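(* Let $f:\mathbb{R}\to\mathbb{R}$ satisfy condition (F) and let $\{X(t);\,t\in[0,1]\}$ be a real-valued stochastic process with independent increments, $X(0)=0$, satisfying $$\mathbb{E} f\big(t^{-1/2}[X(t+s)-X(s)]\big)=\mathbb{E} f(W)\qquad\text{for all } s\ge 0,\ t>0 \text{ with } s+t\le 1.$$ Then $\{X(t);\,t\in[0,1]\}$ is a standard Brownian motion.
   Context: Condition (F) on $f:\mathbb{R}\to\mathbb{R}$: $f$ is symmetric ($f(-x)=f(x)$), continuous, convex, strictly increasing on $\mathbb{R}^+$, $f(0)=0$, and there exist $p\in[1,2)$ and $K_0\ge 0$ such that $f(Kx)\le K^p f(x)$ for all $K\ge K_0$ and all $x>0$. $W$ is a standard normal random variable. A standard Brownian motion on $[0,1]$ means a Gaussian process $\{W(t);\,t\in[0,1]\}$ with independent increments, $\mathbb{E}[W(t)]=0$ and $\mathbb{E}[W(t)W(s)]=\min(t,s)$ (no sample path properties are required). *)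

theory Defs
  imports "HOL-Probability.Probability"
begin

definition condition_F :: "(real \<Rightarrow> real) \<Rightarrow> bool" where
  "condition_F f \<longleftrightarrow>
     (\<forall>x. f (- x) = f x) \<and>
     continuous_on UNIV f \<and>
     convex_on UNIV f \<and>
     strict_mono_on {0<..} f \<and>
     f 0 = 0 \<and>
     (\<exists>p K\<^sub>0. 1 \<le> p \<and> p < 2 \<and> 0 \<le> K\<^sub>0 \<and>
        (\<forall>K\<ge>K\<^sub>0. \<forall>x>0. f (K * x) \<le> K powr p * f x))"

text \<open>A process is a family of functions indexed by all reals, of which only the members with
  index in the time set \<open>T\<close> are constrained.\<close>

definition real_process :: "'a measure \<Rightarrow> real set \<Rightarrow> (real \<Rightarrow> 'a \<Rightarrow> real) \<Rightarrow> bool" where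
  "real_process M T X \<longleftrightarrow> prob_space M \<and> (\<forall>t\<in>T. X t \<in> borel_measurable M)"

definition independent_increments :: "'a measure \<Rightarrow> real set \<Rightarrow> (real \<Rightarrow> 'a \<Rightarrow> real) \<Rightarrow> bool" where
  "independent_increments M T X \<longleftrightarrow>
     (\<forall>(n::nat) \<tau>. \<tau> ` {..n} \<subseteq> T \<and> strict_mono_on {..n} \<tau> \<longrightarrow>
        prob_space.indep_vars M (\<lambda>_. borel)
          (\<lambda>i \<omega>. X (\<tau> (Suc i)) \<omega> - X (\<tau> i) \<omega>) {..<n})"

text \<open>Point masses count as Gaussian, with variance zero.\<close>

definition gaussian_rv :: "'a measure \<Rightarrow> ('a \<Rightarrow> real) \<Rightarrow> bool" where
  "gaussian_rv M Y \<longleftrightarrow> Y \<in> borel_measurable M \<and>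
     ((\<exists>\<mu> \<sigma>. \<sigma> > 0 \<and> distributed M lborel Y (normal_density \<mu> \<sigma>)) \<or>
      (\<exists>\<mu>. AE \<omega> in M. Y \<omega> = \<mu>))"

text \<open>The finite-dimensional distributions are jointly Gaussian, i.e. all linear combinations of
  finitely many members are Gaussian.\<close>

definition gaussian_process :: "'a measure \<Rightarrow> real set \<Rightarrow> (real \<Rightarrow> 'a \<Rightarrow> real) \<Rightarrow> bool" where
  "gaussian_process M T X \<longleftrightarrow> real_process M T X \<and>
     (\<forall>J a. finite J \<and> J \<subseteq> T \<longrightarrow> gaussian_rv M (\<lambda>\<omega>. \<Sum>t\<in>J. a t * X t \<omega>))"

text \<open>No path regularity is required. Gaussianity makes the two expectations below genuine,
  so that the default value \<open>0\<close> of the integral of a non-integrable function plays no role.\<close>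

definition standard_brownian_motion :: "'a measure \<Rightarrow> (real \<Rightarrow> 'a \<Rightarrow> real) \<Rightarrow> bool" where
  "standard_brownian_motion M X \<longleftrightarrow>
     gaussian_process M {0..1} X \<and>
     independent_increments M {0..1} X \<and>
     (\<forall>t\<in>{0..1}. (\<integral>\<omega>. X t \<omega> \<partial>M) = 0) \<and>
     (\<forall>s\<in>{0..1}. \<forall>t\<in>{0..1}. (\<integral>\<omega>. X t \<omega> * X s \<omega> \<partial>M) = min t s)"

end

theory Submission
  imports Defs
begin

text \<open>
  Let \<open>G v x\<close> be the expectation of \<open>f (x + sqrt v * W)\<close>. Split the unit interval into \<open>2 ^ N\<close> pieces and
  centre the increments. Swapping a centred increment for a Gaussian one of the same truncated variance
  changes the expectation of \<open>G\<close> by little, except for a contribution of the large jumps, which is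
  nonnegative by convexity. Since \<open>p < 2\<close>, a jump is visible in the energy only at scales comparable to
  its size, so at most scales almost all dyadic intervals carry no large jumps and the energy condition
  puts their normalised drift \<open>\<mu>\<close> and variance \<open>v\<close> close to the curve \<open>G v \<mu> = G 1 0\<close>. The variances form
  a bounded dyadic martingale, so \<open>v\<close> is nearly the same on an interval and its halves at some scale;
  hence so is the modulus of the drift, and additivity of the drift under halving forces \<open>\<mu>\<close> near \<open>0\<close>
  and \<open>v\<close> near \<open>1\<close>. Thus the truncated variances add up to the full variance, and swapping over the unit
  interval, where the total energy is prescribed, leaves no room for large jumps: the Lindeberg
  condition holds and increments are Gaussian.
\<close>

subsection \<open>Functions satisfying condition (F)\<close>

text \<open>Hence steps are truncated, and the a priori bound concerns \<open>Q\<close>, which is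
  quadratic only near the origin. Nor is \<open>f\<close> smooth; smoothing it by variance
  \<open>l\<^sup>2\<close> costs order \<open>l\<close>, but the Taylor constants then depend on
  \<open>l\<close>. This dictates the order of the choices: \<open>l\<close>, then the cut-offs,
  then the tolerated energy of large jumps. At the last stage the gain from large jumps must not
  depend on \<open>l\<close>, because \<open>l\<close> is chosen small against it. It does not as
  long as later Gaussian steps supply a fixed amount of variance, so large jumps are excluded only
  on the first half of the interval. The second half is reached by running time backwards, which the
  energy condition permits because \<open>f\<close> is even. The drift is identified last, from the
  energy of a half whose centred law is already known.\<close>

lemma mult_ge_right: "1 \<le> a \<Longrightarrow> 0 \<le> b \<Longrightarrow> b \<le> a * b" for a b :: real
  using mult_right_mono[of 1 a b] by simp

text \<open>Dilation factors below the threshold \<open>K\<^sub>0\<close> are absorbed by the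
  constant \<open>D\<close>. Strict monotonicity is kept only as positivity off the origin;
  monotonicity itself returns from convexity in \<open>mono\<close>.\<close>

locale energy =
  fixes f :: "real \<Rightarrow> real" and p D :: real
  assumes even: "f (- x) = f x"
    and cont: "continuous_on UNIV f"
    and conv: "convex_on UNIV f"
    and zero [simp]: "f 0 = 0"
    and pos: "x \<noteq> 0 \<Longrightarrow> 0 < f x"
    and p: "1 \<le> p" "p < 2" and D: "1 \<le> D"
    and dil: "1 \<le> K \<Longrightarrow> f (K * x) \<le> D * K powr p * f x"

lemma condition_F_energy:
  assumes "condition_F f"
  obtains p D where "energy f p D"
proof -
  from assms obtain p K where F: "\<And>x. f (- x) = f x" "continuous_on UNIV f" "convex_on UNIV f"
      "strict_mono_on {0<..} f" "f 0 = 0" "1 \<le> p" "p < 2" "0 \<le> K"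
    and K: "\<And>L x. L \<ge> K \<Longrightarrow> x > 0 \<Longrightarrow> f (L * x) \<le> L powr p * f x"
    unfolding condition_F_def by blast
  have half: "f (c * x) \<le> c * f x" if "0 \<le> c" "c \<le> 1" for c x
    using convex_onD[OF F(3), of c 0 x] that F(5) by simp
  have pos': "0 < f x" if "0 < x" for x
  proof -
    have "f (x / 2) < f x" using that F(4) by (auto simp: strict_mono_on_def)
    \<comment> \<open>Strict growth is known only on the open half-line, so it says nothing about
      \<open>f 0\<close>; midpoint convexity between \<open>x / 2\<close> and \<open>- x / 2\<close>
      makes the comparison.\<close>
    moreover have "0 \<le> f (x / 2)"
      using convex_onD[OF F(3), of "1/2" "x/2" "- (x/2)"] F(1)[of "x/2"] F(5) by simp
    ultimately show ?thesis by simp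
  qed
  have pos: "0 < f x" if "x \<noteq> 0" for x
    using pos'[of x] pos'[of "- x"] that F(1)[of x] by (cases "x > 0") auto
  define K1 where "K1 = max 1 K"
  \<comment> \<open>For \<open>1 \<le> L < K1\<close> the chain
    \<open>f (L * x) \<le> f (K1 * x) \<le> K1 powr p * f x\<close> fixes this constant.\<close>
  define D where "D = K1 powr p"
  have K1: "K1 \<ge> 1" "K1 \<ge> K" by (auto simp: K1_def)
  have D: "1 \<le> D" using K1 F(6) by (auto simp: D_def intro: ge_one_powr_ge_zero)
  have dil': "f (L * x) \<le> D * L powr p * f x" if "1 \<le> L" "x > 0" for L x
  proof (cases "L \<ge> K1")
    case True
    have "f (L * x) \<le> L powr p * f x" using K[of L x] True K1 that by auto
    also have "\<dots> \<le> D * (L powr p * f x)"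
      using D pos[of x] that by (intro mult_ge_right mult_nonneg_nonneg) auto
    finally show ?thesis by (simp add: mult_ac)
  next
    case False
    have "f (L * x) = f (L / K1 * (K1 * x))" using K1 by simp
    also have "\<dots> \<le> L / K1 * f (K1 * x)" using False that K1 by (intro half) auto
    also have "\<dots> \<le> 1 * f (K1 * x)" using False that K1 pos[of "K1 * x"]
      by (intro mult_right_mono) auto
    also have "\<dots> \<le> D * f x" using K[of K1 x] K1 that by (auto simp: D_def)
    also have "\<dots> \<le> D * (L powr p * f x)"
      using D pos[of x] that F(6) by (intro mult_left_mono mult_ge_right ge_one_powr_ge_zero) auto
    finally show ?thesis by (simp add: mult_ac)
  qed
  have "energy f p D"
  proof
    fix L x :: real assume L: "1 \<le> L"
    consider "x > 0" | "x = 0" | "- x > 0" by linarith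
    then show "f (L * x) \<le> D * L powr p * f x"
    proof cases
      case 3 then show ?thesis using dil'[OF L, of "- x"] F(1)[of x] F(1)[of "L * x"] by simp
    qed (use dil'[OF L] F(5) in auto)
  qed (use F pos D in auto)
  then show ?thesis using that by blast
qed

section \<open>Gaussian integrals with exponential weights\<close>

abbreviation std_normal :: "real measure" where "std_normal \<equiv> std_normal_distribution"

interpretation std_normal: real_distribution std_normal by (rule real_dist_normal_dist)

text \<open>Completing the square: \<open>exp (c * w)\<close> times the standard density is a
  multiple of the normal density with mean \<open>c\<close>.\<close>

lemma integrable_std_normal_exp: "integrable std_normal (\<lambda>w. exp (c * \<bar>w\<bar>))"
proof -
  have *: "integrable std_normal (\<lambda>w. exp (c * w))" for c :: real
  proof -
    have "(\<lambda>w. std_normal_density w * exp (c * w)) = (\<lambda>w. exp (c\<^sup>2/2) * normal_density c 1 w)"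
      by (auto simp: std_normal_density_def normal_density_def exp_add[symmetric] fun_eq_iff
          power2_eq_square field_simps)
    moreover have "integrable lborel (\<lambda>w. exp (c\<^sup>2/2) * normal_density c 1 w)" by simp
    ultimately have "integrable lborel (\<lambda>w. std_normal_density w *\<^sub>R exp (c * w))" by simp
    then show ?thesis by (subst integrable_density) auto
  qed
  show ?thesis
  proof (rule Bochner_Integration.integrable_bound[OF Bochner_Integration.integrable_add[OF *[of c] *[of "- c"]]])
    show "AE w in std_normal. norm (exp (c * \<bar>w\<bar>)) \<le> norm (exp (c * w) + exp (- c * w))"
    proof (rule AE_I2)
      fix w :: real
      have "exp (c * \<bar>w\<bar>) \<le> exp (c * w) + exp (- c * w)" by (cases "w \<ge> 0") auto
      then show "norm (exp (c * \<bar>w\<bar>)) \<le> norm (exp (c * w) + exp (- c * w))"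
        by (simp add: add_nonneg_nonneg)
    qed
  qed auto
qed

lemma integrable_std_normal_dominated:
  assumes [measurable]: "g \<in> borel_measurable borel" and "\<And>w. \<bar>g w\<bar> \<le> K * exp (c * \<bar>w\<bar>)"
  shows "integrable std_normal g"
proof (rule Bochner_Integration.integrable_bound)
  show "integrable std_normal (\<lambda>w. K * exp (c * \<bar>w\<bar>))" by (intro integrable_mult_right integrable_std_normal_exp)
  show "AE w in std_normal. norm (g w) \<le> norm (K * exp (c * \<bar>w\<bar>))"
    using assms(2) by (auto intro!: AE_I2 order_trans[OF assms(2)])
qed auto

lemma poly_le_exp:
  fixes t :: real assumes "0 \<le> t"
  shows "1 + t\<^sup>2 \<le> 2 * exp t" "t ^ 3 \<le> 6 * exp t" "t \<le> exp t"
proof -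
  have E: "(\<Sum>k<4. t ^ k / fact k) \<le> exp t"
  proof -
    have "(\<Sum>k<4. t ^ k / fact k) \<le> (\<Sum>k. t ^ k / fact k)"
      using assms by (intro sum_le_suminf) (auto intro: summable_exp_generic[of t, simplified] 
        simp: divide_inverse mult.commute summable_exp)
    then show ?thesis by (simp add: exp_def divide_inverse mult.commute)
  qed
  then have E: "1 + t + t^2/2 + t^3/6 \<le> exp t"
    by (simp add: eval_nat_numeral lessThan_Suc fact_numeral)
  have "0 \<le> t\<^sup>2" "0 \<le> t^3" using assms by auto
  with E assms show "1 + t\<^sup>2 \<le> 2 * exp t" "t ^ 3 \<le> 6 * exp t" "t \<le> exp t" by linarith+
qed

section \<open>Growth and regularity of \<open>f\<close>\<close>

context energy
begin

lemma measurable_f [measurable]: "f \<in> borel_measurable borel"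
  using cont by (rule borel_measurable_continuous_onI)

lemma nonneg [simp]: "0 \<le> f x"
  using pos[of x] by (cases "x = 0") auto

lemma f_pos_iff: "0 < f x \<longleftrightarrow> x \<noteq> 0" using pos by auto

lemma f_abs [simp]: "f \<bar>x\<bar> = f x" by (auto simp: abs_if even)

text \<open>Star-shapedness. Monotonicity, linear growth and the slope bound \<open>f_slope\<close>
  are drawn from it.\<close>

lemma star: "0 \<le> c \<Longrightarrow> c \<le> 1 \<Longrightarrow> f (c * x) \<le> c * f x"
  using convex_onD[OF conv, of c 0 x] by simp

lemma mono: assumes "\<bar>x\<bar> \<le> \<bar>y\<bar>" shows "f x \<le> f y"
proof (cases "y = 0")
  case False
  have "f x = f (\<bar>x\<bar> / \<bar>y\<bar> * \<bar>y\<bar>)" using False by simp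
  also have "\<dots> \<le> \<bar>x\<bar> / \<bar>y\<bar> * f \<bar>y\<bar>" using assms False by (intro star) auto
  also have "\<dots> \<le> 1 * f \<bar>y\<bar>" using assms False by (intro mult_right_mono) auto
  finally show ?thesis by simp
qed (use assms in auto)

lemma f_ge_linear: assumes "1 \<le> \<bar>x\<bar>" shows "f 1 * \<bar>x\<bar> \<le> f x"
proof -
  have "f (inverse \<bar>x\<bar> * \<bar>x\<bar>) \<le> inverse \<bar>x\<bar> * f \<bar>x\<bar>" using assms by (intro star) (auto simp: field_simps)
  moreover have "inverse \<bar>x\<bar> * \<bar>x\<bar> = 1" using assms by (auto simp: field_simps)
  ultimately show ?thesis using assms by (simp add: field_simps)
qed

lemma abs_le_f: "\<bar>x\<bar> \<le> 1 + f x / f 1"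
proof (cases "1 \<le> \<bar>x\<bar>")
  case True
  then show ?thesis using f_ge_linear[OF True] pos[of 1] by (simp add: field_simps)
next
  case False
  have "0 \<le> f x / f 1" by simp
  then show ?thesis using False by linarith
qed

lemma f_two: "f (2 * x) \<le> 4 * D * f x"
proof -
  have "f (2 * x) \<le> D * 2 powr p * f x" by (rule dil) auto
  also have "\<dots> \<le> D * 2 powr 2 * f x"
    using p D by (intro mult_right_mono mult_left_mono powr_mono) auto
  finally show ?thesis by simp
qed

lemma f_add: "f (x + y) \<le> 2 * D * (f x + f y)"
proof -
  have "f (x + y) \<le> (f (2 * x) + f (2 * y)) / 2"
    using convex_onD[OF conv, of "1/2" "2*x" "2*y"] by (simp add: field_simps)
  with f_two[of x] f_two[of y] show ?thesis by (simp add: field_simps)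
qed

lemma f_le_square: assumes "1 \<le> \<bar>x\<bar>" shows "f x \<le> D * f 1 * x\<^sup>2"
proof -
  have "f x = f (\<bar>x\<bar> * 1)" by simp
  also have "\<dots> \<le> D * \<bar>x\<bar> powr p * f 1" using assms by (rule dil)
  also have "\<dots> \<le> D * \<bar>x\<bar> powr 2 * f 1"
    using p D assms by (intro mult_right_mono mult_left_mono powr_mono) auto
  also have "\<bar>x\<bar> powr 2 = x\<^sup>2" using assms by (subst powr_numeral) auto
  finally show ?thesis by (simp add: mult_ac)
qed

lemma f_le: "f x \<le> D * f 1 * (1 + x\<^sup>2)"
proof (cases "1 \<le> \<bar>x\<bar>")
  case True
  have "0 \<le> D * f 1" using D by simp
  then show ?thesis using f_le_square[OF True] by (simp add: distrib_left)
next
  case False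
  then have "f x \<le> f 1" by (intro mono) auto
  also have "\<dots> \<le> D * f 1" using D mult_right_mono[of 1 D "f 1"] by simp
  also have "\<dots> \<le> D * f 1 * (1 + x\<^sup>2)"
    using D mult_left_mono[of 1 "1 + x\<^sup>2" "D * f 1"] by simp
  finally show ?thesis .
qed

text \<open>Convexity between \<open>x\<close> and \<open>2 * x\<close> refines the crude doubling
  bound to a factor that tends to \<open>1\<close> linearly as \<open>s\<close> tends to
  \<open>1\<close>; \<open>G_small\<close> rests on this rate.\<close>

lemma f_stretch: assumes "1 \<le> s" "s \<le> 2" shows "f (s * x) \<le> (1 + 4 * D * (s - 1)) * f x"
proof -
  have "f (s * x) \<le> (2 - s) * f x + (s - 1) * f (2 * x)"
    using convex_onD[OF conv, of "s - 1" x "2 * x"] assms by (simp add: algebra_simps)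
  also have "\<dots> \<le> 1 * f x + (s - 1) * (4 * D * f x)"
    using assms f_two[of x] by (intro add_mono mult_left_mono mult_right_mono) auto
  finally show ?thesis by (simp add: algebra_simps)
qed

text \<open>A dominating function for the Gaussian integrals below. It separates the position
  \<open>x\<close> from the noise \<open>w\<close> and is uniform in the scale \<open>s\<close>, as
  uniform constants over a range of variances require.\<close>

lemma f_shift_exp:
  assumes "0 \<le> s" "s \<le> s1"
  shows "f (x + s * w) \<le> 2 * D * (1 + 2 * D * f 1 * (1 + s1\<^sup>2)) * (1 + f x) * exp \<bar>w\<bar>"
proof -
  define A where "A = D * f 1 * (1 + s1\<^sup>2)"
  have A: "0 \<le> A" using D by (simp add: A_def)
  have "s\<^sup>2 \<le> s1\<^sup>2" using assms by (intro power_mono) auto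
  then have "s\<^sup>2 * w\<^sup>2 \<le> s1\<^sup>2 * w\<^sup>2" by (intro mult_right_mono) auto
  then have "1 + (s*w)\<^sup>2 \<le> (1 + s1\<^sup>2) * (1 + w\<^sup>2)"
    using zero_le_power2[of w] zero_le_power2[of s1]
    unfolding power_mult_distrib distrib_left distrib_right by linarith
  then have "D * f 1 * (1 + (s*w)\<^sup>2) \<le> D * f 1 * ((1 + s1\<^sup>2) * (1 + w\<^sup>2))"
    using D by (intro mult_left_mono) auto
  with f_le[of "s*w"] have "f (s*w) \<le> A * (1 + w\<^sup>2)" by (simp add: A_def mult.assoc)
  also have "\<dots> \<le> A * (2 * exp \<bar>w\<bar>)" using poly_le_exp(1)[of "\<bar>w\<bar>"] A by (intro mult_left_mono) auto
  finally have "f x + f (s*w) \<le> f x * exp \<bar>w\<bar> + 2 * A * exp \<bar>w\<bar>"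
    using mult_left_mono[of 1 "exp \<bar>w\<bar>" "f x"] by simp
  also have "\<dots> \<le> (1 + 2*A) * (1 + f x) * exp \<bar>w\<bar>"
    using A by (simp add: algebra_simps)
  finally have "2 * D * (f x + f (s*w)) \<le> 2 * D * ((1 + 2*A) * (1 + f x) * exp \<bar>w\<bar>)"
    using D by (intro mult_left_mono) auto
  with f_add[of x "s*w"] show ?thesis by (simp add: A_def mult.assoc)
qed

end

subsection \<open>Gaussian smoothing of \<open>f\<close>\<close>

lemma measure_std_normal_UNIV [simp]: "measure std_normal UNIV = 1"
  using std_normal.prob_space by simp

lemma std_normal_integral_uminus: "(\<integral>w. g (- w) \<partial>std_normal) = (\<integral>w. g w \<partial>std_normal)" if [measurable]: "g \<in> borel_measurable borel"
  for g :: "real \<Rightarrow> real"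
proof -
  have "(\<integral>w. g w \<partial>std_normal) = (\<integral>w. std_normal_density w * g w \<partial>lborel)"
    by (subst integral_density) auto
  also have "\<dots> = (\<integral>w. std_normal_density (- w) * g (- w) \<partial>lborel)"
    using lborel_integral_real_affine[of "- 1" "\<lambda>w. std_normal_density w * g w" 0] by simp
  also have "\<dots> = (\<integral>w. std_normal_density w * g (- w) \<partial>lborel)"
    by (simp add: std_normal_density_def)
  also have "\<dots> = (\<integral>w. g (- w) \<partial>std_normal)" by (subst integral_density) auto
  finally show ?thesis by simp
qed

text \<open>The Cameron-Martin formula in dimension one: a shift of the argument becomes a smooth
  kernel.\<close>

lemma std_normal_integral_shift:
  fixes g :: "real \<Rightarrow> real"
  assumes [measurable]: "g \<in> borel_measurable borel"
  shows "(\<integral>w. g (w + r) \<partial>std_normal) = (\<integral>w. g w * exp (r * w - r\<^sup>2 / 2) \<partial>std_normal)"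
proof -
  have *: "std_normal_density (w - r) = std_normal_density w * exp (r * w - r\<^sup>2 / 2)" for w
    by (simp add: std_normal_density_def exp_add[symmetric] power2_eq_square field_simps)
  have "(\<integral>w. g (w + r) \<partial>std_normal) = (\<integral>w. std_normal_density w * g (w + r) \<partial>lborel)"
    by (subst integral_density) auto
  also have "\<dots> = (\<integral>w. std_normal_density (w - r) * g w \<partial>lborel)"
    using lborel_integral_real_affine[of 1 "\<lambda>w. std_normal_density w * g (w + r)" "- r"] by simp
  also have "\<dots> = (\<integral>w. g w * exp (r * w - r\<^sup>2 / 2) \<partial>std_normal)"
    by (subst integral_density) (auto simp: * mult_ac)
  finally show ?thesis .
qed

text \<open>The law of a sum of two independent centred normals, identified by characteristic
  functions. It yields the semigroup property \<open>G_add\<close>.\<close>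

lemma distr_std_normal_pair:
  "distr (std_normal \<Otimes>\<^sub>M std_normal) borel (\<lambda>(a, b). s * a + t * b) = distr std_normal borel (\<lambda>w. sqrt (s\<^sup>2 + t\<^sup>2) * w)"
proof (rule Levy_uniqueness)
  interpret P: pair_prob_space std_normal std_normal ..
  show "real_distribution (distr (std_normal \<Otimes>\<^sub>M std_normal) borel (\<lambda>(a, b). s * a + t * b))"
    by (intro P.real_distribution_distr) auto
  show "real_distribution (distr std_normal borel (\<lambda>w. sqrt (s\<^sup>2 + t\<^sup>2) * w))"
    by (intro std_normal.real_distribution_distr) auto
  have sc: "(CLINT a|std_normal. iexp (u * (r * a))) = exp (- (u * r)\<^sup>2 / 2)" for u r
    using fun_cong[OF char_std_normal_distribution, of "u * r"] by (simp add: char_def mult.assoc)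
  show "char (distr (std_normal \<Otimes>\<^sub>M std_normal) borel (\<lambda>(a, b). s * a + t * b)) =
    char (distr std_normal borel (\<lambda>w. sqrt (s\<^sup>2 + t\<^sup>2) * w))"
  proof
    fix u
    have int: "integrable (std_normal \<Otimes>\<^sub>M std_normal) (\<lambda>(a, b). iexp (u * (s * a + t * b)))"
      by (rule P.P.integrable_const_bound[where B = 1]) (auto simp: split_beta')
    have "char (distr (std_normal \<Otimes>\<^sub>M std_normal) borel (\<lambda>(a, b). s * a + t * b)) u
        = (\<integral>z. (case z of (a, b) \<Rightarrow> iexp (u * (s * a + t * b))) \<partial>(std_normal \<Otimes>\<^sub>M std_normal))"
      by (simp add: char_def integral_distr split_beta')
    also have "\<dots> = (CLINT a|std_normal. CLINT b|std_normal. iexp (u * (s * a + t * b)))"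
      using P.integral_fst'[OF int] by simp
    also have "\<dots> = (CLINT a|std_normal. CLINT b|std_normal. iexp (u * (s * a)) * iexp (u * (t * b)))"
      by (simp add: distrib_left exp_add[symmetric])
    also have "\<dots> = exp (- (u * s)\<^sup>2 / 2) * exp (- (u * t)\<^sup>2 / 2)"
      using sc[of u s] sc[of u t] by simp
    also have "\<dots> = complex_of_real (exp (- (u * sqrt (s\<^sup>2 + t\<^sup>2))\<^sup>2 / 2))"
      by (simp add: exp_add[symmetric] of_real_exp power_mult_distrib field_simps)
    also have "\<dots> = char (distr std_normal borel (\<lambda>w. sqrt (s\<^sup>2 + t\<^sup>2) * w)) u"
      using sc[of u "sqrt (s\<^sup>2 + t\<^sup>2)"] by (simp add: char_def integral_distr)
    finally show "char (distr (std_normal \<Otimes>\<^sub>M std_normal) borel (\<lambda>(a, b). s * a + t * b)) u =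
      char (distr std_normal borel (\<lambda>w. sqrt (s\<^sup>2 + t\<^sup>2) * w)) u" .
  qed
qed

lemma exp_taylor2: "\<bar>exp z - 1 - z - z\<^sup>2 / 2\<bar> \<le> \<bar>z\<bar> ^ 3 * exp \<bar>z\<bar>" for z :: real
proof -
  obtain t where t: "\<bar>t\<bar> \<le> \<bar>z\<bar>" "exp z = (\<Sum>m<3. z ^ m / fact m) + exp t / fact 3 * z ^ 3"
    using Maclaurin_exp_le[of z 3] by blast
  have "exp z - 1 - z - z\<^sup>2 / 2 = exp t / 6 * z ^ 3"
    unfolding t(2) by (simp add: eval_nat_numeral lessThan_Suc fact_numeral)
  then have "\<bar>exp z - 1 - z - z\<^sup>2 / 2\<bar> = exp t / 6 * \<bar>z\<bar> ^ 3" by (simp only: abs_mult power_abs) simp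
  also have "\<dots> \<le> exp \<bar>z\<bar> * \<bar>z\<bar> ^ 3"
  proof (intro mult_right_mono)
    have "exp t \<le> exp \<bar>z\<bar>" using t(1) by simp
    then show "exp t / 6 \<le> exp \<bar>z\<bar>" using exp_ge_zero[of "\<bar>z\<bar>"] by linarith
  qed auto
  finally show ?thesis by (simp add: mult.commute)
qed

text \<open>Second-order expansion in \<open>r\<close> of the Cameron-Martin density, whose
  coefficients are the Hermite polynomials \<open>w\<close> and \<open>w\<^sup>2 - 1\<close>. The
  bound \<open>\<rho>\<close> makes the exponential weight in the error the same for all
  shifts.\<close>

lemma kernel_taylor:
  fixes r \<rho> w :: real
  assumes r: "\<bar>r\<bar> \<le> \<rho>"
  shows "\<bar>exp (r * w - r\<^sup>2 / 2) - 1 - r * w - r\<^sup>2 * (w\<^sup>2 - 1) / 2\<bar>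
    \<le> 8 * \<bar>r\<bar> ^ 3 * exp ((\<rho> + 1) * (\<bar>w\<bar> + \<rho>))"
proof -
  define z where "z = r * w - r\<^sup>2 / 2"
  define t where "t = \<bar>w\<bar> + \<rho>"
  have t: "0 \<le> t" "0 \<le> \<rho>" using r by (auto simp: t_def)
  have r2: "r\<^sup>2 = \<bar>r\<bar> * \<bar>r\<bar>" by (simp add: power2_eq_square)
  have z: "\<bar>z\<bar> \<le> \<bar>r\<bar> * t"
  proof -
    have "\<bar>z\<bar> \<le> \<bar>r * w\<bar> + \<bar>r\<^sup>2 / 2\<bar>" unfolding z_def by (rule abs_triangle_ineq4)
    also have "\<bar>r\<^sup>2 / 2\<bar> = \<bar>r\<bar> * (\<bar>r\<bar> / 2)" by (simp add: r2)
    also have "\<bar>r * w\<bar> + \<bar>r\<bar> * (\<bar>r\<bar> / 2) = \<bar>r\<bar> * (\<bar>w\<bar> + \<bar>r\<bar> / 2)"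
      by (simp add: abs_mult distrib_left)
    also have "\<dots> \<le> \<bar>r\<bar> * t" using r by (intro mult_left_mono) (auto simp: t_def)
    finally show ?thesis .
  qed
  have zt: "\<bar>z\<bar> \<le> \<rho> * t" using z r t by (meson mult_right_mono order_trans)
  \<comment> \<open>Expanding \<open>z\<^sup>2 / 2\<close> leaves exactly two terms of order higher
    than two in \<open>r\<close>.\<close>
  have "exp (r * w - r\<^sup>2 / 2) - 1 - r * w - r\<^sup>2 * (w\<^sup>2 - 1) / 2
      = (exp z - 1 - z - z\<^sup>2 / 2) + (r ^ 4 / 8 - r ^ 3 * w / 2)"
    by (simp add: z_def power2_eq_square field_simps eval_nat_numeral)
  also have "\<bar>\<dots>\<bar> \<le> \<bar>exp z - 1 - z - z\<^sup>2 / 2\<bar> + \<bar>r ^ 4 / 8 - r ^ 3 * w / 2\<bar>"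
    by (rule abs_triangle_ineq)
  also have "\<bar>exp z - 1 - z - z\<^sup>2 / 2\<bar> \<le> (\<bar>r\<bar> * t) ^ 3 * exp (\<rho> * t)"
    using z zt by (intro order_trans[OF exp_taylor2] mult_mono power_mono) auto
  also have "\<dots> \<le> \<bar>r\<bar> ^ 3 * (6 * exp t) * exp (\<rho> * t)"
    unfolding power_mult_distrib using poly_le_exp(2)[OF t(1)] by (intro mult_right_mono mult_left_mono) auto
  also have "\<dots> = 6 * \<bar>r\<bar> ^ 3 * exp ((\<rho> + 1) * t)" by (simp add: exp_add[symmetric] algebra_simps)
  also have "\<bar>r ^ 4 / 8 - r ^ 3 * w / 2\<bar> \<le> \<bar>r\<bar> ^ 3 * \<bar>r\<bar> / 8 + \<bar>r\<bar> ^ 3 * \<bar>w\<bar> / 2"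
    by (rule order_trans[OF abs_triangle_ineq4]) (simp add: abs_mult power_abs eval_nat_numeral)
  also have "\<dots> = \<bar>r\<bar> ^ 3 * (\<bar>r\<bar> / 8 + \<bar>w\<bar> / 2)" by (simp add: algebra_simps)
  also have "\<dots> \<le> \<bar>r\<bar> ^ 3 * t" using r t(2) by (intro mult_left_mono) (auto simp: t_def)
  also have "\<dots> \<le> \<bar>r\<bar> ^ 3 * exp ((\<rho> + 1) * t)"
  proof (intro mult_left_mono)
    have "t \<le> exp t" by (rule poly_le_exp(3)[OF t(1)])
    also have "\<dots> \<le> exp ((\<rho> + 1) * t)" using t by (simp add: distrib_right)
    finally show "t \<le> exp ((\<rho> + 1) * t)" .
  qed auto
  finally have "\<bar>exp (r * w - r\<^sup>2 / 2) - 1 - r * w - r\<^sup>2 * (w\<^sup>2 - 1) / 2\<bar>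
     \<le> 6 * \<bar>r\<bar> ^ 3 * exp ((\<rho> + 1) * t) + \<bar>r\<bar> ^ 3 * exp ((\<rho> + 1) * t)" by simp
  also have "\<dots> = 7 * (\<bar>r\<bar> ^ 3 * exp ((\<rho> + 1) * t))" by simp
  also have "\<dots> \<le> 8 * (\<bar>r\<bar> ^ 3 * exp ((\<rho> + 1) * t))" by (intro mult_right_mono) auto
  finally show ?thesis by (simp add: t_def)
qed

lemma exp_split: "exp ((1 + c) * t) = exp t * exp (c * t)" for c t :: real
  by (simp add: exp_add[symmetric] distrib_right)

context energy
begin

text \<open>The heat flow of \<open>f\<close> with the variance as time; \<open>G 1 0\<close> is the
  prescribed energy of a normalised increment.\<close>

definition G :: "real \<Rightarrow> real \<Rightarrow> real" where
  "G v x = (\<integral>w. f (x + sqrt v * w) \<partial>std_normal)"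

text \<open>The first two derivatives of \<open>G v\<close>, with the differentiation moved onto the Gaussian kernel, so
  that no smoothness of \<open>f\<close> is needed.\<close>

definition Gx :: "real \<Rightarrow> real \<Rightarrow> real" where
  "Gx v x = (\<integral>w. f (x + sqrt v * w) * w \<partial>std_normal) / sqrt v"

definition Gxx :: "real \<Rightarrow> real \<Rightarrow> real" where
  "Gxx v x = (\<integral>w. f (x + sqrt v * w) * (w\<^sup>2 - 1) \<partial>std_normal) / v"

text \<open>The Bregman divergence of \<open>G v\<close>. For a centred step independent of the
  position the linear term averages out, so the mean of \<open>B\<close> is the energy gained in the
  step.\<close>

definition B :: "real \<Rightarrow> real \<Rightarrow> real \<Rightarrow> real" where
  "B v x u = G v (x + u) - G v x - Gx v x * u"

lemma measurable_G [measurable]: "G v \<in> borel_measurable borel"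
  and measurable_Gx [measurable]: "Gx v \<in> borel_measurable borel"
  and measurable_Gxx [measurable]: "Gxx v \<in> borel_measurable borel"
  unfolding G_def[abs_def] Gx_def[abs_def] Gxx_def[abs_def] by measurable

lemma integrable_f_exp:
  assumes [measurable]: "g \<in> borel_measurable borel" and g: "\<And>w. \<bar>g w\<bar> \<le> K * exp (c * \<bar>w\<bar>)"
    and v: "0 \<le> v"
  shows "integrable std_normal (\<lambda>w. f (x + sqrt v * w) * g w)"
proof -
  let ?C = "2 * D * (1 + 2 * D * f 1 * (1 + (sqrt v)\<^sup>2)) * (1 + f x)"
  show ?thesis
  proof (rule integrable_std_normal_dominated[where K = "?C * K" and c = "1 + c"])
    fix w
    have "\<bar>f (x + sqrt v * w) * g w\<bar> \<le> (?C * exp \<bar>w\<bar>) * (K * exp (c * \<bar>w\<bar>))"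
      unfolding abs_mult using f_shift_exp[of "sqrt v" "sqrt v" x w] g[of w] v D
      by (intro mult_mono) auto
    also have "\<dots> = ?C * K * exp ((1 + c) * \<bar>w\<bar>)" unfolding exp_split by (simp only: mult_ac)
    finally show "\<bar>f (x + sqrt v * w) * g w\<bar> \<le> ?C * K * exp ((1 + c) * \<bar>w\<bar>)" .
  qed measurable
qed

lemma integrable_G: "0 \<le> v \<Longrightarrow> integrable std_normal (\<lambda>w. f (x + sqrt v * w))"
  using integrable_f_exp[of "\<lambda>_. 1" 1 0 v x] by simp

text \<open>The bound is linear in the size \<open>K\<close> of the kernel: the bounds on
  \<open>G\<close>, \<open>Gx\<close> and \<open>Gxx\<close> use a fixed kernel, the Taylor
  remainder one of size \<open>\<bar>u\<bar> ^ 3\<close>.\<close>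

lemma weighted_bound:
  "\<exists>C\<ge>0. \<forall>v\<in>{0..v1}. \<forall>x K g. 0 \<le> K \<longrightarrow> g \<in> borel_measurable borel \<longrightarrow> (\<forall>w. \<bar>g w\<bar> \<le> K * exp (c * \<bar>w\<bar>))
      \<longrightarrow> \<bar>\<integral>w. f (x + sqrt v * w) * g w \<partial>std_normal\<bar> \<le> C * K * (1 + f x)"
proof -
  let ?A = "2 * D * (1 + 2 * D * f 1 * (1 + (sqrt v1)\<^sup>2))"
  have A: "0 \<le> ?A" using D by simp
  let ?I = "\<integral>w. exp ((1 + c) * \<bar>w\<bar>) \<partial>std_normal"
  have "\<bar>\<integral>w. f (x + sqrt v * w) * g w \<partial>std_normal\<bar> \<le> ?A * ?I * K * (1 + f x)"
    if v: "v \<in> {0..v1}" and K: "0 \<le> K" and [measurable]: "g \<in> borel_measurable borel"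
      and g: "\<forall>w. \<bar>g w\<bar> \<le> K * exp (c * \<bar>w\<bar>)" for v x K g
  proof -
    have "\<bar>\<integral>w. f (x + sqrt v * w) * g w \<partial>std_normal\<bar> \<le> (\<integral>w. \<bar>f (x + sqrt v * w) * g w\<bar> \<partial>std_normal)"
      by (rule integral_abs_bound)
    also have "\<dots> \<le> (\<integral>w. (?A * K * (1 + f x)) * exp ((1 + c) * \<bar>w\<bar>) \<partial>std_normal)"
    proof (rule integral_mono)
      show "integrable std_normal (\<lambda>w. \<bar>f (x + sqrt v * w) * g w\<bar>)"
        using v g by (intro integrable_abs integrable_f_exp[where K = K and c = c]) auto
      show "integrable std_normal (\<lambda>w. (?A * K * (1 + f x)) * exp ((1 + c) * \<bar>w\<bar>))"
        by (intro integrable_mult_right integrable_std_normal_exp)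
      fix w
      have "\<bar>f (x + sqrt v * w) * g w\<bar> \<le> (?A * (1 + f x) * exp \<bar>w\<bar>) * (K * exp (c * \<bar>w\<bar>))"
        unfolding abs_mult using f_shift_exp[of "sqrt v" "sqrt v1" x w] g v A
        by (intro mult_mono) auto
      also have "\<dots> = (?A * K * (1 + f x)) * exp ((1 + c) * \<bar>w\<bar>)"
        unfolding exp_split by (simp only: mult_ac)
      finally show "\<bar>f (x + sqrt v * w) * g w\<bar> \<le> (?A * K * (1 + f x)) * exp ((1 + c) * \<bar>w\<bar>)" .
    qed
    also have "\<dots> = ?A * ?I * K * (1 + f x)" by (simp add: mult_ac)
    finally show ?thesis .
  qed
  moreover have "0 \<le> ?I" by (intro integral_nonneg_AE) auto
  then have "0 \<le> ?A * ?I" by (rule mult_nonneg_nonneg[OF A])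
  ultimately show ?thesis by blast
qed

lemma G_bound: "\<exists>C\<ge>1. \<forall>v\<in>{0..v1}. \<forall>x. G v x \<le> C * (1 + f x)"
proof -
  obtain C where C: "C \<ge> 0" "\<forall>v\<in>{0..v1}. \<forall>x K g. 0 \<le> K \<longrightarrow> g \<in> borel_measurable borel \<longrightarrow> (\<forall>w. \<bar>g w\<bar> \<le> K * exp (0 * \<bar>w\<bar>))
      \<longrightarrow> \<bar>\<integral>w. f (x + sqrt v * w) * g w \<partial>std_normal\<bar> \<le> C * K * (1 + f x)"
    using weighted_bound[of v1 0] by blast
  have "G v x \<le> (C + 1) * (1 + f x)" if "v \<in> {0..v1}" for v x
  proof -
    have "\<bar>\<integral>w. f (x + sqrt v * w) * 1 \<partial>std_normal\<bar> \<le> C * 1 * (1 + f x)"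
      using C(2)[rule_format, OF that, of 1 "\<lambda>_. 1" x] by simp
    also have "C * 1 * (1 + f x) \<le> (C + 1) * (1 + f x)" by (intro mult_right_mono) auto
    finally show ?thesis unfolding G_def by simp
  qed
  then show ?thesis using C(1) by (intro exI[of _ "C + 1"]) auto
qed

lemma G_zero [simp]: "G 0 x = f x" by (simp add: G_def std_normal.prob_space)

lemma G_nonneg [simp]: "0 \<le> G v x" unfolding G_def by (intro integral_nonneg_AE) auto

lemma G_uminus [simp]: "G v (- x) = G v x"
proof -
  have "G v (- x) = (\<integral>w. f (x + sqrt v * (- w)) \<partial>std_normal)"
    unfolding G_def by (rule Bochner_Integration.integral_cong) (auto simp: even[of "x - _", symmetric] algebra_simps)
  also have "\<dots> = G v x" unfolding G_def by (rule std_normal_integral_uminus) measurable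
  finally show ?thesis .
qed

lemma G_abs [simp]: "G v \<bar>x\<bar> = G v x" by (simp add: abs_if)

lemma convex_G: assumes "0 \<le> v" shows "convex_on UNIV (G v)"
proof (rule convex_onI)
  fix t x y :: real assume t: "0 < t" "t < 1"
  have "G v ((1 - t) *\<^sub>R x + t *\<^sub>R y) \<le> (\<integral>w. (1 - t) * f (x + sqrt v * w) + t * f (y + sqrt v * w) \<partial>std_normal)"
    unfolding G_def
  proof (rule integral_mono)
    fix w
    have "(1 - t) *\<^sub>R x + t *\<^sub>R y + sqrt v * w = (1 - t) *\<^sub>R (x + sqrt v * w) + t *\<^sub>R (y + sqrt v * w)"
      by (simp add: algebra_simps)
    then show "f ((1 - t) *\<^sub>R x + t *\<^sub>R y + sqrt v * w) \<le> (1 - t) * f (x + sqrt v * w) + t * f (y + sqrt v * w)"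
      using convex_onD[OF conv, of t "x + sqrt v * w" "y + sqrt v * w"] t by simp
  qed (use assms in \<open>auto intro!: integrable_G\<close>)
  also have "\<dots> = (1 - t) * G v x + t * G v y"
    unfolding G_def using assms by (subst Bochner_Integration.integral_add) (auto intro!: integrable_G)
  finally show "G v ((1 - t) *\<^sub>R x + t *\<^sub>R y) \<le> (1 - t) * G v x + t * G v y" .
qed auto

text \<open>Pairing the noise \<open>w\<close> with \<open>- w\<close> gives Jensen's inequality;
  evenness of \<open>f\<close> and of \<open>G v\<close> identifies the two halves.\<close>

lemma f_le_G: assumes "0 \<le> v" shows "f x \<le> G v x"
proof -
  have int: "integrable std_normal (\<lambda>w. f (x + sqrt v * w))" "integrable std_normal (\<lambda>w. f (- x + sqrt v * w))"
    using integrable_G[OF assms] by blast+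
  have "f x = (\<integral>w. f x \<partial>std_normal)" by (simp add: std_normal.prob_space)
  also have "\<dots> \<le> (\<integral>w. (f (x + sqrt v * w) + f (- x + sqrt v * w)) / 2 \<partial>std_normal)"
  proof (rule integral_mono)
    fix w
    have "f ((1/2) *\<^sub>R (x + sqrt v * w) + (1/2) *\<^sub>R (x - sqrt v * w)) \<le> 1/2 * f (x + sqrt v * w) + 1/2 * f (x - sqrt v * w)"
      using convex_onD[OF conv, of "1/2" "x + sqrt v * w" "x - sqrt v * w"] by simp
    moreover have "f (x - sqrt v * w) = f (- x + sqrt v * w)" using even[of "x - sqrt v * w"] by simp
    moreover have "(1/2) *\<^sub>R (x + sqrt v * w) + (1/2) *\<^sub>R (x - sqrt v * w) = x" by (simp add: field_simps)
    ultimately show "f x \<le> (f (x + sqrt v * w) + f (- x + sqrt v * w)) / 2" by simp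
  qed (use int in auto)
  also have "\<dots> = (G v x + G v (- x)) / 2" unfolding G_def using int by simp
  finally show ?thesis by simp
qed

text \<open>The semigroup property of the heat flow: a further Gaussian step is absorbed into the
  variance argument.\<close>

lemma G_add: assumes "0 \<le> v" "0 \<le> q"
  shows "integrable std_normal (\<lambda>w. G v (x + sqrt q * w))" "(\<integral>w. G v (x + sqrt q * w) \<partial>std_normal) = G (v + q) x"
proof -
  interpret P: pair_prob_space std_normal std_normal ..
  have "integrable (distr std_normal borel (\<lambda>w. sqrt ((sqrt q)\<^sup>2 + (sqrt v)\<^sup>2) * w)) (\<lambda>z. f (x + z))"
    using integrable_G[of "v + q" x] assms by (subst integrable_distr_eq) (auto simp: add.commute)
  then have "integrable (distr (std_normal \<Otimes>\<^sub>M std_normal) borel (\<lambda>(a, b). sqrt q * a + sqrt v * b)) (\<lambda>z. f (x + z))"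
    by (simp only: distr_std_normal_pair)
  then have int: "integrable (std_normal \<Otimes>\<^sub>M std_normal) (\<lambda>(a, b). f (x + (sqrt q * a + sqrt v * b)))"
    by (subst (asm) integrable_distr_eq) (auto simp: split_beta')
  show "integrable std_normal (\<lambda>w. G v (x + sqrt q * w))"
    using P.integrable_fst'[OF int] by (simp add: G_def add.assoc)
  have "(\<integral>w. G v (x + sqrt q * w) \<partial>std_normal) = (\<integral>z. (case z of (a, b) \<Rightarrow> f (x + (sqrt q * a + sqrt v * b))) \<partial>(std_normal \<Otimes>\<^sub>M std_normal))"
    using P.integral_fst'[OF int] by (simp add: G_def add.assoc)
  also have "\<dots> = (\<integral>z. f (x + z) \<partial>distr (std_normal \<Otimes>\<^sub>M std_normal) borel (\<lambda>(a, b). sqrt q * a + sqrt v * b))"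
    by (subst integral_distr) (auto simp: split_beta')
  also have "\<dots> = G (v + q) x"
    unfolding distr_std_normal_pair using assms by (subst integral_distr) (auto simp: G_def add.commute)
  finally show "(\<integral>w. G v (x + sqrt q * w) \<partial>std_normal) = G (v + q) x" .
qed

end

section \<open>Taylor and heat expansions of the smoothed energy\<close>

lemma std_normal_moments:
  "integrable std_normal (\<lambda>w. w)" "(\<integral>w. w \<partial>std_normal) = 0"
  "integrable std_normal (\<lambda>w. w\<^sup>2)" "(\<integral>w. w\<^sup>2 \<partial>std_normal) = 1"
  "integrable std_normal (\<lambda>w. \<bar>w\<bar> ^ 3)"
  using integrable_std_normal_distribution_moment[of 1] integral_std_normal_distribution_moment_odd[of 1]
    integrable_std_normal_distribution_moment[of 2] std_normal_distribution_even_moments(1)[of 1]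
    integrable_abs[OF integrable_std_normal_distribution_moment[of 3]]
  by (simp_all add: power_abs)

lemma abs_square_minus_one_le: "\<bar>w\<^sup>2 - 1\<bar> \<le> 2 * exp \<bar>w\<bar>" for w :: real
proof -
  have "\<bar>w\<^sup>2 - 1\<bar> \<le> 1 + \<bar>w\<bar>\<^sup>2" by (simp add: abs_le_iff)
  also have "\<dots> \<le> 2 * exp \<bar>w\<bar>" by (rule poly_le_exp) simp
  finally show ?thesis .
qed

context energy
begin

text \<open>The shift by \<open>u\<close> becomes a Cameron-Martin density with parameter
  \<open>u / sqrt v\<close>, so the expansion of that density stands in for differentiability of
  \<open>f\<close>. The lower bound \<open>v0\<close> keeps the parameter bounded.\<close>

lemma G_taylor_small:
  assumes v0: "0 < v0"
  shows "\<exists>C\<ge>0. \<forall>v\<in>{v0..v1}. \<forall>x u. \<bar>u\<bar> \<le> 1 \<longrightarrow>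
    \<bar>B v x u - Gxx v x * u\<^sup>2 / 2\<bar> \<le> C * (1 + f x) * \<bar>u\<bar> ^ 3"
proof -
  define \<rho> where "\<rho> = 1 / sqrt v0"
  obtain C where C: "C \<ge> 0" "\<forall>v\<in>{0..v1}. \<forall>x K g. 0 \<le> K \<longrightarrow> g \<in> borel_measurable borel \<longrightarrow>
      (\<forall>w. \<bar>g w\<bar> \<le> K * exp ((\<rho> + 1) * \<bar>w\<bar>))
      \<longrightarrow> \<bar>\<integral>w. f (x + sqrt v * w) * g w \<partial>std_normal\<bar> \<le> C * K * (1 + f x)"
    using weighted_bound[of v1 "\<rho> + 1"] by blast
  have "\<bar>B v x u - Gxx v x * u\<^sup>2 / 2\<bar> \<le> (C * 8 * exp ((\<rho> + 1) * \<rho>) * \<rho> ^ 3) * (1 + f x) * \<bar>u\<bar> ^ 3"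
    if v: "v \<in> {v0..v1}" and u: "\<bar>u\<bar> \<le> 1" for v x u
  proof -
    have v_pos: "0 < v" using v v0 by auto
    define r where "r = u / sqrt v"
    have "\<bar>r\<bar> = \<bar>u\<bar> / sqrt v" using v_pos by (simp add: r_def)
    also have "\<dots> \<le> \<bar>u\<bar> / sqrt v0" using v v0 by (intro divide_left_mono) auto
    finally have r_le: "\<bar>r\<bar> \<le> \<rho> * \<bar>u\<bar>" by (simp add: \<rho>_def)
    also have "\<dots> \<le> \<rho>" using u v0 by (simp add: \<rho>_def divide_right_mono)
    finally have r: "\<bar>r\<bar> \<le> \<rho>" .
    define h where "h w = exp (r * w - r\<^sup>2 / 2) - 1 - r * w - r\<^sup>2 * (w\<^sup>2 - 1) / 2" for w
    have [measurable]: "h \<in> borel_measurable borel" by (simp add: h_def[abs_def])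
    define K where "K = 8 * \<bar>r\<bar> ^ 3 * exp ((\<rho> + 1) * \<rho>)"
    have h: "\<bar>h w\<bar> \<le> K * exp ((\<rho> + 1) * \<bar>w\<bar>)" for w
      using kernel_taylor[OF r, of w] unfolding h_def K_def distrib_left[of "\<rho> + 1"] exp_add by (simp add: mult_ac)
    have i0: "integrable std_normal (\<lambda>w. f (x + sqrt v * w))" using v_pos by (simp add: integrable_G)
    have i1: "integrable std_normal (\<lambda>w. f (x + sqrt v * w) * w)"
      by (rule integrable_f_exp[where K = 1 and c = 1]) (use v_pos poly_le_exp(3) in auto)
    have i2: "integrable std_normal (\<lambda>w. f (x + sqrt v * w) * (w\<^sup>2 - 1))"
    proof (rule integrable_f_exp[where K = 2 and c = 1])
    qed (use v_pos abs_square_minus_one_le in auto)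
    have ih: "integrable std_normal (\<lambda>w. f (x + sqrt v * w) * h w)"
      by (rule integrable_f_exp[OF _ h]) (use v_pos in auto)
    have eq: "f (x + sqrt v * w) * exp (r * w - r\<^sup>2 / 2) = f (x + sqrt v * w) * h w + f (x + sqrt v * w)
        + r * (f (x + sqrt v * w) * w) + r\<^sup>2 / 2 * (f (x + sqrt v * w) * (w\<^sup>2 - 1))" for w
      by (simp add: h_def field_simps)
    have "G v (x + u) = (\<integral>w. f (x + sqrt v * (w + r)) \<partial>std_normal)"
      unfolding G_def using v_pos by (intro Bochner_Integration.integral_cong) (auto simp: r_def algebra_simps)
    also have "\<dots> = (\<integral>w. f (x + sqrt v * w) * exp (r * w - r\<^sup>2 / 2) \<partial>std_normal)"
      by (rule std_normal_integral_shift) measurable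
    also have "\<dots> = (\<integral>w. f (x + sqrt v * w) * h w \<partial>std_normal) + G v x + r * (\<integral>w. f (x + sqrt v * w) * w \<partial>std_normal)
        + r\<^sup>2 / 2 * (\<integral>w. f (x + sqrt v * w) * (w\<^sup>2 - 1) \<partial>std_normal)"
      unfolding eq G_def using i0 i1 i2 ih by simp
    also have "r * (\<integral>w. f (x + sqrt v * w) * w \<partial>std_normal) = Gx v x * u"
      by (simp add: r_def Gx_def)
    also have "r\<^sup>2 / 2 * (\<integral>w. f (x + sqrt v * w) * (w\<^sup>2 - 1) \<partial>std_normal) = Gxx v x * u\<^sup>2 / 2"
      using v_pos by (simp add: r_def Gxx_def power_divide)
    finally have "B v x u - Gxx v x * u\<^sup>2 / 2 = (\<integral>w. f (x + sqrt v * w) * h w \<partial>std_normal)"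
      by (simp add: B_def)
    also have "\<bar>\<dots>\<bar> \<le> C * K * (1 + f x)"
      by (rule C(2)[rule_format, of v K h]) (use v v0 h in \<open>auto simp: K_def\<close>)
    also have "\<dots> \<le> C * (8 * (\<rho> ^ 3 * \<bar>u\<bar> ^ 3) * exp ((\<rho> + 1) * \<rho>)) * (1 + f x)"
      unfolding K_def using C(1) r_le
      by (intro mult_right_mono mult_left_mono)
        (auto simp: power_mult_distrib[symmetric] intro!: power_mono)
    finally show ?thesis by (simp add: mult_ac)
  qed
  moreover have "0 \<le> C * 8 * exp ((\<rho> + 1) * \<rho>) * \<rho> ^ 3" using C(1) v0 by (simp add: \<rho>_def)
  ultimately show ?thesis by blast
qed

lemma Gx_bound: assumes v0: "0 < v0" shows "\<exists>C\<ge>0. \<forall>v\<in>{v0..v1}. \<forall>x. \<bar>Gx v x\<bar> \<le> C * (1 + f x)"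
proof -
  obtain C where C: "C \<ge> 0" "\<forall>v\<in>{0..v1}. \<forall>x K g. 0 \<le> K \<longrightarrow> g \<in> borel_measurable borel \<longrightarrow>
      (\<forall>w. \<bar>g w\<bar> \<le> K * exp (1 * \<bar>w\<bar>))
      \<longrightarrow> \<bar>\<integral>w. f (x + sqrt v * w) * g w \<partial>std_normal\<bar> \<le> C * K * (1 + f x)"
    using weighted_bound[of v1 1] by blast
  have "\<bar>Gx v x\<bar> \<le> C / sqrt v0 * (1 + f x)" if v: "v \<in> {v0..v1}" for v x
  proof -
    have "\<bar>\<integral>w. f (x + sqrt v * w) * w \<partial>std_normal\<bar> \<le> C * 1 * (1 + f x)"
      by (rule C(2)[rule_format]) (use v v0 poly_le_exp(3) in auto)
    then have "\<bar>\<integral>w. f (x + sqrt v * w) * w \<partial>std_normal\<bar> / sqrt v \<le> C * (1 + f x) / sqrt v0"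
      using v v0 by (intro frac_le) auto
    then show ?thesis using v v0 by (simp add: Gx_def)
  qed
  then show ?thesis using C(1) v0 by (intro exI[of _ "C / sqrt v0"]) auto
qed

lemma Gxx_bound: assumes v0: "0 < v0" shows "\<exists>C\<ge>0. \<forall>v\<in>{v0..v1}. \<forall>x. \<bar>Gxx v x\<bar> \<le> C * (1 + f x)"
proof -
  obtain C where C: "C \<ge> 0" "\<forall>v\<in>{0..v1}. \<forall>x K g. 0 \<le> K \<longrightarrow> g \<in> borel_measurable borel \<longrightarrow>
      (\<forall>w. \<bar>g w\<bar> \<le> K * exp (1 * \<bar>w\<bar>))
      \<longrightarrow> \<bar>\<integral>w. f (x + sqrt v * w) * g w \<partial>std_normal\<bar> \<le> C * K * (1 + f x)"
    using weighted_bound[of v1 1] by blast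
  have "\<bar>Gxx v x\<bar> \<le> C * 2 / v0 * (1 + f x)" if v: "v \<in> {v0..v1}" for v x
  proof -
    have "\<bar>\<integral>w. f (x + sqrt v * w) * (w\<^sup>2 - 1) \<partial>std_normal\<bar> \<le> C * 2 * (1 + f x)"
      by (rule C(2)[rule_format]) (use v v0 abs_square_minus_one_le in auto)
    then have "\<bar>\<integral>w. f (x + sqrt v * w) * (w\<^sup>2 - 1) \<partial>std_normal\<bar> / v \<le> C * 2 * (1 + f x) / v0"
      using v v0 by (intro frac_le) auto
    then show ?thesis using v v0 by (simp add: Gxx_def)
  qed
  then show ?thesis using C(1) v0 by (intro exI[of _ "C * 2 / v0"]) auto
qed

text \<open>The kernel integral \<open>Gx\<close> is thereby an honest derivative, so convexity puts
  \<open>G v\<close> above its tangent and makes \<open>B\<close> nonnegative.\<close>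

lemma G_has_derivative: assumes v: "0 < v" shows "(G v has_real_derivative Gx v x) (at x)"
proof -
  obtain C where C: "C \<ge> 0" "\<And>u. \<bar>u\<bar> \<le> 1 \<Longrightarrow> \<bar>B v x u - Gxx v x * u\<^sup>2 / 2\<bar> \<le> C * (1 + f x) * \<bar>u\<bar> ^ 3"
    using G_taylor_small[OF v, of v] by auto
  define K where "K = \<bar>Gxx v x\<bar> / 2 + C * (1 + f x)"
  have "((\<lambda>h. (G v (x + h) - G v x) / h - Gx v x) \<longlongrightarrow> 0) (at 0)"
  proof (rule Lim_null_comparison)
    show "((\<lambda>h. K * \<bar>h\<bar>) \<longlongrightarrow> 0) (at 0)" by (auto intro!: tendsto_eq_intros)
    show "\<forall>\<^sub>F h in at 0. norm ((G v (x + h) - G v x) / h - Gx v x) \<le> K * \<bar>h\<bar>"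
      unfolding eventually_at
    proof (intro exI[of _ 1] conjI ballI impI; (elim conjE)?)
      fix h :: real assume h: "h \<noteq> 0" "dist h 0 < 1"
      then have h1: "\<bar>h\<bar> \<le> 1" by (simp add: dist_real_def)
      have "\<bar>B v x h\<bar> \<le> \<bar>Gxx v x * h\<^sup>2 / 2\<bar> + C * (1 + f x) * \<bar>h\<bar> ^ 3"
        using C(2)[OF h1] by linarith
      also have "\<dots> \<le> \<bar>Gxx v x\<bar> / 2 * \<bar>h\<bar>\<^sup>2 + C * (1 + f x) * \<bar>h\<bar>\<^sup>2"
        using h1 C(1) by (intro add_mono mult_left_mono power_decreasing) (auto simp: abs_mult)
      also have "\<dots> = K * \<bar>h\<bar> * \<bar>h\<bar>" by (simp add: K_def algebra_simps power2_eq_square)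
      finally have "\<bar>B v x h\<bar> / \<bar>h\<bar> \<le> K * \<bar>h\<bar>" using h by (simp add: field_simps)
      moreover have "(G v (x + h) - G v x) / h - Gx v x = B v x h / h" using h by (simp add: B_def field_simps)
      ultimately show "norm ((G v (x + h) - G v x) / h - Gx v x) \<le> K * \<bar>h\<bar>" by simp
    qed auto
  qed
  then show ?thesis unfolding DERIV_def by (rule LIM_zero_cancel)
qed

lemma B_nonneg: assumes "0 < v" shows "0 \<le> B v x u"
proof -
  have "G v (x + u) - G v x \<ge> Gx v x * (x + u - x)"
    by (rule convex_on_imp_above_tangent[where A = UNIV]) (use assms convex_G G_has_derivative in auto)
  then show ?thesis by (simp add: B_def)
qed

text \<open>The linear terms of \<open>B v x u\<close> and \<open>B v x (- u)\<close> cancel and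
  both numbers are nonnegative, so each is bounded by values of \<open>G v\<close> alone.\<close>

lemma B_bound: assumes v0: "0 < v0"
  shows "\<exists>C\<ge>0. \<forall>v\<in>{v0..v1}. \<forall>x u. B v x u \<le> C * (1 + f x) * (1 + f u)"
proof -
  obtain C where C: "C \<ge> 1" "\<forall>v\<in>{0..v1}. \<forall>x. G v x \<le> C * (1 + f x)" using G_bound by blast
  have "B v x u \<le> 4 * D * C * (1 + f x) * (1 + f u)" if v: "v \<in> {v0..v1}" for v x u
  proof -
    have "B v x (- u) \<ge> 0" using v v0 by (intro B_nonneg) auto
    moreover have "B v x u + B v x (- u) = G v (x + u) + G v (x + (- u)) - 2 * G v x"
      by (simp add: B_def)
    ultimately have "B v x u \<le> G v (x + u) + G v (x + (- u))"
      using G_nonneg[of v x] by linarith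
    also have "\<dots> \<le> C * (1 + f (x + u)) + C * (1 + f (x + (- u)))"
      using C(2) v v0 by (intro add_mono) auto
    also have "\<dots> \<le> C * (1 + 2 * D * (f x + f u)) + C * (1 + 2 * D * (f x + f (- u)))"
      using C(1) by (intro add_mono mult_left_mono f_add) auto
    also have "\<dots> = 2 * C + 4 * D * C * (f x + f u)" by (simp add: even algebra_simps)
    also have "\<dots> \<le> 4 * D * C + 4 * D * C * (f x + f u)" using C(1) D by simp
    also have "\<dots> = 4 * D * C * (1 + f x + f u)" by (simp add: algebra_simps)
    also have "\<dots> \<le> 4 * D * C * ((1 + f x) * (1 + f u))"
      using C(1) D by (intro mult_left_mono) (auto simp: algebra_simps)
    finally show ?thesis by (simp add: mult_ac)
  qed
  then show ?thesis using C(1) D by (intro exI[of _ "4 * D * C"]) auto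
qed

lemma B_bound_tail: assumes v0: "0 < v0" and \<kappa>: "0 < \<kappa>"
  shows "\<exists>C\<ge>0. \<forall>v\<in>{v0..v1}. \<forall>x u. \<kappa> < \<bar>u\<bar> \<longrightarrow> B v x u \<le> C * (1 + f x) * f u"
proof -
  obtain C where C: "C \<ge> 0" "\<And>v x u. v \<in> {v0..v1} \<Longrightarrow> B v x u \<le> C * (1 + f x) * (1 + f u)"
    using B_bound[OF v0] by blast
  have fk: "0 < f \<kappa>" using \<kappa> pos by auto
  have "B v x u \<le> C * (1 / f \<kappa> + 1) * (1 + f x) * f u" if v: "v \<in> {v0..v1}" and u: "\<kappa> < \<bar>u\<bar>" for v x u
  proof -
    have "f \<kappa> \<le> f u" using u \<kappa> by (intro mono) auto
    then have "1 + f u \<le> (1 / f \<kappa> + 1) * f u" using fk by (simp add: field_simps)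
    then have "C * (1 + f x) * (1 + f u) \<le> C * (1 + f x) * ((1 / f \<kappa> + 1) * f u)"
      using C(1) by (intro mult_left_mono) auto
    with C(2)[OF v, of x u] show ?thesis by (simp add: mult_ac)
  qed
  then show ?thesis using C(1) by (intro exI[of _ "C * (1 / f \<kappa> + 1)"]) auto
qed

text \<open>For \<open>\<bar>u\<bar> \<ge> 1\<close> nothing has to cancel: \<open>f\<close> grows
  at most quadratically there, so both terms are of order \<open>\<bar>u\<bar> ^ 3\<close>
  separately.\<close>

lemma G_taylor:
  assumes v0: "0 < v0"
  shows "\<exists>C\<ge>0. \<forall>v\<in>{v0..v1}. \<forall>x u. \<bar>B v x u - Gxx v x * u\<^sup>2 / 2\<bar> \<le> C * (1 + f x) * \<bar>u\<bar> ^ 3"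
proof -
  obtain C1 where C1: "C1 \<ge> 0" "\<And>v x u. v \<in> {v0..v1} \<Longrightarrow> \<bar>u\<bar> \<le> 1 \<Longrightarrow>
    \<bar>B v x u - Gxx v x * u\<^sup>2 / 2\<bar> \<le> C1 * (1 + f x) * \<bar>u\<bar> ^ 3" using G_taylor_small[OF v0] by blast
  obtain C2 where C2: "C2 \<ge> 0" "\<And>v x u. v \<in> {v0..v1} \<Longrightarrow> B v x u \<le> C2 * (1 + f x) * (1 + f u)"
    using B_bound[OF v0] by blast
  obtain C3 where C3: "C3 \<ge> 0" "\<And>v x. v \<in> {v0..v1} \<Longrightarrow> \<bar>Gxx v x\<bar> \<le> C3 * (1 + f x)"
    using Gxx_bound[OF v0] by blast
  define C where "C = C1 + C2 * (1 + D * f 1) + C3"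
  have D1: "0 \<le> D * f 1" using D by simp
  have "\<bar>B v x u - Gxx v x * u\<^sup>2 / 2\<bar> \<le> C * (1 + f x) * \<bar>u\<bar> ^ 3" if v: "v \<in> {v0..v1}" for v x u
  proof (cases "\<bar>u\<bar> \<le> 1")
    case True
    have "C1 * (1 + f x) * \<bar>u\<bar> ^ 3 \<le> C * (1 + f x) * \<bar>u\<bar> ^ 3"
      using C1(1) C2(1) C3(1) D1 by (intro mult_right_mono) (auto simp: C_def)
    with C1(2)[OF v True, of x] show ?thesis by linarith
  next
    case False
    then have u: "1 \<le> \<bar>u\<bar>" by simp
    have u3: "u\<^sup>2 \<le> \<bar>u\<bar> ^ 3" using power_increasing[of 2 3 "\<bar>u\<bar>"] u by simp
    have u32: "u\<^sup>2 / 2 \<le> \<bar>u\<bar> ^ 3" using u3 zero_le_power2[of u] by linarith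
    have u0: "1 \<le> \<bar>u\<bar> ^ 3" using u by (rule one_le_power)
    have "f u \<le> D * f 1 * u\<^sup>2" using u by (rule f_le_square)
    also have "\<dots> \<le> D * f 1 * \<bar>u\<bar> ^ 3" using u3 D1 by (intro mult_left_mono)
    finally have fu: "1 + f u \<le> (1 + D * f 1) * \<bar>u\<bar> ^ 3" using u0 by (simp add: algebra_simps)
    have "B v x u \<le> C2 * (1 + f x) * ((1 + D * f 1) * \<bar>u\<bar> ^ 3)"
      using C2(2)[OF v, of x u] mult_left_mono[OF fu, of "C2 * (1 + f x)"] C2(1) by simp
    then have b: "B v x u \<le> C2 * (1 + D * f 1) * (1 + f x) * \<bar>u\<bar> ^ 3" by (simp add: mult_ac)
    have "\<bar>Gxx v x * u\<^sup>2 / 2\<bar> = \<bar>Gxx v x\<bar> * (u\<^sup>2 / 2)" by (simp add: abs_mult)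
    also have "\<dots> \<le> C3 * (1 + f x) * \<bar>u\<bar> ^ 3"
      using C3 v u32 by (intro mult_mono) auto
    finally have a: "\<bar>Gxx v x * u\<^sup>2 / 2\<bar> \<le> C3 * (1 + f x) * \<bar>u\<bar> ^ 3" .
    have "0 \<le> B v x u" using v v0 by (intro B_nonneg) auto
    then have "\<bar>B v x u - Gxx v x * u\<^sup>2 / 2\<bar> \<le> B v x u + \<bar>Gxx v x * u\<^sup>2 / 2\<bar>" by linarith
    also have "\<dots> \<le> (C2 * (1 + D * f 1) + C3) * (1 + f x) * \<bar>u\<bar> ^ 3"
      using a b by (simp add: algebra_simps)
    also have "\<dots> \<le> C * (1 + f x) * \<bar>u\<bar> ^ 3"
      using C1(1) by (intro mult_right_mono) (auto simp: C_def)
    finally show ?thesis .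
  qed
  moreover have "0 \<le> C" using C1(1) C2(1) C3(1) D1 by (simp add: C_def)
  ultimately show ?thesis by blast
qed

text \<open>The Taylor expansion is averaged over a normal step of variance \<open>q\<close>: the
  first moment vanishes, the second gives the heat equation, the third the error. A centred step
  with the same second moment has the same leading term, which is what the swapping
  exploits.\<close>

lemma G_heat:
  assumes v0: "0 < v0"
  shows "\<exists>C\<ge>0. \<forall>v\<in>{v0..v1}. \<forall>x. \<forall>q\<ge>0. \<bar>G (v + q) x - G v x - Gxx v x * q / 2\<bar> \<le> C * (1 + f x) * (q * sqrt q)"
proof -
  obtain C where C: "C \<ge> 0" "\<And>v x u. v \<in> {v0..v1} \<Longrightarrow>
    \<bar>B v x u - Gxx v x * u\<^sup>2 / 2\<bar> \<le> C * (1 + f x) * \<bar>u\<bar> ^ 3" using G_taylor[OF v0] by blast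
  let ?m = "\<integral>w. \<bar>w\<bar> ^ 3 \<partial>std_normal"
  have "\<bar>G (v + q) x - G v x - Gxx v x * q / 2\<bar> \<le> C * ?m * (1 + f x) * (q * sqrt q)"
    if v: "v \<in> {v0..v1}" and q: "0 \<le> q" for v x q
  proof -
    have i: "integrable std_normal (\<lambda>w. G v (x + sqrt q * w))" and e: "(\<integral>w. G v (x + sqrt q * w) \<partial>std_normal) = G (v + q) x"
      using G_add[of v q x] v v0 q by auto
    define h where "h w = B v x (sqrt q * w) - Gxx v x * (sqrt q * w)\<^sup>2 / 2" for w
    have h: "h w = G v (x + sqrt q * w) - G v x - Gx v x * sqrt q * w - Gxx v x * q / 2 * w\<^sup>2" for w
      using q by (simp add: h_def B_def power_mult_distrib)
    have ih: "integrable std_normal h" unfolding h[abs_def] using i std_normal_moments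
      by (intro Bochner_Integration.integrable_diff integrable_mult_right) auto
    have "(\<integral>w. h w \<partial>std_normal) = G (v + q) x - G v x - Gxx v x * q / 2"
      unfolding h using i std_normal_moments e by (simp add: Bochner_Integration.integrable_diff)
    then have "\<bar>G (v + q) x - G v x - Gxx v x * q / 2\<bar> \<le> (\<integral>w. \<bar>h w\<bar> \<partial>std_normal)"
      using integral_abs_bound[of std_normal h] by simp
    also have "\<dots> \<le> (\<integral>w. C * (1 + f x) * (q * sqrt q) * \<bar>w\<bar> ^ 3 \<partial>std_normal)"
    proof (rule integral_mono)
      fix w
      have "\<bar>h w\<bar> \<le> C * (1 + f x) * \<bar>sqrt q * w\<bar> ^ 3" unfolding h_def by (rule C(2)[OF v])
      also have "\<bar>sqrt q * w\<bar> ^ 3 = q * sqrt q * \<bar>w\<bar> ^ 3"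
        using q by (simp add: abs_mult power_mult_distrib power3_eq_cube[of "sqrt q"])
      finally show "\<bar>h w\<bar> \<le> C * (1 + f x) * (q * sqrt q) * \<bar>w\<bar> ^ 3" by (simp add: mult_ac)
    qed (use ih std_normal_moments in auto)
    finally show ?thesis by (simp add: mult_ac)
  qed
  moreover have "0 \<le> C * ?m" using C(1) by (intro mult_nonneg_nonneg integral_nonneg_AE) auto
  ultimately show ?thesis by blast
qed

text \<open>\<open>x + l * w\<close> is a convex combination of \<open>x / (1 - l)\<close> and
  \<open>w\<close>, the latter with weight \<open>l\<close>. So smoothing costs only order
  \<open>l\<close> although \<open>f\<close> may have kinks.\<close>

lemma G_small: assumes "0 < l" "l \<le> 1/2"
  shows "G (l\<^sup>2) x \<le> f x + (4 * D + G 1 0) * l * (1 + f x)"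
proof -
  have s: "1 \<le> 1 / (1 - l)" "1 / (1 - l) \<le> 2" using assms by (auto simp: field_simps)
  have "G (l\<^sup>2) x \<le> (\<integral>w. (1 + 4 * D * l) * f x + l * f (0 + sqrt 1 * w) \<partial>std_normal)"
    unfolding G_def
  proof (rule integral_mono)
    fix w
    have "f (x + sqrt (l\<^sup>2) * w) = f ((1 - l) *\<^sub>R (1 / (1 - l) * x) + l *\<^sub>R w)"
      using assms by simp
    also have "\<dots> \<le> (1 - l) * f (1 / (1 - l) * x) + l * f w"
      using assms by (intro convex_onD[OF conv]) auto
    also have "\<dots> \<le> (1 - l) * ((1 + 4 * D * (1 / (1 - l) - 1)) * f x) + l * f w"
      using assms by (intro add_mono mult_left_mono f_stretch s) auto
    also have "(1 - l) * ((1 + 4 * D * (1 / (1 - l) - 1)) * f x) = (1 - l + 4 * D * l) * f x"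
      using assms by (simp add: field_simps)
    also have "\<dots> \<le> (1 + 4 * D * l) * f x" using assms by (intro mult_right_mono) auto
    finally show "f (x + sqrt (l\<^sup>2) * w) \<le> (1 + 4 * D * l) * f x + l * f (0 + sqrt 1 * w)" by simp
  qed (use assms integrable_G[of 1 0] integrable_G[of "l\<^sup>2" x] in auto)
  also have "\<dots> = (1 + 4 * D * l) * f x + l * G 1 0"
    unfolding G_def using integrable_G[of 1 0] by simp
  also have "\<dots> \<le> f x + (4 * D + G 1 0) * l * (1 + f x)"
    using assms D G_nonneg[of 1 0] mult_nonneg_nonneg[of l "4 * D + G 1 0 * f x"] by (simp add: algebra_simps)
  finally show ?thesis .
qed

text \<open>Continuity up to \<open>v = 0\<close> lets the compactness argument in
  \<open>rigidity\<close> include degenerate variances.\<close>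

lemma continuous_G: "continuous_on (UNIV \<times> {0..}) (\<lambda>(x, v). G v x)"
  unfolding continuous_on_sequentially
proof (intro allI impI ballI; elim conjE)
  fix z :: "nat \<Rightarrow> real \<times> real" and a :: "real \<times> real"
  assume z: "\<forall>n. z n \<in> UNIV \<times> {0..}" "z \<longlonglongrightarrow> a" and a: "a \<in> UNIV \<times> {0..}"
  obtain R where R: "\<And>n. norm (z n) \<le> R"
    using convergent_imp_Bseq[OF convergentI[OF z(2)]] by (auto simp: Bseq_def)
  let ?K = "2 * D * (1 + 2 * D * f 1 * (1 + (sqrt R)\<^sup>2)) * (1 + f R)"
  have "(\<lambda>n. \<integral>w. f (fst (z n) + sqrt (snd (z n)) * w) \<partial>std_normal) \<longlonglongrightarrow> (\<integral>w. f (fst a + sqrt (snd a) * w) \<partial>std_normal)"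
  proof (rule integral_dominated_convergence[where w = "\<lambda>w. ?K * exp (1 * \<bar>w\<bar>)"])
    show "AE w in std_normal. (\<lambda>n. f (fst (z n) + sqrt (snd (z n)) * w)) \<longlonglongrightarrow> f (fst a + sqrt (snd a) * w)"
      using cont z(2) by (intro AE_I2 isCont_tendsto_compose[where g = f] tendsto_intros)
        (auto simp: continuous_on_eq_continuous_at)
    show "AE w in std_normal. norm (f (fst (z n) + sqrt (snd (z n)) * w)) \<le> ?K * exp (1 * \<bar>w\<bar>)" for n
    proof (rule AE_I2)
      fix w
      have s: "\<bar>fst (z n)\<bar> \<le> R" "\<bar>snd (z n)\<bar> \<le> R" "0 \<le> snd (z n)"
        using R[of n] norm_fst_le[of "fst (z n)" "snd (z n)"] norm_snd_le[of "snd (z n)" "fst (z n)"] z(1)[rule_format, of n]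
        by (auto simp: mem_Times_iff intro: order_trans)
      have "f (fst (z n) + sqrt (snd (z n)) * w) \<le> 2 * D * (1 + 2 * D * f 1 * (1 + (sqrt R)\<^sup>2)) * (1 + f (fst (z n))) * exp \<bar>w\<bar>"
        using s by (intro f_shift_exp) auto
      also have "\<dots> \<le> ?K * exp \<bar>w\<bar>"
        using s D mono[of "fst (z n)" R] by (intro mult_right_mono mult_left_mono) auto
      finally show "norm (f (fst (z n) + sqrt (snd (z n)) * w)) \<le> ?K * exp (1 * \<bar>w\<bar>)" by simp
    qed
    show "integrable std_normal (\<lambda>w. ?K * exp (1 * \<bar>w\<bar>))" by (intro integrable_mult_right integrable_std_normal_exp)
  qed measurable
  then show "((\<lambda>(x, v). G v x) \<circ> z) \<longlonglongrightarrow> (case a of (x, v) \<Rightarrow> G v x)"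
    by (simp add: G_def o_def split_beta')
qed

end

section \<open>Quantitative strict convexity of the smoothed energy\<close>

lemma convex_on_difference:
  fixes g :: "real \<Rightarrow> real"
  assumes g: "convex_on UNIV g" and u: "1 \<le> u"
  shows "u * (g (x + 1) - g x) \<le> g (x + u) - g x"
proof -
  have "(1 - 1 / u) *\<^sub>R x + (1 / u) *\<^sub>R (x + u) = x + 1" using u by (simp add: field_simps)
  then have *: "g (x + 1) \<le> (1 - 1 / u) * g x + 1 / u * g (x + u)"
    using convex_onD[OF g, of "1 / u" x "x + u"] u by simp
  have "u * g (x + 1) \<le> u * ((1 - 1 / u) * g x + 1 / u * g (x + u))"
    by (rule mult_left_mono[OF *]) (use u in simp)
  also have "\<dots> = (u - 1) * g x + g (x + u)"
    unfolding distrib_left mult.assoc[symmetric] right_diff_distrib using u by simp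
  finally show ?thesis by (simp add: left_diff_distrib right_diff_distrib)
qed

context energy
begin

text \<open>The price that a centred step pays in Gaussian energy: quadratic at the origin, of the growth of \<open>f\<close>
  at infinity.\<close>

definition Q :: "real \<Rightarrow> real" where
  "Q u = (if \<bar>u\<bar> \<le> 1 then u\<^sup>2 else f u)"

lemma measurable_Q [measurable]: "Q \<in> borel_measurable borel"
  unfolding Q_def[abs_def] by measurable

lemma Q_nonneg [simp]: "0 \<le> Q u" by (simp add: Q_def)

lemma Q_le: "Q u \<le> 1 + f u"
proof -
  have "u\<^sup>2 \<le> 1" if "\<bar>u\<bar> \<le> 1" using that by (simp add: abs_square_le_1)
  moreover have "0 \<le> f u" by simp
  ultimately show ?thesis by (auto simp: Q_def intro: order_trans)
qed

lemma Q_minus [simp]: "Q (- u) = Q u" by (simp add: Q_def even)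

text \<open>By star-shapedness \<open>f (z + h) - f z\<close> is at least the fraction
  \<open>h / (z + h)\<close> of \<open>f (z + h)\<close>, and the latter grows at least
  linearly.\<close>

lemma f_slope: assumes "1 \<le> z" "0 \<le> h" shows "f z + h * f 1 \<le> f (z + h)"
proof (cases "h = 0")
  case False
  have "f (z / (z + h) * (z + h)) \<le> z / (z + h) * f (z + h)"
    using assms by (intro star) auto
  moreover have "z / (z + h) * (z + h) = z" using assms by simp
  ultimately have "f z \<le> z / (z + h) * f (z + h)" by simp
  then have "(z + h) * f z \<le> z * f (z + h)" using assms by (simp add: field_simps)
  moreover have "h * (f 1 * (z + h)) \<le> h * f (z + h)"
    using f_ge_linear[of "z + h"] assms by (intro mult_left_mono) auto
  ultimately have "(z + h) * (f z + h * f 1) \<le> (z + h) * f (z + h)"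
    by (simp add: algebra_simps)
  then show ?thesis using assms by (simp add: mult_le_cancel_left)
qed simp

text \<open>The normal density with mean \<open>x\<close> and variance \<open>v\<close> has a common
  lower bound on the window. A convexity gap of \<open>f\<close> found on average over the window
  thus passes to \<open>G v\<close>.\<close>

lemma window_bound:
  assumes v0: "0 < v0"
  shows "\<exists>c>0::real. \<forall>v\<in>{v0..v1}. \<forall>x\<in>{-R..R}. \<forall>g::real \<Rightarrow> real. continuous_on UNIV g \<longrightarrow> (\<forall>z. 0 \<le> g z) \<longrightarrow>
    integrable std_normal (\<lambda>w. g (x + sqrt v * w)) \<longrightarrow>
    c * integral {-2..2} g \<le> (\<integral>w. g (x + sqrt v * w) \<partial>std_normal)"
proof -
  define c where "c = 1 / sqrt (2 * pi * (\<bar>v1\<bar> + 1)) * exp (- (\<bar>R\<bar> + 2)\<^sup>2 / (2 * v0))"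
  have c: "0 < c" by (simp add: c_def)
  have "c * integral {-2..2} g \<le> (\<integral>w. g (x + sqrt v * w) \<partial>std_normal)"
    if v: "v \<in> {v0..v1}" and x: "x \<in> {-R..R}" and g: "continuous_on UNIV g" "\<And>z. 0 \<le> g z"
      and int: "integrable std_normal (\<lambda>w. g (x + sqrt v * w))" for v x g
  proof -
    have v_pos: "0 < v" using v v0 by auto
    have [measurable]: "g \<in> borel_measurable borel" using g(1) by (rule borel_measurable_continuous_onI)
    have sd: "std_normal_density ((z - x) / sqrt v) / sqrt v = normal_density x (sqrt v) z" for z
      using v_pos by (simp add: normal_density_def std_normal_density_def real_sqrt_mult power_divide field_simps)
    have low: "c \<le> normal_density x (sqrt v) z" if z: "z \<in> {-2..2}" for z
    proof -
      have "\<bar>z - x\<bar> \<le> \<bar>R\<bar> + 2" using z x by auto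
      then have "(z - x)\<^sup>2 \<le> (\<bar>R\<bar> + 2)\<^sup>2" by (metis abs_ge_zero power2_abs power_mono)
      then have "(z - x)\<^sup>2 / (2 * v) \<le> (\<bar>R\<bar> + 2)\<^sup>2 / (2 * v0)" using v v0 by (intro frac_le) auto
      moreover have "1 / sqrt (2 * pi * (\<bar>v1\<bar> + 1)) \<le> 1 / sqrt (2 * pi * v)"
        using v v_pos by (intro divide_left_mono) (auto intro!: mult_mono)
      ultimately show ?thesis
        unfolding c_def normal_density_def using v_pos by (intro mult_mono) auto
    qed
    have int': "integrable lborel (\<lambda>w. std_normal_density w * g (x + sqrt v * w))"
      using int by (subst (asm) integrable_density) auto
    have int2: "integrable lborel (\<lambda>z. normal_density x (sqrt v) z * g z)"
    proof -
      have "integrable lborel (\<lambda>z. std_normal_density (- x / sqrt v + (1 / sqrt v) * z) *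
        g (x + sqrt v * (- x / sqrt v + (1 / sqrt v) * z)))"
        using v_pos by (intro lborel_integrable_real_affine[OF int']) auto
      then have "integrable lborel (\<lambda>z. std_normal_density ((z - x) / sqrt v) * g z)"
        using v_pos by (simp add: field_simps)
      then have "integrable lborel (\<lambda>z. 1 / sqrt v * (std_normal_density ((z - x) / sqrt v) * g z))"
        by (intro integrable_mult_right)
      then show ?thesis by (simp add: sd[symmetric])
    qed
    have si: "set_integrable lborel {-2..2} g"
      using g(1) continuous_on_subset by (intro borel_integrable_atLeastAtMost') blast
    have "(\<integral>w. g (x + sqrt v * w) \<partial>std_normal) = (\<integral>w. std_normal_density w * g (x + sqrt v * w) \<partial>lborel)"
      by (subst integral_density) auto
    also have "\<dots> = \<bar>1 / sqrt v\<bar> *\<^sub>R (\<integral>z. std_normal_density (- x / sqrt v + (1 / sqrt v) * z) *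
        g (x + sqrt v * (- x / sqrt v + (1 / sqrt v) * z)) \<partial>lborel)"
      using v_pos by (intro lborel_integral_real_affine) auto
    also have "\<dots> = (\<integral>z. 1 / sqrt v * (std_normal_density ((z - x) / sqrt v) * g z) \<partial>lborel)"
      using v_pos by (simp add: field_simps)
    also have "\<dots> = (\<integral>z. normal_density x (sqrt v) z * g z \<partial>lborel)"
      by (simp add: sd[symmetric])
    also have "\<dots> \<ge> (\<integral>z. c * (indicator {-2..2} z *\<^sub>R g z) \<partial>lborel)"
    proof (rule integral_mono)
      show "integrable lborel (\<lambda>z. c * (indicator {-2..2} z *\<^sub>R g z))"
        using si by (intro integrable_mult_right) (simp add: set_integrable_def)
      fix z show "c * (indicator {-2..2} z *\<^sub>R g z) \<le> normal_density x (sqrt v) z * g z"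
        using low[of z] g(2)[of z] by (cases "z \<in> {-2..2::real}") (auto intro: mult_right_mono)
    qed (rule int2)
    also have "(\<integral>z. c * (indicator {-2..2} z *\<^sub>R g z) \<partial>lborel) = c * integral {-2..2} g"
      using set_borel_integral_eq_integral(2)[OF si] by (simp add: set_lebesgue_integral_def)
    finally show ?thesis .
  qed
  with c show ?thesis by (intro exI[of _ c]) auto
qed

text \<open>A pointwise bound of this kind fails, because \<open>f\<close> may be affine between its kinks; only the
  increase of the slope across the whole window is available.\<close>

lemma second_diff_integral:
  assumes u: "0 < u" "u \<le> 1"
  shows "f 1 * u\<^sup>2 / 2 \<le> integral {-2..2} (\<lambda>z. f (z + u) - 2 * f (z + u / 2) + f z)"
proof -
  obtain \<Phi> where \<Phi>: "\<And>z. z \<in> {-9..9} \<Longrightarrow> (\<Phi> has_vector_derivative f z) (at z within {-9..9})"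
    using antiderivative_continuous[of "-9" 9 f] continuous_on_subset[OF cont] by blast
  have \<Phi>': "(\<Phi> has_real_derivative f z) (at z)" if "\<bar>z\<bar> < 9" for z
  proof -
    have "(\<Phi> has_vector_derivative f z) (at z within {-9<..<9})"
      using that by (intro has_vector_derivative_within_subset[OF \<Phi>]) auto
    moreover have "at z within {-9<..<9} = at z" using that by (intro at_within_open) auto
    ultimately show ?thesis by (simp add: has_real_derivative_iff_has_vector_derivative)
  qed
  have I: "((\<lambda>z. f (z + h)) has_integral (\<Phi> (2 + h) - \<Phi> (- 2 + h))) {-2..2}" if h: "0 \<le> h" "h \<le> 1" for h
  proof (rule fundamental_theorem_of_calculus)
    fix z :: real assume z: "z \<in> {-2..2}"
    have "((\<lambda>z. \<Phi> (z + h)) has_real_derivative f (z + h) * (1 + 0)) (at z)"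
      by (rule DERIV_chain2[where f = \<Phi>]) (use z h in \<open>auto intro!: \<Phi>' derivative_eq_intros\<close>)
    then show "((\<lambda>z. \<Phi> (z + h)) has_vector_derivative f (z + h)) (at z within {-2..2})"
      by (simp add: has_real_derivative_iff_has_vector_derivative has_vector_derivative_at_within)
  qed simp
  \<comment> \<open>\<open>J h\<close> is the integral of \<open>f\<close> over the window moved by
    \<open>h\<close>, so the integral in question is a second difference of
    \<open>J\<close>.\<close>
  define J where "J h = \<Phi> (2 + h) - \<Phi> (- 2 + h)" for h
  define g where "g s = J (s + u / 2) - J s" for s
  have J': "(J has_real_derivative f (2 + h) - f (- 2 + h)) (at h)" if "0 \<le> h" "h \<le> 1" for h
  proof -
    have "((\<lambda>h. \<Phi> (2 + h)) has_real_derivative f (2 + h) * (0 + 1)) (at h)"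
      by (rule DERIV_chain2[where f = \<Phi>]) (use that in \<open>auto intro!: \<Phi>' derivative_eq_intros\<close>)
    moreover have "((\<lambda>h. \<Phi> (- 2 + h)) has_real_derivative f (- 2 + h) * (0 + 1)) (at h)"
      by (rule DERIV_chain2[where f = \<Phi>]) (use that in \<open>auto intro!: \<Phi>' derivative_eq_intros\<close>)
    ultimately show ?thesis unfolding J_def[abs_def] by (auto intro!: derivative_eq_intros)
  qed
  have g': "(g has_real_derivative (f (2 + (s + u / 2)) - f (- 2 + (s + u / 2))) - (f (2 + s) - f (- 2 + s))) (at s)"
    if "0 \<le> s" "s \<le> u / 2" for s
  proof -
    have "((\<lambda>s. J (s + u / 2)) has_real_derivative (f (2 + (s + u / 2)) - f (- 2 + (s + u / 2))) * (1 + 0)) (at s)"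
      using that u by (intro DERIV_chain2[where f = J] J') (auto intro!: derivative_eq_intros)
    then show ?thesis unfolding g_def[abs_def] using that u by (auto intro!: derivative_eq_intros J')
  qed
  \<comment> \<open>The mean value theorem leaves increments of \<open>f\<close> near the two ends
    of the window. After reflection their arguments are at least \<open>1\<close>, where
    \<open>f_slope\<close> applies.\<close>
  have "\<exists>s>0. s < u / 2 \<and> g (u / 2) - g 0 = (u / 2 - 0) * ((f (2 + (s + u / 2)) - f (- 2 + (s + u / 2))) - (f (2 + s) - f (- 2 + s)))"
    using u by (intro MVT2 g') auto
  then obtain s where s: "0 < s" "s < u / 2" "g (u / 2) - g 0 = (u / 2 - 0) * ((f (2 + (s + u / 2)) - f (- 2 + (s + u / 2))) - (f (2 + s) - f (- 2 + s)))"
    by blast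
  have "f (2 + s) + u / 2 * f 1 \<le> f (2 + s + u / 2)" using s u by (intro f_slope) auto
  moreover have "f (2 - (s + u / 2)) + u / 2 * f 1 \<le> f (2 - (s + u / 2) + u / 2)" using s u by (intro f_slope) auto
  moreover have "f (- 2 + (s + u / 2)) = f (2 - (s + u / 2))" using even[of "2 - (s + u / 2)"] by (simp add: algebra_simps)
  moreover have "f (- 2 + s) = f (2 - (s + u / 2) + u / 2)" using even[of "2 - s"] by (simp add: algebra_simps)
  ultimately have "u * f 1 \<le> (f (2 + (s + u / 2)) - f (- 2 + (s + u / 2))) - (f (2 + s) - f (- 2 + s))"
    by (simp add: add.assoc)
  then have "u / 2 * (u * f 1) \<le> g (u / 2) - g 0" unfolding s(3) diff_zero
    by (rule mult_left_mono) (use u in simp)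
  also have "\<dots> = J u - 2 * J (u / 2) + J 0" by (simp add: g_def)
  also have "\<dots> = integral {-2..2} (\<lambda>z. f (z + u) - 2 * f (z + u / 2) + f z)"
  proof -
    have "((\<lambda>z. f (z + u) - 2 * f (z + u / 2) + f (z + 0)) has_integral (J u - 2 * J (u / 2) + J 0)) {-2..2}"
      unfolding J_def using u
      by (intro has_integral_add has_integral_diff has_integral_mult_right I) auto
    then show ?thesis by (simp add: integral_unique)
  qed
  finally show ?thesis by (simp add: power2_eq_square mult_ac)
qed

lemma Gx_uminus: "Gx v (- x) = - Gx v x"
proof -
  have "f (- x + sqrt v * w) * w = - (f (x + sqrt v * (- w)) * (- w))" for w
    using even[of "x - sqrt v * w"] by simp
  then have "(\<integral>w. f (- x + sqrt v * w) * w \<partial>std_normal) = - (\<integral>w. f (x + sqrt v * (- w)) * (- w) \<partial>std_normal)"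
    by (simp only: Bochner_Integration.integral_minus)
  also have "(\<integral>w. f (x + sqrt v * (- w)) * (- w) \<partial>std_normal) = (\<integral>w. f (x + sqrt v * w) * w \<partial>std_normal)"
    by (rule std_normal_integral_uminus) measurable
  finally show ?thesis by (simp add: Gx_def)
qed

lemma B_uminus: "B v (- x) (- u) = B v x u"
  using G_uminus[of v "x + u"] by (simp add: B_def Gx_uminus del: G_uminus) simp

text \<open>Convexity bounds the tangent by a difference quotient in the same direction, which
  trades the derivative for three values of \<open>G v\<close>.\<close>

lemma B_ge_difference:
  assumes "0 < v" "0 < t"
  shows "G v (x + u) - G v x - (G v (x + t * u) - G v x) / t \<le> B v x u"
proof -
  have "Gx v x * u * t \<le> G v (x + t * u) - G v x"
    using B_nonneg[OF assms(1), of x "t * u"] by (simp add: B_def mult_ac)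
  then have "Gx v x * u \<le> (G v (x + t * u) - G v x) / t" using assms by (simp add: pos_le_divide_eq)
  then show ?thesis by (simp add: B_def)
qed

text \<open>Three ranges of \<open>u\<close>: small jumps use the quadratic gap of
  \<open>second_diff_integral\<close>, large ones the size of \<open>f u\<close>, and the bounded
  range between them is covered by monotonicity of \<open>B\<close> along the ray.\<close>

lemma B_lower:
  assumes v0: "0 < v0"
  shows "\<exists>c>0. \<forall>v\<in>{v0..v1}. \<forall>x\<in>{-R..R}. \<forall>u. c * Q u \<le> B v x u"
proof -
  obtain c where c: "c > (0::real)" "\<And>v x g. v \<in> {v0..v1} \<Longrightarrow> x \<in> {-R..R} \<Longrightarrow> continuous_on UNIV g \<Longrightarrow> (\<And>z. 0 \<le> g z) \<Longrightarrow>
    integrable std_normal (\<lambda>w. g (x + sqrt v * w)) \<Longrightarrow>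
    c * integral {-2..2} g \<le> (\<integral>w. g (x + sqrt v * w) \<partial>std_normal)"
    using window_bound[OF v0, of v1 R] by blast
  have fcont: "continuous_on S (\<lambda>z. f (z + h))" for S h
    by (intro continuous_on_compose2[OF cont]) (auto intro!: continuous_intros)
  have int: "integrable std_normal (\<lambda>w. f (x + sqrt v * w + h))" if "v \<in> {v0..v1}" for v x h
    using integrable_G[of v "x + h"] that v0 by (simp add: add.assoc add.commute add.left_commute)
  have Gsh: "(\<integral>w. f (x + sqrt v * w + h) \<partial>std_normal) = G v (x + h)" for v x h
    unfolding G_def by (simp add: add.assoc add.commute add.left_commute)
  have small: "c * (f 1 / 2) * u\<^sup>2 \<le> B v x u"
    if v: "v \<in> {v0..v1}" and x: "x \<in> {-R..R}" and u: "0 < u" "u \<le> 1" for v x u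
  proof -
    let ?d = "\<lambda>z. f (z + u) - 2 * f (z + u / 2) + f z"
    have "c * (f 1 / 2) * u\<^sup>2 = c * (f 1 * u\<^sup>2 / 2)" by simp
    also have "\<dots> \<le> c * integral {-2..2} ?d"
      using second_diff_integral[OF u] c(1) by (intro mult_left_mono) auto
    also have "\<dots> \<le> (\<integral>w. ?d (x + sqrt v * w) \<partial>std_normal)"
    proof (rule c(2)[OF v x])
      show "continuous_on UNIV ?d" using fcont[of _ 0] by (intro continuous_intros fcont) auto
      show "0 \<le> ?d z" for z
        using convex_onD[OF conv, of "1/2" z "z + u"] by (simp add: field_simps)
      show "integrable std_normal (\<lambda>w. ?d (x + sqrt v * w))"
        using int[OF v, of x] int[OF v, of x 0] by (intro Bochner_Integration.integrable_add Bochner_Integration.integrable_diff integrable_mult_right) auto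
    qed
    also have "\<dots> = G v (x + u) - 2 * G v (x + u / 2) + G v x"
      using int[OF v, of x u] int[OF v, of x "u/2"] int[OF v, of x 0] Gsh[of x v u] Gsh[of x v "u/2"] Gsh[of x v 0]
      by (subst Bochner_Integration.integral_add) (auto simp: Bochner_Integration.integral_diff)
    also have "\<dots> \<le> B v x u"
      using B_ge_difference[of v "1/2" x u] v v0 by simp
    finally show ?thesis .
  qed
  have one: "c * (f 1 / 2) \<le> B v x u"
    if v: "v \<in> {v0..v1}" and x: "x \<in> {-R..R}" and u: "1 \<le> u" for v x u
  proof -
    have "c * (f 1 / 2) \<le> B v x 1" using small[OF v x, of 1] by simp
    also have "\<dots> \<le> B v x u"
    proof -
      have "u * B v x 1 \<le> B v x u"
        using convex_on_difference[OF convex_G[of v] u, of x] v v0 by (simp add: B_def algebra_simps)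
      moreover have "B v x 1 \<le> u * B v x 1" using u v v0 by (intro mult_ge_right B_nonneg) auto
      ultimately show ?thesis by simp
    qed
    finally show ?thesis .
  qed
  \<comment> \<open>Only \<open>z \<in> {-2..-1}\<close> counts: there the unit step goes downhill,
    so the subtracted slope helps. With \<open>8 \<le> u\<close> one has
    \<open>2 \<le> u / 4\<close>, hence \<open>f z \<le> f (u / 4)\<close> and
    \<open>z + u \<ge> 3 * u / 4\<close>.\<close>
  have large: "c / (4 * D) * f u \<le> B v x u"
    if v: "v \<in> {v0..v1}" and x: "x \<in> {-R..R}" and u: "8 \<le> u" for v x u
  proof -
    let ?d = "\<lambda>z. f (z + u) - f z - u * (f (z + 1) - f z)"
    have d0: "0 \<le> ?d z" for z
      using convex_on_difference[OF conv, of u z] u by simp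
    have d1: "f u / (4 * D) \<le> ?d z" if z: "z \<in> {-2..-1}" for z
    proof -
      have "f (z + 1) \<le> f z" using z by (intro mono) auto
      then have "u * (f (z + 1) - f z) \<le> 0" using u by (intro mult_nonneg_nonpos) auto
      moreover have "f (3 * u / 4) \<le> f (z + u)" using z u by (intro mono) auto
      moreover have "f z \<le> f (u / 4)" using z u by (intro mono) auto
      moreover have "f (u / 2) + f (u / 4) \<le> f (3 * u / 4)"
        using star[of "2/3" "3 * u / 4"] star[of "1/3" "3 * u / 4"] by simp
      moreover have "f u \<le> 4 * D * f (u / 2)" using f_two[of "u / 2"] by simp
      then have "f u / (4 * D) \<le> f (u / 2)" using D by (simp add: field_simps)
      ultimately show ?thesis by linarith
    qed
    have dcont: "continuous_on S ?d" for S using fcont[of _ 0] by (intro continuous_intros fcont) auto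
    have "f u / (4 * D) = integral {-2..-1::real} (\<lambda>_. f u / (4 * D))" by simp
    also have "\<dots> \<le> integral {-2..-1} ?d"
      by (intro integral_le integrable_continuous_real dcont d1) auto
    also have "\<dots> \<le> integral {-2..2} ?d"
      by (rule integral_subset_le[OF _ integrable_continuous_real[OF dcont] integrable_continuous_real[OF dcont]])
        (use d0 in simp_all)
    finally have "c * (f u / (4 * D)) \<le> c * integral {-2..2} ?d"
      by (rule mult_left_mono) (use c(1) in simp)
    also have "\<dots> \<le> (\<integral>w. ?d (x + sqrt v * w) \<partial>std_normal)"
    proof (rule c(2)[OF v x dcont d0])
      show "integrable std_normal (\<lambda>w. ?d (x + sqrt v * w))"
        using int[OF v, of x] int[OF v, of x 0] by (intro Bochner_Integration.integrable_diff integrable_mult_right) auto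
    qed
    also have "\<dots> = G v (x + u) - G v x - u * (G v (x + 1) - G v x)"
      using int[OF v, of x u] int[OF v, of x 1] int[OF v, of x 0] Gsh[of x v u] Gsh[of x v 1] Gsh[of x v 0]
      by (simp add: Bochner_Integration.integrable_diff)
    also have "\<dots> = G v (x + u) - G v x - (G v (x + 1 / u * u) - G v x) / (1 / u)"
      using u by simp
    also have "\<dots> \<le> B v x u"
      by (rule B_ge_difference) (use v v0 u in auto)
    finally show ?thesis by simp
  qed
  define c' where "c' = min (c * (f 1 / 2)) (min (c * (f 1 / 2) / f 8) (c / (4 * D)))"
  have f1: "0 < f 1" "0 < f 8" by (auto intro: pos)
  have c': "0 < c'" using c(1) f1 D by (simp add: c'_def)
  have main: "c' * Q u \<le> B v x u"
    if v: "v \<in> {v0..v1}" and x: "x \<in> {-R..R}" and u: "0 < u" for v x u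
  proof -
    consider "u \<le> 1" | "1 < u" "u \<le> 8" | "8 < u" by linarith
    then show ?thesis
    proof cases
      case 1
      have "c' * u\<^sup>2 \<le> c * (f 1 / 2) * u\<^sup>2" by (intro mult_right_mono) (auto simp: c'_def)
      also have "\<dots> \<le> B v x u" by (rule small[OF v x u 1])
      finally show ?thesis using 1 u by (simp add: Q_def)
    next
      case 2
      have "c' * f u \<le> (c * (f 1 / 2) / f 8) * f 8"
        using 2 c(1) f1 by (intro mult_mono mono) (auto simp: c'_def)
      also have "\<dots> = c * (f 1 / 2)" using f1 by simp
      finally show ?thesis using one[OF v x, of u] 2 by (simp add: Q_def)
    next
      case 3
      have "c' * f u \<le> c / (4 * D) * f u" by (intro mult_right_mono) (auto simp: c'_def)
      then show ?thesis using large[OF v x, of u] 3 by (simp add: Q_def)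
    qed
  qed
  have "c' * Q u \<le> B v x u" if v: "v \<in> {v0..v1}" and x: "x \<in> {-R..R}" for v x u
  proof -
    consider "u > 0" | "u = 0" | "u < 0" by linarith
    then show ?thesis
    proof cases
      case 1 then show ?thesis using main v x by simp
    next
      case 2 then show ?thesis by (simp add: Q_def B_def)
    next
      case 3
      then have "c' * Q (- u) \<le> B v (- x) (- u)" using v x by (intro main) auto
      then show ?thesis by (simp add: B_uminus)
    qed
  qed
  with c' show ?thesis by (intro exI[of _ c']) auto
qed

section \<open>Dependence of the Gaussian energy on drift and variance\<close>

lemma G_strict_zero: assumes "0 \<le> v" "y \<noteq> 0" shows "G v 0 < G v y"
proof (cases "v = 0")
  case True then show ?thesis using assms pos by simp
next
  case False
  then have v: "0 < v" using assms by simp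
  obtain c where "c > 0" "\<forall>w\<in>{v..v}. \<forall>x\<in>{-1..1}. \<forall>u. c * Q u \<le> B w x u" using B_lower[OF v, of v 1] by blast
  then have "c * Q y \<le> B v 0 y" by auto
  moreover have "Gx v 0 = 0" using Gx_uminus[of v 0] by simp
  moreover have "0 < c * Q y" using \<open>c > 0\<close> assms pos by (simp add: Q_def)
  ultimately show ?thesis by (simp add: B_def)
qed

lemma G_zero_le: "0 \<le> v \<Longrightarrow> G v 0 \<le> G v y"
  using G_strict_zero[of v y] by (cases "y = 0") auto

lemma G_strict_mono: assumes "0 \<le> v" "\<bar>x\<bar> < \<bar>y\<bar>" shows "G v x < G v y"
proof -
  define t where "t = \<bar>x\<bar> / \<bar>y\<bar>"
  have t: "0 \<le> t" "t < 1" using assms by (auto simp: t_def)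
  have "G v x = G v ((1 - t) *\<^sub>R 0 + t *\<^sub>R \<bar>y\<bar>)" using assms by (simp add: t_def)
  also have "\<dots> \<le> (1 - t) * G v 0 + t * G v \<bar>y\<bar>"
    using t assms by (intro convex_onD[OF convex_G]) auto
  also have "\<dots> < (1 - t) * G v y + t * G v y"
    using t assms G_strict_zero[of v y] by (intro add_less_le_mono mult_strict_left_mono) auto
  finally show ?thesis by (simp add: algebra_simps)
qed

text \<open>At a fixed variance the energy determines the modulus of the drift but not its
  sign.\<close>

lemma G_inj: "0 \<le> v \<Longrightarrow> G v x = G v y \<Longrightarrow> \<bar>x\<bar> = \<bar>y\<bar>"
  using G_strict_mono[of v x y] G_strict_mono[of v y x] by force

lemma G_var_mono: assumes "0 \<le> v" "v \<le> w" shows "G v 0 \<le> G w 0"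
  unfolding G_def
proof (rule integral_mono)
  fix a have "\<bar>sqrt v * a\<bar> \<le> \<bar>sqrt w * a\<bar>" using assms by (simp add: abs_mult mult_right_mono)
  then show "f (0 + sqrt v * a) \<le> f (0 + sqrt w * a)" by (intro mono) simp
qed (use assms in \<open>auto intro: integrable_G[of _ 0, simplified]\<close>)

lemma G_pos: assumes "0 < w" shows "0 < G w 0"
proof (rule ccontr)
  assume "\<not> 0 < G w 0"
  then have "G w 0 = 0" using G_nonneg[of w 0] by linarith
  then have "AE a in std_normal. f (0 + sqrt w * a) = 0"
    unfolding G_def using assms by (subst (asm) integral_nonneg_eq_0_iff_AE) (auto intro: integrable_G[of _ 0, simplified])
  then have "AE a in std_normal. a\<^sup>2 = 0"
  proof eventually_elim
    fix a assume "f (0 + sqrt w * a) = 0"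
    then have "sqrt w * a = 0" using f_pos_iff[of "sqrt w * a"] by simp
    then show "a\<^sup>2 = 0" using assms by simp
  qed
  then have "(\<integral>a. a\<^sup>2 \<partial>std_normal) = 0" by (subst integral_cong_AE[where g = "\<lambda>_. 0"]) auto
  then show False by (simp add: std_normal_moments)
qed

lemma G_var_strict_mono: assumes "0 \<le> v" "v < w" shows "G v 0 < G w 0"
proof -
  have w: "0 < w" using assms by simp
  define t where "t = sqrt v / sqrt w"
  have t: "0 \<le> t" "t < 1" using assms by (auto simp: t_def)
  have "G v 0 \<le> (\<integral>a. t * f (0 + sqrt w * a) \<partial>std_normal)"
    unfolding G_def
  proof (rule integral_mono)
    fix a
    have "f (t * (sqrt w * a)) \<le> t * f (sqrt w * a)" using t by (intro star) auto
    moreover have "t * (sqrt w * a) = sqrt v * a" using w by (simp add: t_def)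
    ultimately show "f (0 + sqrt v * a) \<le> t * f (0 + sqrt w * a)" by simp
  qed (use assms in \<open>auto intro!: integrable_G[of _ 0, simplified]\<close>)
  also have "\<dots> = t * G w 0" by (simp add: G_def)
  also have "\<dots> < 1 * G w 0" using t G_pos[OF w] by (intro mult_strict_right_mono) auto
  finally show ?thesis by simp
qed

end

subsection \<open>Swapping one step of a walk for a Gaussian step\<close>

context energy
begin

text \<open>The constant depends on the lower end \<open>v0\<close> of the variances, so it is
  available only once the initial smoothing is fixed.\<close>

definition smooth_const :: "real \<Rightarrow> real \<Rightarrow> real \<Rightarrow> bool" where
  "smooth_const v0 v1 C \<longleftrightarrow> 0 \<le> C \<and> (\<forall>v\<in>{v0..v1}. \<forall>x.
     G v x \<le> C * (1 + f x) \<and> \<bar>Gx v x\<bar> \<le> C * (1 + f x) \<and> \<bar>Gxx v x\<bar> \<le> C * (1 + f x) \<and>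
     (\<forall>u. \<bar>B v x u - Gxx v x * u\<^sup>2 / 2\<bar> \<le> C * (1 + f x) * \<bar>u\<bar> ^ 3) \<and>
     (\<forall>q\<ge>0. \<bar>G (v + q) x - G v x - Gxx v x * q / 2\<bar> \<le> C * (1 + f x) * (q * sqrt q)))"

lemma smooth_const_exists: assumes "0 < v0" shows "\<exists>C. smooth_const v0 v1 C"
proof -
  obtain C1 where C1: "1 \<le> C1" "\<forall>v\<in>{0..v1}. \<forall>x. G v x \<le> C1 * (1 + f x)" using G_bound by blast
  obtain C2 where C2: "0 \<le> C2" "\<forall>v\<in>{v0..v1}. \<forall>x. \<bar>Gx v x\<bar> \<le> C2 * (1 + f x)" using Gx_bound[OF assms] by blast
  obtain C3 where C3: "0 \<le> C3" "\<forall>v\<in>{v0..v1}. \<forall>x. \<bar>Gxx v x\<bar> \<le> C3 * (1 + f x)" using Gxx_bound[OF assms] by blast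
  obtain C4 where C4: "0 \<le> C4" "\<forall>v\<in>{v0..v1}. \<forall>x u. \<bar>B v x u - Gxx v x * u\<^sup>2 / 2\<bar> \<le> C4 * (1 + f x) * \<bar>u\<bar> ^ 3"
    using G_taylor[OF assms] by blast
  obtain C5 where C5: "0 \<le> C5" "\<forall>v\<in>{v0..v1}. \<forall>x. \<forall>q\<ge>0. \<bar>G (v + q) x - G v x - Gxx v x * q / 2\<bar> \<le> C5 * (1 + f x) * (q * sqrt q)"
    using G_heat[OF assms] by blast
  define C where "C = C1 + C2 + C3 + C4 + C5"
  have up: "c * (1 + f x) * y \<le> C * (1 + f x) * y" if "c \<le> C" "0 \<le> y" for c x y
    using that by (intro mult_right_mono) auto
  have le: "C1 \<le> C" "C2 \<le> C" "C3 \<le> C" "C4 \<le> C" "C5 \<le> C" "0 \<le> C"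
    using C1 C2 C3 C4 C5 by (auto simp: C_def)
  have "smooth_const v0 v1 C"
    unfolding smooth_const_def
  proof (intro conjI ballI allI impI)
    fix v x assume v: "v \<in> {v0..v1}"
    then have v': "v \<in> {0..v1}" using assms by auto
    show "G v x \<le> C * (1 + f x)" using C1(2)[rule_format, OF v', of x] up[OF le(1), of 1 x] by simp
    show "\<bar>Gx v x\<bar> \<le> C * (1 + f x)" using C2(2)[rule_format, OF v, of x] up[OF le(2), of 1 x] by simp
    show "\<bar>Gxx v x\<bar> \<le> C * (1 + f x)" using C3(2)[rule_format, OF v, of x] up[OF le(3), of 1 x] by simp
    show "\<bar>B v x u - Gxx v x * u\<^sup>2 / 2\<bar> \<le> C * (1 + f x) * \<bar>u\<bar> ^ 3" for u
      using C4(2)[rule_format, OF v, of x u] up[OF le(4), of "\<bar>u\<bar> ^ 3" x] by simp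
    show "\<bar>G (v + q) x - G v x - Gxx v x * q / 2\<bar> \<le> C * (1 + f x) * (q * sqrt q)" if "0 \<le> q" for q
      using C5(2)[rule_format, OF v, of q x] up[OF le(5), of "q * sqrt q" x] that by simp
  qed (rule le)
  then show ?thesis by blast
qed

definition lower_const :: "real \<Rightarrow> real \<Rightarrow> real \<Rightarrow> real \<Rightarrow> bool" where
  "lower_const v0 v1 R c \<longleftrightarrow> 0 < c \<and> (\<forall>v\<in>{v0..v1}. \<forall>x\<in>{-R..R}. \<forall>u. c * Q u \<le> B v x u)"

definition tail_const :: "real \<Rightarrow> real \<Rightarrow> real \<Rightarrow> real \<Rightarrow> bool" where
  "tail_const v0 v1 \<kappa> C \<longleftrightarrow> 0 \<le> C \<and> (\<forall>v\<in>{v0..v1}. \<forall>x u. \<kappa> < \<bar>u\<bar> \<longrightarrow> B v x u \<le> C * (1 + f x) * f u)"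

end

definition far :: "real \<Rightarrow> real \<Rightarrow> real" where "far \<kappa> u = (if \<bar>u\<bar> \<le> \<kappa> then 0 else 1)"
definition near :: "real \<Rightarrow> real \<Rightarrow> real" where "near \<kappa> u = (if \<bar>u\<bar> \<le> \<kappa> then 1 else 0)"

lemma measurable_far [measurable]: "far \<kappa> \<in> borel_measurable borel"
  and measurable_near [measurable]: "near \<kappa> \<in> borel_measurable borel"
  unfolding far_def[abs_def] near_def[abs_def] by measurable

lemma near_far_simps: "far \<kappa> u = 1 - near \<kappa> u" "0 \<le> far \<kappa> u" "far \<kappa> u \<le> 1" "0 \<le> near \<kappa> u" "near \<kappa> u \<le> 1"
  by (auto simp: far_def near_def)

lemma square_near_le: "0 \<le> \<kappa> \<Longrightarrow> u\<^sup>2 * near \<kappa> u \<le> \<kappa>\<^sup>2"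
  by (auto simp: near_def abs_le_square_iff[symmetric])

text \<open>The normalised drift \<open>\<mu>\<close> is the starting point, which leaves centred
  steps. In place of second moments, a common bound \<open>H\<close> on the energies along the path
  is assumed.\<close>

locale walk = energy f p D + prob_space M
  for f p D and M :: "'a measure" +
  fixes S :: "nat \<Rightarrow> 'a \<Rightarrow> real" and n :: nat and \<mu> H :: real
  assumes meas: "k \<le> n \<Longrightarrow> S k \<in> borel_measurable M"
    and start: "S 0 \<omega> = \<mu>"
    and indep: "k < n \<Longrightarrow> indep_var borel (S k) borel (\<lambda>\<omega>. S (Suc k) \<omega> - S k \<omega>)"
    and mean_zero: "k < n \<Longrightarrow> expectation (\<lambda>\<omega>. S (Suc k) \<omega> - S k \<omega>) = 0"
    and energy_int: "k \<le> n \<Longrightarrow> integrable M (\<lambda>\<omega>. f (S k \<omega>))"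
    and energy_le: "k \<le> n \<Longrightarrow> expectation (\<lambda>\<omega>. f (S k \<omega>)) \<le> H"
begin

definition \<xi> :: "nat \<Rightarrow> 'a \<Rightarrow> real" where "\<xi> k \<omega> = S (Suc k) \<omega> - S k \<omega>"

lemma meas_S [measurable (raw)]: "k \<le> n \<Longrightarrow> S k \<in> borel_measurable M" by (rule meas)

lemma meas_xi: "k < n \<Longrightarrow> \<xi> k \<in> borel_measurable M"
  unfolding \<xi>_def[abs_def] by (intro borel_measurable_diff meas) auto

lemma S_Suc: "S (Suc k) \<omega> = S k \<omega> + \<xi> k \<omega>" by (simp add: \<xi>_def)

lemma energy_xi: assumes k: "k < n" shows "integrable M (\<lambda>\<omega>. f (\<xi> k \<omega>))"
proof (rule Bochner_Integration.integrable_bound)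
  show "integrable M (\<lambda>\<omega>. 2 * D * (f (S (Suc k) \<omega>) + f (S k \<omega>)))"
    using k by (intro integrable_mult_right Bochner_Integration.integrable_add energy_int) auto
  show "(\<lambda>\<omega>. f (\<xi> k \<omega>)) \<in> borel_measurable M" using meas_xi[OF k] by measurable
  show "AE \<omega> in M. norm (f (\<xi> k \<omega>)) \<le> norm (2 * D * (f (S (Suc k) \<omega>) + f (S k \<omega>)))"
  proof (rule AE_I2)
    fix \<omega>
    have "f (\<xi> k \<omega>) \<le> 2 * D * (f (S (Suc k) \<omega>) + f (- S k \<omega>))"
      using f_add[of "S (Suc k) \<omega>" "- S k \<omega>"] by (simp add: \<xi>_def)
    then show "norm (f (\<xi> k \<omega>)) \<le> norm (2 * D * (f (S (Suc k) \<omega>) + f (S k \<omega>)))"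
      using D by (simp add: even)
  qed
qed

lemma integrable_S_dom:
  assumes k: "k \<le> n" and [measurable]: "g \<in> borel_measurable borel" and g: "\<And>x. \<bar>g x\<bar> \<le> C * (1 + f x)"
  shows "integrable M (\<lambda>\<omega>. g (S k \<omega>))"
proof (rule Bochner_Integration.integrable_bound)
  show "integrable M (\<lambda>\<omega>. C * (1 + f (S k \<omega>)))"
    using k by (intro integrable_mult_right Bochner_Integration.integrable_add energy_int) auto
  show "(\<lambda>\<omega>. g (S k \<omega>)) \<in> borel_measurable M" using meas[OF k] by measurable
  show "AE \<omega> in M. norm (g (S k \<omega>)) \<le> norm (C * (1 + f (S k \<omega>)))"
    using g by (intro AE_I2) (simp add: order_trans[OF g abs_ge_self])
qed

lemma integrable_xi_dom:
  assumes k: "k < n" and [measurable]: "g \<in> borel_measurable borel" and g: "\<And>x. \<bar>g x\<bar> \<le> C * (1 + f x)"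
  shows "integrable M (\<lambda>\<omega>. g (\<xi> k \<omega>))"
proof (rule Bochner_Integration.integrable_bound)
  show "integrable M (\<lambda>\<omega>. C * (1 + f (\<xi> k \<omega>)))"
    using k by (intro integrable_mult_right Bochner_Integration.integrable_add energy_xi) auto
  show "(\<lambda>\<omega>. g (\<xi> k \<omega>)) \<in> borel_measurable M" using meas_xi[OF k] by measurable
  show "AE \<omega> in M. norm (g (\<xi> k \<omega>)) \<le> norm (C * (1 + f (\<xi> k \<omega>)))"
    using g by (intro AE_I2) (simp add: order_trans[OF g abs_ge_self])
qed

lemma abs_dom: "\<bar>x\<bar> \<le> (1 + 1 / f 1) * (1 + f x)"
proof -
  have "0 \<le> f x + 1 / f 1" by simp
  moreover have "(1 + 1 / f 1) * (1 + f x) = 1 + f x / f 1 + (f x + 1 / f 1)"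
    by (simp add: distrib_left distrib_right)
  ultimately show ?thesis using abs_le_f[of x] by linarith
qed

lemma xi_mean: "k < n \<Longrightarrow> integrable M (\<xi> k)" "k < n \<Longrightarrow> expectation (\<xi> k) = 0"
  using integrable_xi_dom[of k "\<lambda>x. x" "1 + 1 / f 1"] abs_dom mean_zero[of k]
  by (auto simp: \<xi>_def[abs_def])

lemma product:
  fixes g h :: "real \<Rightarrow> real"
  assumes k: "k < n" and [measurable]: "g \<in> borel_measurable borel" "h \<in> borel_measurable borel"
    and int: "integrable M (\<lambda>\<omega>. g (S k \<omega>))" "integrable M (\<lambda>\<omega>. h (\<xi> k \<omega>))"
  shows "integrable M (\<lambda>\<omega>. g (S k \<omega>) * h (\<xi> k \<omega>))"
    "expectation (\<lambda>\<omega>. g (S k \<omega>) * h (\<xi> k \<omega>)) = expectation (\<lambda>\<omega>. g (S k \<omega>)) * expectation (\<lambda>\<omega>. h (\<xi> k \<omega>))"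
proof -
  have "indep_var borel (g \<circ> S k) borel (h \<circ> \<xi> k)"
    using indep[OF k] by (intro indep_var_compose[where ?M1.0 = borel and ?M2.0 = borel]) (auto simp: \<xi>_def[abs_def])
  then have i: "indep_var borel (\<lambda>\<omega>. g (S k \<omega>)) borel (\<lambda>\<omega>. h (\<xi> k \<omega>))" by (simp add: o_def)
  show "integrable M (\<lambda>\<omega>. g (S k \<omega>) * h (\<xi> k \<omega>))" by (rule indep_var_integrable[OF i int])
  show "expectation (\<lambda>\<omega>. g (S k \<omega>) * h (\<xi> k \<omega>)) = expectation (\<lambda>\<omega>. g (S k \<omega>)) * expectation (\<lambda>\<omega>. h (\<xi> k \<omega>))"
    by (rule indep_var_lebesgue_integral[OF i int])
qed

lemma H_nonneg: "0 \<le> H"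
proof -
  have "0 \<le> expectation (\<lambda>\<omega>. f (S 0 \<omega>))" by (intro integral_nonneg_AE) auto
  with energy_le[OF le0] show ?thesis by linarith
qed

lemma weight_le: "k \<le> n \<Longrightarrow> expectation (\<lambda>\<omega>. 1 + f (S k \<omega>)) \<le> 1 + H"
  using energy_le energy_int by (subst Bochner_Integration.integral_add) (auto simp: prob_space)

text \<open>Markov's inequality: by \<open>abs_le_f\<close> the mean modulus is at most half of this
  radius.\<close>

lemma prob_ball:
  assumes k: "k \<le> n"
  shows "1 / 2 \<le> expectation (\<lambda>\<omega>. near (2 * (1 + H / f 1)) (S k \<omega>))"
proof -
  define R where "R = 2 * (1 + H / f 1)"
  have R: "0 < R" using H_nonneg by (simp add: R_def add_pos_nonneg)
  have i: "integrable M (\<lambda>\<omega>. \<bar>S k \<omega>\<bar>)"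
    by (rule integrable_S_dom[OF k, where C = "1 + 1 / f 1"]) (use abs_dom in auto)
  have "expectation (\<lambda>\<omega>. \<bar>S k \<omega>\<bar>) \<le> expectation (\<lambda>\<omega>. 1 + f (S k \<omega>) / f 1)"
    using i energy_int[OF k] abs_le_f by (intro integral_mono) auto
  also have "\<dots> = 1 + expectation (\<lambda>\<omega>. f (S k \<omega>)) / f 1"
    using energy_int[OF k] by (simp add: prob_space)
  also have "\<dots> \<le> R / 2" using energy_le[OF k] by (simp add: R_def divide_right_mono)
  finally have e: "expectation (\<lambda>\<omega>. \<bar>S k \<omega>\<bar>) / R \<le> 1 / 2" using R by (simp add: field_simps)
  have "1 - expectation (\<lambda>\<omega>. \<bar>S k \<omega>\<bar>) / R = expectation (\<lambda>\<omega>. 1 - \<bar>S k \<omega>\<bar> / R)"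
    using i by (simp add: prob_space)
  also have "\<dots> \<le> expectation (\<lambda>\<omega>. near R (S k \<omega>))"
  proof (rule integral_mono)
    show "integrable M (\<lambda>\<omega>. near R (S k \<omega>))"
      by (rule integrable_S_dom[OF k, where C = 1]) (auto simp: near_def)
    show "1 - \<bar>S k \<omega>\<bar> / R \<le> near R (S k \<omega>)" for \<omega> using R by (auto simp: near_def field_simps)
  qed (use i in auto)
  finally show ?thesis using e unfolding R_def by linarith
qed

text \<open>The steps are centred before truncation, so this is a truncated second moment rather
  than the variance of the truncated step.\<close>

definition q :: "real \<Rightarrow> nat \<Rightarrow> real" where
  "q \<kappa> k = expectation (\<lambda>\<omega>. (\<xi> k \<omega>)\<^sup>2 * near \<kappa> (\<xi> k \<omega>))"

lemma q_bounds: assumes \<kappa>: "0 \<le> \<kappa>" and k: "k < n"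
  shows "0 \<le> q \<kappa> k" "q \<kappa> k \<le> \<kappa>\<^sup>2" "integrable M (\<lambda>\<omega>. (\<xi> k \<omega>)\<^sup>2 * near \<kappa> (\<xi> k \<omega>))"
proof -
  show i: "integrable M (\<lambda>\<omega>. (\<xi> k \<omega>)\<^sup>2 * near \<kappa> (\<xi> k \<omega>))"
  proof (rule integrable_const_bound[where B = "\<kappa>\<^sup>2"])
    show "AE \<omega> in M. norm ((\<xi> k \<omega>)\<^sup>2 * near \<kappa> (\<xi> k \<omega>)) \<le> \<kappa>\<^sup>2"
      using square_near_le[OF \<kappa>] near_far_simps(4) by (intro AE_I2) (simp add: abs_of_nonneg)
    show "(\<lambda>\<omega>. (\<xi> k \<omega>)\<^sup>2 * near \<kappa> (\<xi> k \<omega>)) \<in> borel_measurable M" using meas_xi[OF k] by measurable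
  qed
  show "0 \<le> q \<kappa> k" unfolding q_def by (intro integral_nonneg_AE) (auto simp: near_far_simps)
  have "q \<kappa> k \<le> expectation (\<lambda>\<omega>. \<kappa>\<^sup>2)" unfolding q_def by (intro integral_mono i square_near_le[OF \<kappa>]) auto
  then show "q \<kappa> k \<le> \<kappa>\<^sup>2" by (simp add: prob_space)
qed

context
  fixes v0 v1 C
  assumes C: "smooth_const v0 v1 C" and v0: "0 < v0"
begin

lemma C_nonneg: "0 \<le> C" using C by (simp add: smooth_const_def)

lemma C_bounds:
  assumes "v \<in> {v0..v1}"
  shows "G v x \<le> C * (1 + f x)" "\<bar>Gx v x\<bar> \<le> C * (1 + f x)" "\<bar>Gxx v x\<bar> \<le> C * (1 + f x)"
    "\<bar>B v x u - Gxx v x * u\<^sup>2 / 2\<bar> \<le> C * (1 + f x) * \<bar>u\<bar> ^ 3"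
    "0 \<le> h \<Longrightarrow> \<bar>G (v + h) x - G v x - Gxx v x * h / 2\<bar> \<le> C * (1 + f x) * (h * sqrt h)"
  using C assms unfolding smooth_const_def by blast+

lemma int_GS: assumes "v \<in> {v0..v1}" "k \<le> n"
  shows "integrable M (\<lambda>\<omega>. G v (S k \<omega>))" "integrable M (\<lambda>\<omega>. Gx v (S k \<omega>))" "integrable M (\<lambda>\<omega>. Gxx v (S k \<omega>))"
  using assms C_bounds[OF assms(1)]
  by (auto intro!: integrable_S_dom[where C = C])

lemma B_eq: "B v (S k \<omega>) (\<xi> k \<omega>) = G v (S (Suc k) \<omega>) - G v (S k \<omega>) - Gx v (S k \<omega>) * \<xi> k \<omega>"
  by (simp add: B_def S_Suc)

text \<open>Independence and centring annihilate the mean of the linear term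
  \<open>Gx v (S k \<omega>) * \<xi> k \<omega>\<close>.\<close>

lemma step_B: assumes v: "v \<in> {v0..v1}" and k: "k < n"
  shows "integrable M (\<lambda>\<omega>. B v (S k \<omega>) (\<xi> k \<omega>))"
    "expectation (\<lambda>\<omega>. B v (S k \<omega>) (\<xi> k \<omega>)) = expectation (\<lambda>\<omega>. G v (S (Suc k) \<omega>)) - expectation (\<lambda>\<omega>. G v (S k \<omega>))"
proof -
  have m: "(\<lambda>x. x) \<in> borel_measurable (borel :: real measure)" by measurable
  note p = product[OF k measurable_Gx m int_GS(2)[OF v less_imp_le[OF k]] xi_mean(1)[OF k]]
  have i: "integrable M (\<lambda>\<omega>. Gx v (S k \<omega>) * \<xi> k \<omega>)" "expectation (\<lambda>\<omega>. Gx v (S k \<omega>) * \<xi> k \<omega>) = 0"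
    using p xi_mean[OF k] by auto
  note g = int_GS(1)[OF v, of k] int_GS(1)[OF v, of "Suc k"]
  show "integrable M (\<lambda>\<omega>. B v (S k \<omega>) (\<xi> k \<omega>))" unfolding B_eq using i g k by auto
  show "expectation (\<lambda>\<omega>. B v (S k \<omega>) (\<xi> k \<omega>)) = expectation (\<lambda>\<omega>. G v (S (Suc k) \<omega>)) - expectation (\<lambda>\<omega>. G v (S k \<omega>))"
    unfolding B_eq using i g k by (simp add: Bochner_Integration.integrable_diff)
qed

lemma meas_B: "k < n \<Longrightarrow> (\<lambda>\<omega>. B v (S k \<omega>) (\<xi> k \<omega>)) \<in> borel_measurable M"
  unfolding B_def using meas[of k] meas_xi[of k] by measurable

lemma int_B_cut: assumes v: "v \<in> {v0..v1}" and k: "k < n"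
  shows "integrable M (\<lambda>\<omega>. B v (S k \<omega>) (\<xi> k \<omega>) * far \<kappa> (\<xi> k \<omega>))"
    "integrable M (\<lambda>\<omega>. B v (S k \<omega>) (\<xi> k \<omega>) * near \<kappa> (\<xi> k \<omega>))"
proof -
  show "integrable M (\<lambda>\<omega>. B v (S k \<omega>) (\<xi> k \<omega>) * far \<kappa> (\<xi> k \<omega>))"
    by (rule Bochner_Integration.integrable_bound[OF step_B(1)[OF v k]])
      (use meas_B[OF k] meas_xi[OF k] in \<open>auto simp: far_def\<close>)
  show "integrable M (\<lambda>\<omega>. B v (S k \<omega>) (\<xi> k \<omega>) * near \<kappa> (\<xi> k \<omega>))"
    by (rule Bochner_Integration.integrable_bound[OF step_B(1)[OF v k]])
      (use meas_B[OF k] meas_xi[OF k] in \<open>auto simp: near_def\<close>)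
qed

text \<open>The lower bound on \<open>B\<close> holds at bounded positions only. By
  \<open>prob_ball\<close> these have probability at least \<open>1 / 2\<close>, and they are
  independent of the step, whence \<open>c / 2\<close>.\<close>

lemma far_lower:
  assumes v: "v \<in> {v0..v1}" and k: "k < n" and c: "lower_const v v (2 * (1 + H / f 1)) c"
  shows "c / 2 * expectation (\<lambda>\<omega>. Q (\<xi> k \<omega>) * far \<kappa> (\<xi> k \<omega>))
    \<le> expectation (\<lambda>\<omega>. B v (S k \<omega>) (\<xi> k \<omega>) * far \<kappa> (\<xi> k \<omega>))"
proof -
  define R where "R = 2 * (1 + H / f 1)"
  have c0: "0 < c" and cB: "\<And>x u. x \<in> {-R..R} \<Longrightarrow> c * Q u \<le> B v x u"
    using c unfolding R_def[symmetric] lower_const_def by auto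
  have mQ: "(\<lambda>u. Q u * far \<kappa> u) \<in> borel_measurable borel" by measurable
  have Qh: "0 \<le> Q u * far \<kappa> u" "Q u * far \<kappa> u \<le> 1 * (1 + f u)" for u
    using Q_le[of u] by (auto simp: far_def)
  have iQ: "integrable M (\<lambda>\<omega>. Q (\<xi> k \<omega>) * far \<kappa> (\<xi> k \<omega>))"
    by (rule integrable_xi_dom[OF k mQ, where C = 1]) (use Qh in auto)
  have iS: "integrable M (\<lambda>\<omega>. near R (S k \<omega>))"
    using k by (intro integrable_S_dom[where C = 1]) (auto simp: near_def)
  note p = product[OF k measurable_near mQ iS iQ]
  have "c * (1 / 2 * expectation (\<lambda>\<omega>. Q (\<xi> k \<omega>) * far \<kappa> (\<xi> k \<omega>)))
    \<le> c * (expectation (\<lambda>\<omega>. near R (S k \<omega>)) * expectation (\<lambda>\<omega>. Q (\<xi> k \<omega>) * far \<kappa> (\<xi> k \<omega>)))"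
    using c0 prob_ball[of k] k Qh(1) unfolding R_def[symmetric] by (intro mult_left_mono mult_right_mono integral_nonneg_AE) auto
  also have "\<dots> = expectation (\<lambda>\<omega>. c * (near R (S k \<omega>) * (Q (\<xi> k \<omega>) * far \<kappa> (\<xi> k \<omega>))))"
    using p(2) by simp
  also have "\<dots> \<le> expectation (\<lambda>\<omega>. B v (S k \<omega>) (\<xi> k \<omega>) * far \<kappa> (\<xi> k \<omega>))"
  proof (rule integral_mono[OF _ int_B_cut(1)[OF v k]])
    show "integrable M (\<lambda>\<omega>. c * (near R (S k \<omega>) * (Q (\<xi> k \<omega>) * far \<kappa> (\<xi> k \<omega>))))"
      using p(1) by (rule integrable_mult_right)
    fix \<omega>
    have b: "0 \<le> B v (S k \<omega>) (\<xi> k \<omega>)" using v v0 by (intro B_nonneg) auto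
    show "c * (near R (S k \<omega>) * (Q (\<xi> k \<omega>) * far \<kappa> (\<xi> k \<omega>))) \<le> B v (S k \<omega>) (\<xi> k \<omega>) * far \<kappa> (\<xi> k \<omega>)"
    proof (cases "\<bar>S k \<omega>\<bar> \<le> R")
      case True
      then have "c * Q (\<xi> k \<omega>) \<le> B v (S k \<omega>) (\<xi> k \<omega>)" by (intro cB) auto
      then have "c * Q (\<xi> k \<omega>) * far \<kappa> (\<xi> k \<omega>) \<le> B v (S k \<omega>) (\<xi> k \<omega>) * far \<kappa> (\<xi> k \<omega>)"
        by (intro mult_right_mono near_far_simps)
      then show ?thesis using True by (simp add: near_def mult.assoc)
    next
      case False
      then show ?thesis using b by (simp add: near_def near_far_simps)
    qed
  qed
  finally show ?thesis by simp
qed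

lemma far_upper:
  assumes v: "v \<in> {v0..v1}" and k: "k < n" and T: "tail_const v0 v1 \<kappa>' T" and \<kappa>: "\<kappa>' \<le> \<kappa>"
  shows "expectation (\<lambda>\<omega>. B v (S k \<omega>) (\<xi> k \<omega>) * far \<kappa> (\<xi> k \<omega>))
    \<le> T * (1 + H) * expectation (\<lambda>\<omega>. f (\<xi> k \<omega>) * far \<kappa> (\<xi> k \<omega>))"
proof -
  have T0: "0 \<le> T" and TB: "\<And>x u. \<kappa>' < \<bar>u\<bar> \<Longrightarrow> B v x u \<le> T * (1 + f x) * f u"
    using T v by (auto simp: tail_const_def)
  have m1: "(\<lambda>x. 1 + f x) \<in> borel_measurable borel" and m2: "(\<lambda>u. f u * far \<kappa> u) \<in> borel_measurable borel"
    by measurable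
  have ih: "integrable M (\<lambda>\<omega>. f (\<xi> k \<omega>) * far \<kappa> (\<xi> k \<omega>))"
    by (rule integrable_xi_dom[OF k, where C = 1 and g = "\<lambda>u. f u * far \<kappa> u"]) (auto simp: far_def)
  have iS: "integrable M (\<lambda>\<omega>. 1 + f (S k \<omega>))" using energy_int k by auto
  note p = product[OF k m1 m2 iS ih]
  have "expectation (\<lambda>\<omega>. B v (S k \<omega>) (\<xi> k \<omega>) * far \<kappa> (\<xi> k \<omega>))
    \<le> expectation (\<lambda>\<omega>. T * ((1 + f (S k \<omega>)) * (f (\<xi> k \<omega>) * far \<kappa> (\<xi> k \<omega>))))"
  proof (rule integral_mono[OF int_B_cut(1)[OF v k]])
    show "integrable M (\<lambda>\<omega>. T * ((1 + f (S k \<omega>)) * (f (\<xi> k \<omega>) * far \<kappa> (\<xi> k \<omega>))))"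
      using p(1) by (rule integrable_mult_right)
    show "B v (S k \<omega>) (\<xi> k \<omega>) * far \<kappa> (\<xi> k \<omega>) \<le> T * ((1 + f (S k \<omega>)) * (f (\<xi> k \<omega>) * far \<kappa> (\<xi> k \<omega>)))" for \<omega>
      using TB[of "\<xi> k \<omega>" "S k \<omega>"] \<kappa> by (auto simp: far_def mult.assoc)
  qed
  also have "\<dots> = T * (expectation (\<lambda>\<omega>. 1 + f (S k \<omega>)) * expectation (\<lambda>\<omega>. f (\<xi> k \<omega>) * far \<kappa> (\<xi> k \<omega>)))"
    using p(2) by simp
  also have "\<dots> \<le> T * ((1 + H) * expectation (\<lambda>\<omega>. f (\<xi> k \<omega>) * far \<kappa> (\<xi> k \<omega>)))"
    using T0 weight_le[of k] k by (intro mult_left_mono mult_right_mono integral_nonneg_AE) (auto simp: far_def)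
  finally show ?thesis by (simp add: mult.assoc)
qed

text \<open>The near part of the step and a Gaussian step of variance \<open>q \<kappa> k\<close>
  share the leading term, half of \<open>q \<kappa> k\<close> times the mean of \<open>Gxx\<close>.
  Each deviates by a third-order error, and the cut-off turns one order into a factor
  \<open>\<kappa>\<close>. The far part is kept exactly because its sign matters later.\<close>

lemma step_estimate:
  assumes v: "v \<in> {v0..v1}" and k: "k < n" and \<kappa>: "0 \<le> \<kappa>"
  shows "integrable M (\<lambda>\<omega>. G (v + q \<kappa> k) (S k \<omega>))"
    "\<bar>expectation (\<lambda>\<omega>. G v (S (Suc k) \<omega>)) - expectation (\<lambda>\<omega>. G (v + q \<kappa> k) (S k \<omega>))
      - expectation (\<lambda>\<omega>. B v (S k \<omega>) (\<xi> k \<omega>) * far \<kappa> (\<xi> k \<omega>))\<bar> \<le> 2 * C * (1 + H) * \<kappa> * q \<kappa> k"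
proof -
  let ?q = "q \<kappa> k"
  note q = q_bounds[OF \<kappa> k]
  have k': "k \<le> n" using k by simp
  note g = int_GS[OF v k']
  have iS: "integrable M (\<lambda>\<omega>. 1 + f (S k \<omega>))" using energy_int k by auto
  obtain C' where C': "1 \<le> C'" "\<And>w x. w \<in> {0..v + ?q} \<Longrightarrow> G w x \<le> C' * (1 + f x)"
    using G_bound[of "v + ?q"] by blast
  show gi: "integrable M (\<lambda>\<omega>. G (v + ?q) (S k \<omega>))"
    by (rule integrable_S_dom[OF k', where C = C']) (use C'(2)[of "v + ?q"] v v0 q in auto)
  have sq: "?q * sqrt ?q \<le> \<kappa> * ?q"
  proof -
    have "sqrt ?q \<le> sqrt (\<kappa>\<^sup>2)" using q by (intro real_sqrt_le_mono)
    then have "?q * sqrt ?q \<le> ?q * \<kappa>" using \<kappa> q by (intro mult_left_mono) auto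
    then show ?thesis by (simp add: mult.commute)
  qed
  define A where "A = expectation (\<lambda>\<omega>. Gxx v (S k \<omega>))"
  have h: "\<bar>expectation (\<lambda>\<omega>. G (v + ?q) (S k \<omega>)) - expectation (\<lambda>\<omega>. G v (S k \<omega>)) - A * ?q / 2\<bar>
    \<le> C * (1 + H) * \<kappa> * ?q"
  proof -
    have e: "expectation (\<lambda>\<omega>. G (v + ?q) (S k \<omega>)) - expectation (\<lambda>\<omega>. G v (S k \<omega>)) - A * ?q / 2
      = expectation (\<lambda>\<omega>. G (v + ?q) (S k \<omega>) - G v (S k \<omega>) - Gxx v (S k \<omega>) * (?q / 2))"
      unfolding A_def using g gi by simp
    have "\<bar>expectation (\<lambda>\<omega>. G (v + ?q) (S k \<omega>)) - expectation (\<lambda>\<omega>. G v (S k \<omega>)) - A * ?q / 2\<bar> \<le> expectation (\<lambda>\<omega>. \<bar>G (v + ?q) (S k \<omega>) - G v (S k \<omega>) - Gxx v (S k \<omega>) * (?q / 2)\<bar>)"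
      unfolding e by (rule integral_abs_bound)
    also have "\<dots> \<le> expectation (\<lambda>\<omega>. C * \<kappa> * ?q * (1 + f (S k \<omega>)))"
    proof (rule integral_mono)
      fix \<omega>
      have "\<bar>G (v + ?q) (S k \<omega>) - G v (S k \<omega>) - Gxx v (S k \<omega>) * (?q / 2)\<bar> \<le> C * (1 + f (S k \<omega>)) * (?q * sqrt ?q)"
        unfolding times_divide_eq_right by (rule C_bounds(5)[OF v q(1)])
      also have "\<dots> \<le> C * (1 + f (S k \<omega>)) * (\<kappa> * ?q)"
        by (rule mult_left_mono[OF sq]) (use C_nonneg in simp)
      finally show "\<bar>G (v + ?q) (S k \<omega>) - G v (S k \<omega>) - Gxx v (S k \<omega>) * (?q / 2)\<bar> \<le> C * \<kappa> * ?q * (1 + f (S k \<omega>))"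
        by (simp add: mult_ac)
    qed (use g gi iS in auto)
    also have "\<dots> = C * \<kappa> * ?q * expectation (\<lambda>\<omega>. 1 + f (S k \<omega>))" by simp
    also have "\<dots> \<le> C * \<kappa> * ?q * (1 + H)"
      by (rule mult_left_mono[OF weight_le[OF k']]) (use C_nonneg \<kappa> q in simp)
    finally show ?thesis by (simp add: mult_ac)
  qed
  have l: "\<bar>expectation (\<lambda>\<omega>. B v (S k \<omega>) (\<xi> k \<omega>) * near \<kappa> (\<xi> k \<omega>)) - A * ?q / 2\<bar> \<le> C * (1 + H) * \<kappa> * ?q"
  proof -
    have m1: "(\<lambda>x. 1 + f x) \<in> borel_measurable borel" and m2: "(\<lambda>u. u\<^sup>2 * near \<kappa> u) \<in> borel_measurable borel"
      by measurable
    note p1 = product[OF k measurable_Gxx m2 g(3) q(3)]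
    note p2 = product[OF k m1 m2 iS q(3)]
    have "A * ?q / 2 = expectation (\<lambda>\<omega>. Gxx v (S k \<omega>) * ((\<xi> k \<omega>)\<^sup>2 * near \<kappa> (\<xi> k \<omega>)) / 2)"
      using p1(2) by (simp add: A_def q_def)
    then have e: "expectation (\<lambda>\<omega>. B v (S k \<omega>) (\<xi> k \<omega>) * near \<kappa> (\<xi> k \<omega>)) - A * ?q / 2
      = expectation (\<lambda>\<omega>. B v (S k \<omega>) (\<xi> k \<omega>) * near \<kappa> (\<xi> k \<omega>) - Gxx v (S k \<omega>) * ((\<xi> k \<omega>)\<^sup>2 * near \<kappa> (\<xi> k \<omega>)) / 2)"
      using int_B_cut(2)[OF v k] p1(1) by simp
    have "\<bar>expectation (\<lambda>\<omega>. B v (S k \<omega>) (\<xi> k \<omega>) * near \<kappa> (\<xi> k \<omega>)) - A * ?q / 2\<bar> \<le> expectation (\<lambda>\<omega>. \<bar>B v (S k \<omega>) (\<xi> k \<omega>) * near \<kappa> (\<xi> k \<omega>) - Gxx v (S k \<omega>) * ((\<xi> k \<omega>)\<^sup>2 * near \<kappa> (\<xi> k \<omega>)) / 2\<bar>)"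
      unfolding e by (rule integral_abs_bound)
    also have "\<dots> \<le> expectation (\<lambda>\<omega>. C * \<kappa> * ((1 + f (S k \<omega>)) * ((\<xi> k \<omega>)\<^sup>2 * near \<kappa> (\<xi> k \<omega>))))"
    proof (rule integral_mono)
      show "integrable M (\<lambda>\<omega>. C * \<kappa> * ((1 + f (S k \<omega>)) * ((\<xi> k \<omega>)\<^sup>2 * near \<kappa> (\<xi> k \<omega>))))"
        using p2(1) by (rule integrable_mult_right)
      fix \<omega>
      show "\<bar>B v (S k \<omega>) (\<xi> k \<omega>) * near \<kappa> (\<xi> k \<omega>) - Gxx v (S k \<omega>) * ((\<xi> k \<omega>)\<^sup>2 * near \<kappa> (\<xi> k \<omega>)) / 2\<bar>
        \<le> C * \<kappa> * ((1 + f (S k \<omega>)) * ((\<xi> k \<omega>)\<^sup>2 * near \<kappa> (\<xi> k \<omega>)))"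
      proof (cases "\<bar>\<xi> k \<omega>\<bar> \<le> \<kappa>")
        case True
        have "\<bar>\<xi> k \<omega>\<bar> ^ 3 = \<bar>\<xi> k \<omega>\<bar> * (\<xi> k \<omega>)\<^sup>2"
          by (simp add: power3_eq_cube power2_eq_square mult.assoc)
        also have "\<dots> \<le> \<kappa> * (\<xi> k \<omega>)\<^sup>2" by (rule mult_right_mono[OF True]) simp
        finally have "C * (1 + f (S k \<omega>)) * \<bar>\<xi> k \<omega>\<bar> ^ 3 \<le> C * (1 + f (S k \<omega>)) * (\<kappa> * (\<xi> k \<omega>)\<^sup>2)"
          by (rule mult_left_mono) (use C_nonneg in simp)
        with C_bounds(4)[OF v, of "S k \<omega>" "\<xi> k \<omega>"] True show ?thesis by (simp add: near_def mult_ac)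
      qed (simp add: near_def)
    qed (use int_B_cut(2)[OF v k] p1(1) in auto)
    also have "\<dots> = C * \<kappa> * (expectation (\<lambda>\<omega>. 1 + f (S k \<omega>)) * ?q)" using p2(2) by (simp add: q_def)
    also have "\<dots> \<le> C * \<kappa> * ((1 + H) * ?q)"
      by (rule mult_left_mono[OF mult_right_mono[OF weight_le[OF k'] q(1)]]) (use C_nonneg \<kappa> in simp)
    finally show ?thesis by (simp add: mult_ac)
  qed
  have s: "expectation (\<lambda>\<omega>. G v (S (Suc k) \<omega>)) - expectation (\<lambda>\<omega>. G v (S k \<omega>))
    = expectation (\<lambda>\<omega>. B v (S k \<omega>) (\<xi> k \<omega>) * near \<kappa> (\<xi> k \<omega>)) + expectation (\<lambda>\<omega>. B v (S k \<omega>) (\<xi> k \<omega>) * far \<kappa> (\<xi> k \<omega>))"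
    unfolding step_B(2)[OF v k, symmetric] using int_B_cut[OF v k, of \<kappa>]
    by (subst Bochner_Integration.integral_add[symmetric]) (auto simp: near_far_simps(1) algebra_simps)
  have "\<bar>expectation (\<lambda>\<omega>. G v (S (Suc k) \<omega>)) - expectation (\<lambda>\<omega>. G (v + ?q) (S k \<omega>))
      - expectation (\<lambda>\<omega>. B v (S k \<omega>) (\<xi> k \<omega>) * far \<kappa> (\<xi> k \<omega>))\<bar> \<le> C * (1 + H) * \<kappa> * ?q + C * (1 + H) * \<kappa> * ?q"
    using s h l by (simp only: abs_le_iff) linarith
  then show "\<bar>expectation (\<lambda>\<omega>. G v (S (Suc k) \<omega>)) - expectation (\<lambda>\<omega>. G (v + q \<kappa> k) (S k \<omega>))
      - expectation (\<lambda>\<omega>. B v (S k \<omega>) (\<xi> k \<omega>) * far \<kappa> (\<xi> k \<omega>))\<bar> \<le> 2 * C * (1 + H) * \<kappa> * q \<kappa> k"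
    by (simp only: mult.assoc mult_2[symmetric])
qed

text \<open>Every step raises the smoothed energy by at least a multiple of the mean of
  \<open>Q\<close>, and these gains telescope. This takes the place of an a priori bound on
  variances.\<close>

lemma energy_bound:
  assumes v: "v \<in> {v0..v1}" and c: "lower_const v v (2 * (1 + H / f 1)) c"
  shows "c / 2 * (\<Sum>k<n. expectation (\<lambda>\<omega>. Q (\<xi> k \<omega>))) \<le> expectation (\<lambda>\<omega>. G v (S n \<omega>))"
proof -
  \<comment> \<open>With cut-off \<open>- 1\<close> every step counts as far, so
    \<open>far_lower\<close> bounds the whole of \<open>Q\<close>.\<close>
  have hi1: "far (- 1) u = 1" for u by (simp add: far_def)
  have "c / 2 * (\<Sum>k<n. expectation (\<lambda>\<omega>. Q (\<xi> k \<omega>)))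
    = (\<Sum>k<n. c / 2 * expectation (\<lambda>\<omega>. Q (\<xi> k \<omega>)))" by (rule sum_distrib_left)
  also have "\<dots> \<le> (\<Sum>k<n. expectation (\<lambda>\<omega>. G v (S (Suc k) \<omega>)) - expectation (\<lambda>\<omega>. G v (S k \<omega>)))"
  proof (rule sum_mono)
    fix k assume "k \<in> {..<n}"
    then have k: "k < n" by simp
    show "c / 2 * expectation (\<lambda>\<omega>. Q (\<xi> k \<omega>)) \<le> expectation (\<lambda>\<omega>. G v (S (Suc k) \<omega>)) - expectation (\<lambda>\<omega>. G v (S k \<omega>))"
      using far_lower[OF v k c, of "- 1"] step_B(2)[OF v k] by (simp add: hi1)
  qed
  also have "\<dots> = expectation (\<lambda>\<omega>. G v (S n \<omega>)) - expectation (\<lambda>\<omega>. G v (S 0 \<omega>))"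
    by (rule sum_lessThan_telescope)
  also have "\<dots> \<le> expectation (\<lambda>\<omega>. G v (S n \<omega>))" by (simp add: start prob_space)
  finally show ?thesis .
qed

context
  fixes l \<kappa>
  assumes l: "v0 \<le> l" and \<kappa>: "0 \<le> \<kappa>" and V: "l + (\<Sum>k<n. q \<kappa> k) \<le> v1"
begin

text \<open>The smoothing variance once all steps from \<open>k\<close> on have been replaced by
  Gaussian ones.\<close>

definition \<tau> :: "nat \<Rightarrow> real" where "\<tau> k = l + (\<Sum>j\<in>{k..<n}. q \<kappa> j)"

lemma tau_range: "\<tau> k \<in> {v0..v1}"
proof -
  have "0 \<le> (\<Sum>j\<in>{k..<n}. q \<kappa> j)" by (intro sum_nonneg q_bounds(1)[OF \<kappa>]) auto
  moreover have "(\<Sum>j\<in>{k..<n}. q \<kappa> j) \<le> (\<Sum>j<n. q \<kappa> j)"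
    by (intro sum_mono2) (use q_bounds(1)[OF \<kappa>] in auto)
  ultimately show ?thesis using l V by (simp add: \<tau>_def)
qed

text \<open>Lindeberg's hybrids \<open>G (\<tau> k) (S k \<omega>)\<close> lead from the pure
  Gaussian at \<open>k = 0\<close> to the walk smoothed by \<open>l\<close> at
  \<open>k = n\<close>.\<close>

lemma telescope:
  "\<bar>expectation (\<lambda>\<omega>. G l (S n \<omega>)) - G (l + (\<Sum>k<n. q \<kappa> k)) \<mu>
     - (\<Sum>k<n. expectation (\<lambda>\<omega>. B (\<tau> (Suc k)) (S k \<omega>) (\<xi> k \<omega>) * far \<kappa> (\<xi> k \<omega>)))\<bar>
   \<le> 2 * C * (1 + H) * \<kappa> * (\<Sum>k<n. q \<kappa> k)"
proof -
  define d where "d k = expectation (\<lambda>\<omega>. G (\<tau> (Suc k)) (S (Suc k) \<omega>)) - expectation (\<lambda>\<omega>. G (\<tau> k) (S k \<omega>))" for k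
  define b where "b k = expectation (\<lambda>\<omega>. B (\<tau> (Suc k)) (S k \<omega>) (\<xi> k \<omega>) * far \<kappa> (\<xi> k \<omega>))" for k
  have "(\<Sum>k<n. d k) = expectation (\<lambda>\<omega>. G (\<tau> n) (S n \<omega>)) - expectation (\<lambda>\<omega>. G (\<tau> 0) (S 0 \<omega>))"
    unfolding d_def by (rule sum_lessThan_telescope)
  also have "\<dots> = expectation (\<lambda>\<omega>. G l (S n \<omega>)) - G (l + (\<Sum>k<n. q \<kappa> k)) \<mu>"
    by (simp add: \<tau>_def start prob_space atLeast0LessThan)
  finally have sum: "expectation (\<lambda>\<omega>. G l (S n \<omega>)) - G (l + (\<Sum>k<n. q \<kappa> k)) \<mu> - (\<Sum>k<n. b k) = (\<Sum>k<n. d k - b k)"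
    by (simp add: sum_subtractf)
  have "\<bar>\<Sum>k<n. d k - b k\<bar> \<le> (\<Sum>k<n. 2 * C * (1 + H) * \<kappa> * q \<kappa> k)"
  proof (rule order_trans[OF sum_abs sum_mono])
    fix k assume "k \<in> {..<n}"
    then have k: "k < n" by simp
    have "\<tau> k = \<tau> (Suc k) + q \<kappa> k"
      using k by (simp add: \<tau>_def sum.atLeast_Suc_lessThan)
    then show "\<bar>d k - b k\<bar> \<le> 2 * C * (1 + H) * \<kappa> * q \<kappa> k"
      using step_estimate(2)[OF tau_range[of "Suc k"] k \<kappa>] by (simp add: d_def b_def)
  qed
  then show ?thesis unfolding sum b_def[symmetric] by (simp only: sum_distrib_left)
qed

text \<open>Here the far parts are errors, estimated from above; in \<open>lindeberg_gain\<close>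
  the same terms are the profit.\<close>

lemma lindeberg:
  assumes T: "tail_const v0 v1 \<kappa>' T" and \<kappa>': "\<kappa>' \<le> \<kappa>"
  shows "\<bar>expectation (\<lambda>\<omega>. G l (S n \<omega>)) - G (l + (\<Sum>k<n. q \<kappa> k)) \<mu>\<bar>
    \<le> 2 * C * (1 + H) * \<kappa> * (\<Sum>k<n. q \<kappa> k) + T * (1 + H) * (\<Sum>k<n. expectation (\<lambda>\<omega>. f (\<xi> k \<omega>) * far \<kappa> (\<xi> k \<omega>)))"
proof -
  let ?b = "\<lambda>k. expectation (\<lambda>\<omega>. B (\<tau> (Suc k)) (S k \<omega>) (\<xi> k \<omega>) * far \<kappa> (\<xi> k \<omega>))"
  have "(\<Sum>k<n. ?b k) \<le> (\<Sum>k<n. T * (1 + H) * expectation (\<lambda>\<omega>. f (\<xi> k \<omega>) * far \<kappa> (\<xi> k \<omega>)))"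
    by (intro sum_mono far_upper[OF tau_range _ T \<kappa>']) auto
  then have "(\<Sum>k<n. ?b k) \<le> T * (1 + H) * (\<Sum>k<n. expectation (\<lambda>\<omega>. f (\<xi> k \<omega>) * far \<kappa> (\<xi> k \<omega>)))"
    by (simp only: sum_distrib_left)
  moreover have "0 \<le> (\<Sum>k<n. ?b k)"
  proof (intro sum_nonneg integral_nonneg_AE AE_I2 mult_nonneg_nonneg near_far_simps)
    show "0 \<le> B (\<tau> (Suc k)) (S k \<omega>) (\<xi> k \<omega>)" for k \<omega>
      using tau_range[of "Suc k"] v0 by (intro B_nonneg) auto
  qed
  ultimately show ?thesis using telescope by linarith
qed

text \<open>Gaussian steps are swapped in from the end of the walk, so when one of the first \<open>n1\<close> steps is
  treated, the later Gaussian steps already smooth \<open>f\<close> at variance at least \<open>v2\<close>. This makes the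
  constant \<open>c\<close> independent of the initial smoothing \<open>l\<close>.\<close>

lemma lindeberg_gain:
  assumes n1: "n1 \<le> n" and v2: "v2 \<le> (\<Sum>k\<in>{n1..<n}. q \<kappa> k)" and c: "lower_const v2 v1 (2 * (1 + H / f 1)) c"
  shows "G (l + (\<Sum>k<n. q \<kappa> k)) \<mu> - 2 * C * (1 + H) * \<kappa> * (\<Sum>k<n. q \<kappa> k)
      + c / 2 * (\<Sum>k<n1. expectation (\<lambda>\<omega>. Q (\<xi> k \<omega>) * far \<kappa> (\<xi> k \<omega>)))
    \<le> expectation (\<lambda>\<omega>. G l (S n \<omega>))"
proof -
  let ?b = "\<lambda>k. expectation (\<lambda>\<omega>. B (\<tau> (Suc k)) (S k \<omega>) (\<xi> k \<omega>) * far \<kappa> (\<xi> k \<omega>))"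
  have b0: "0 \<le> ?b k" for k
  proof (intro integral_nonneg_AE AE_I2 mult_nonneg_nonneg near_far_simps)
    show "0 \<le> B (\<tau> (Suc k)) (S k \<omega>) (\<xi> k \<omega>)" for \<omega>
      using tau_range[of "Suc k"] v0 by (intro B_nonneg) auto
  qed
  have "c / 2 * (\<Sum>k<n1. expectation (\<lambda>\<omega>. Q (\<xi> k \<omega>) * far \<kappa> (\<xi> k \<omega>)))
    = (\<Sum>k<n1. c / 2 * expectation (\<lambda>\<omega>. Q (\<xi> k \<omega>) * far \<kappa> (\<xi> k \<omega>)))" by (rule sum_distrib_left)
  also have "\<dots> \<le> (\<Sum>k<n1. ?b k)"
  proof (rule sum_mono)
    fix k assume k: "k \<in> {..<n1}"
    have "(\<Sum>k\<in>{n1..<n}. q \<kappa> k) \<le> (\<Sum>k\<in>{Suc k..<n}. q \<kappa> k)"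
      by (intro sum_mono2) (use k q_bounds(1)[OF \<kappa>] in auto)
    then have "\<tau> (Suc k) \<in> {v2..v1}" using v2 l v0 tau_range[of "Suc k"] by (auto simp: \<tau>_def)
    then have "lower_const (\<tau> (Suc k)) (\<tau> (Suc k)) (2 * (1 + H / f 1)) c"
      using c unfolding lower_const_def by auto
    then show "c / 2 * expectation (\<lambda>\<omega>. Q (\<xi> k \<omega>) * far \<kappa> (\<xi> k \<omega>)) \<le> ?b k"
      using k n1 by (intro far_lower[OF tau_range]) auto
  qed
  also have "\<dots> \<le> (\<Sum>k<n. ?b k)" using n1 b0 by (intro sum_mono2) auto
  finally show ?thesis using telescope by linarith
qed

end
end
end

subsection \<open>Rigidity of the Gaussian energy curve\<close>

lemma sqrt2_power: "sqrt (1 / 2 ^ j) = 1 / sqrt 2 ^ j" "(sqrt 2 ^ j)\<^sup>2 = 2 ^ j"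
proof -
  have "(sqrt 2 ^ j)\<^sup>2 = ((sqrt 2)\<^sup>2) ^ j" by (simp only: power_mult[symmetric] mult.commute)
  then show "(sqrt 2 ^ j)\<^sup>2 = 2 ^ j" by simp
qed (simp add: real_sqrt_divide real_sqrt_power)

context energy
begin

text \<open>The two halves of an interval have drifts \<open>m1\<close>, \<open>m2\<close> in their own units; in the units of the
  whole interval these add up to \<open>(m1 + m2) / sqrt 2\<close>. If all three have the same modulus they vanish.\<close>

lemma rigidity_exact:
  assumes v: "0 \<le> v" and m: "G v m1 = G 1 0" "G v m2 = G 1 0" "G v ((m1 + m2) / sqrt 2) = G 1 0"
  shows "v = 1"
proof -
  have "\<bar>m1\<bar> = \<bar>m2\<bar>" "\<bar>(m1 + m2) / sqrt 2\<bar> = \<bar>m1\<bar>" using G_inj[OF v] m by metis+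
  then have "m1 = 0" using sqrt2_less_2 by (auto simp: abs_if field_simps split: if_splits)
  then have e: "G v 0 = G 1 0" using m by simp
  show ?thesis
    using G_var_strict_mono[of v 1] G_var_strict_mono[of 1 v] e v by (cases v "1::real" rule: linorder_cases) auto
qed

text \<open>Compactness makes \<open>rigidity_exact\<close> quantitative. The bound is linear in the
  defects so that it can be averaged over all intervals of a level.\<close>

lemma rigidity:
  assumes \<epsilon>: "0 < \<epsilon>"
  shows "\<exists>K\<ge>0. \<forall>m1\<in>{-R..R}. \<forall>m2\<in>{-R..R}. \<forall>v1\<in>{0..V}. \<forall>v2\<in>{0..V}.
    \<bar>(v1 + v2) / 2 - 1\<bar> \<le> \<epsilon> + K * (\<bar>G v1 m1 - G 1 0\<bar> + \<bar>G v2 m2 - G 1 0\<bar>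
      + \<bar>G ((v1 + v2) / 2) ((m1 + m2) / sqrt 2) - G 1 0\<bar> + \<bar>v1 - v2\<bar>)"
proof -
  define \<Phi> where "\<Phi> = (\<lambda>(m1, m2, v1, v2). \<bar>G v1 m1 - G 1 0\<bar> + \<bar>G v2 m2 - G 1 0\<bar>
      + \<bar>G ((v1 + v2) / 2) ((m1 + m2) / sqrt 2) - G 1 0\<bar> + \<bar>v1 - v2\<bar>)"
  define Z where "Z = ({-R..R} \<times> {-R..R} \<times> {0..V} \<times> {0..V})"
  define Z' where "Z' = Z \<inter> (\<lambda>(m1, m2, v1, v2). \<bar>(v1 + v2) / 2 - 1\<bar>) -` {\<epsilon>..}"
  have Zc: "compact Z" unfolding Z_def by (intro compact_Times compact_Icc)
  have G': "continuous_on Z (\<lambda>z. G (a z) (b z))"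
    if "continuous_on Z a" "continuous_on Z b" "\<And>z. z \<in> Z \<Longrightarrow> 0 \<le> a z" for a b
  proof -
    have "continuous_on Z (\<lambda>z. case (b z, a z) of (x, v) \<Rightarrow> G v x)"
    proof (rule continuous_on_compose2[OF continuous_G])
      show "continuous_on Z (\<lambda>z. (b z, a z))" by (intro continuous_on_Pair that)
      show "(\<lambda>z. (b z, a z)) ` Z \<subseteq> UNIV \<times> {0..}" using that(3) by (intro image_subsetI) simp
    qed
    then show ?thesis by simp
  qed
  have cont\<Phi>: "continuous_on Z \<Phi>"
    unfolding \<Phi>_def split_beta'
    by (intro continuous_intros G') (auto simp: Z_def)
  have "closed Z'"
    unfolding Z'_def split_beta'
    by (intro continuous_closed_preimage) (use Zc in \<open>auto intro!: continuous_intros simp: compact_imp_closed\<close>)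
  then have Z'c: "compact Z'" using Zc compact_Int_closed[of Z Z'] by (simp add: Z'_def Int_absorb1 inf.absorb2)
  have pos: "0 < \<Phi> z" if "z \<in> Z'" for z
  proof -
    obtain m1 m2 v1 v2 where z: "z = (m1, m2, v1, v2)" by (cases z) auto
    have h: "0 \<le> v1" "\<epsilon> \<le> \<bar>(v1 + v2) / 2 - 1\<bar>" using that by (auto simp: Z'_def Z_def z)
    have "0 \<le> \<Phi> z" by (simp add: \<Phi>_def z)
    moreover have "\<Phi> z \<noteq> 0"
    proof
      assume "\<Phi> z = 0"
      then have e: "\<bar>G v1 m1 - G 1 0\<bar> = 0" "\<bar>G v2 m2 - G 1 0\<bar> = 0"
        "\<bar>G ((v1 + v2) / 2) ((m1 + m2) / sqrt 2) - G 1 0\<bar> = 0" "\<bar>v1 - v2\<bar> = 0"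
        unfolding \<Phi>_def z prod.case by linarith+
      then have "v1 = 1" using rigidity_exact[OF h(1), of m1 m2] by auto
      then show False using h \<epsilon> e by simp
    qed
    ultimately show ?thesis by linarith
  qed
  obtain d where d: "0 < d" "\<And>z. z \<in> Z' \<Longrightarrow> d \<le> \<Phi> z"
  proof (cases "Z' = {}")
    case True then show ?thesis using that[of 1] by auto
  next
    case False
    have "continuous_on Z' \<Phi>" by (rule continuous_on_subset[OF cont\<Phi>]) (auto simp: Z'_def)
    then obtain z where "z \<in> Z'" "\<forall>y\<in>Z'. \<Phi> z \<le> \<Phi> y"
      using continuous_attains_inf[OF Z'c False] by blast
    then show ?thesis using that[of "\<Phi> z"] pos by auto
  qed
  \<comment> \<open>On the exceptional set the left side is at most \<open>\<bar>V\<bar> + 1\<close>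
    and the defect at least \<open>d\<close>, which explains the factor.\<close>
  have "\<bar>(v1 + v2) / 2 - 1\<bar> \<le> \<epsilon> + (\<bar>V\<bar> + 1) / d * \<Phi> (m1, m2, v1, v2)"
    if "m1 \<in> {-R..R}" "m2 \<in> {-R..R}" "v1 \<in> {0..V}" "v2 \<in> {0..V}" for m1 m2 v1 v2
  proof (cases "\<bar>(v1 + v2) / 2 - 1\<bar> \<le> \<epsilon>")
    case True
    have "0 \<le> (\<bar>V\<bar> + 1) / d * \<Phi> (m1, m2, v1, v2)" using d(1) by (simp add: \<Phi>_def)
    then show ?thesis using True by linarith
  next
    case False
    then have "(m1, m2, v1, v2) \<in> Z'" using that by (auto simp: Z'_def Z_def)
    then have "d \<le> \<Phi> (m1, m2, v1, v2)" by (rule d(2))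
    then have "(\<bar>V\<bar> + 1) / d * d \<le> (\<bar>V\<bar> + 1) / d * \<Phi> (m1, m2, v1, v2)"
      using d(1) by (intro mult_left_mono) auto
    moreover have "0 \<le> (v1 + v2) / 2" "(v1 + v2) / 2 \<le> \<bar>V\<bar>" using that by auto
    then have "\<bar>(v1 + v2) / 2 - 1\<bar> \<le> \<bar>V\<bar> + 1" by linarith
    ultimately show ?thesis using d(1) \<epsilon> by simp
  qed
  moreover have "0 \<le> (\<bar>V\<bar> + 1) / d" using d(1) by simp
  ultimately show ?thesis unfolding \<Phi>_def prod.case by blast
qed

text \<open>This is where \<open>p < 2\<close> matters: jumps much larger than the current scale contribute a
  geometrically small amount of energy.\<close>

lemma scale_sum:
  assumes \<kappa>: "0 < \<kappa>" "\<kappa> \<le> 1"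
  shows "\<exists>C\<ge>0. \<forall>u m. (\<Sum>j<m. 1 / 2 ^ j * (f (sqrt 2 ^ j * u) * far \<kappa> (sqrt 2 ^ j * u))) \<le> C * Q u"
proof -
  \<comment> \<open>From one level to the next the argument grows by \<open>sqrt 2\<close>, hence
    \<open>f\<close> by \<open>2 powr (p / 2)\<close> up to the constant \<open>D\<close>, while the
    weight halves; \<open>p < 2\<close> makes the ratio smaller than \<open>1\<close>.\<close>
  define r where "r = 2 powr (p / 2 - 1)"
  have r: "0 < r" "r < 1" using p by (auto simp: r_def powr_less_one)
  note sq = sqrt2_power(2)
  have ratio: "1 / 2 ^ i * (sqrt 2 ^ i) powr p = r ^ i" for i :: nat
  proof -
    have "sqrt 2 ^ i = sqrt 2 powr real i" by (simp add: powr_realpow)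
    also have "\<dots> = (2 powr (1 / 2)) powr real i" by (simp add: powr_half_sqrt)
    also have "\<dots> = 2 powr (real i / 2)" by (simp add: powr_powr)
    finally have "sqrt 2 ^ i = 2 powr (real i / 2)" .
    moreover have "1 / 2 ^ i = (2::real) powr (- real i)"
      by (subst powr_minus, subst powr_realpow) (simp_all add: divide_inverse)
    moreover have "r ^ i = r powr real i" by (rule powr_realpow[OF r(1), symmetric])
    then have "r ^ i = 2 powr ((p / 2 - 1) * real i)" by (simp add: r_def powr_powr)
    ultimately show ?thesis by (simp add: powr_powr powr_add[symmetric] algebra_simps)
  qed
  define E where "E = D / (1 - r)"
  have E: "0 \<le> E" using r D by (simp add: E_def)
  define C where "C = E * (max 1 (f 1 / \<kappa>\<^sup>2) + f 2 / \<kappa>\<^sup>2)"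
  have f12: "0 < f 1" "0 < f 2" by (auto intro: pos)
  have C: "0 \<le> C" using E f12 \<kappa> by (simp add: C_def)
  have "(\<Sum>j<m. 1 / 2 ^ j * (f (sqrt 2 ^ j * u) * far \<kappa> (sqrt 2 ^ j * u))) \<le> C * Q u" for u m
  proof (cases "\<exists>j. \<kappa> < sqrt 2 ^ j * \<bar>u\<bar>")
    case False
    then have "far \<kappa> (sqrt 2 ^ j * u) = 0" for j by (simp add: far_def abs_mult not_less)
    then show ?thesis using C by simp
  next
    case True
    \<comment> \<open>The first level at which the jump is visible; it dominates the geometric
      sum.\<close>
    define j0 where "j0 = (LEAST j. \<kappa> < sqrt 2 ^ j * \<bar>u\<bar>)"
    have j0: "\<kappa> < sqrt 2 ^ j0 * \<bar>u\<bar>" unfolding j0_def using True by (rule LeastI_ex)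
    have lt: "sqrt 2 ^ j * \<bar>u\<bar> \<le> \<kappa>" if "j < j0" for j
      using not_less_Least[of j "\<lambda>j. \<kappa> < sqrt 2 ^ j * \<bar>u\<bar>"] that by (simp add: j0_def not_less)
    define A where "A = D * (1 / 2 ^ j0 * f (sqrt 2 ^ j0 * u))"
    have A: "0 \<le> A" using D by (simp add: A_def)
    have trm: "1 / 2 ^ j * (f (sqrt 2 ^ j * u) * far \<kappa> (sqrt 2 ^ j * u)) \<le> (if j0 \<le> j then A * r ^ (j - j0) else 0)" for j
    proof (cases "j0 \<le> j")
      case True
      define i where "i = j - j0"
      have j: "j = i + j0" using True by (simp add: i_def)
      have fj: "f (sqrt 2 ^ j * u) = f (sqrt 2 ^ i * (sqrt 2 ^ j0 * u))" by (simp add: j power_add mult.assoc)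
      have "1 / 2 ^ j * (f (sqrt 2 ^ j * u) * far \<kappa> (sqrt 2 ^ j * u)) \<le> 1 / 2 ^ j * (f (sqrt 2 ^ j * u) * 1)"
        by (intro mult_left_mono near_far_simps) auto
      also have "\<dots> \<le> 1 / 2 ^ j * ((D * (sqrt 2 ^ i) powr p * f (sqrt 2 ^ j0 * u)) * 1)"
        unfolding fj by (intro mult_left_mono mult_right_mono dil one_le_power) auto
      also have "\<dots> = A * (1 / 2 ^ i * (sqrt 2 ^ i) powr p)" by (simp add: A_def j power_add mult_ac)
      finally show ?thesis using True unfolding ratio by (simp add: i_def)
    next
      case False
      then show ?thesis using lt[of j] by (simp add: far_def abs_mult)
    qed
    have "(\<Sum>j<m. 1 / 2 ^ j * (f (sqrt 2 ^ j * u) * far \<kappa> (sqrt 2 ^ j * u)))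
      \<le> (\<Sum>j<m. if j0 \<le> j then A * r ^ (j - j0) else 0)" by (intro sum_mono trm)
    also have "\<dots> \<le> (\<Sum>j<j0 + m. if j0 \<le> j then A * r ^ (j - j0) else 0)"
      using A r by (intro sum_mono2) auto
    also have "\<dots> = (\<Sum>j\<in>{j0..<j0 + m}. A * r ^ (j - j0))"
      by (intro sum.mono_neutral_cong_right) auto
    also have "\<dots> = (\<Sum>i\<in>{0..<m}. A * r ^ i)"
      using sum.shift_bounds_nat_ivl[of "\<lambda>j. A * r ^ (j - j0)" 0 j0 m] by (simp add: add.commute)
    also have "\<dots> = A * (\<Sum>i\<in>{0..<m}. r ^ i)" by (simp add: sum_distrib_left)
    also have "\<dots> \<le> A * (1 / (1 - r))"
    proof (rule mult_left_mono[OF _ A])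
      have "(\<Sum>i\<in>{0..<m}. r ^ i) \<le> (\<Sum>i. r ^ i)"
        using r by (intro sum_le_suminf summable_geometric) auto
      then show "(\<Sum>i\<in>{0..<m}. r ^ i) \<le> 1 / (1 - r)" using r by (simp add: suminf_geometric)
    qed
    also have "\<dots> = E * (1 / 2 ^ j0 * f (sqrt 2 ^ j0 * u))" by (simp add: A_def E_def)
    also have "\<dots> \<le> C * Q u"
    \<comment> \<open>A jump visible at once may be of any size above \<open>\<kappa>\<close>.
      Otherwise its rescaled size at level \<open>j0\<close> lies between \<open>\<kappa>\<close>
      and \<open>2\<close>, so the weight \<open>1 / 2 ^ j0\<close> is of order
      \<open>u\<^sup>2\<close>.\<close>
    proof (cases "j0 = 0")
      case True
      have "f u \<le> max 1 (f 1 / \<kappa>\<^sup>2) * Q u"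
      proof (cases "\<bar>u\<bar> \<le> 1")
        case T: True
        have "\<kappa>\<^sup>2 \<le> u\<^sup>2" using j0 True \<kappa> by (simp add: abs_le_square_iff[symmetric])
        then have "f 1 \<le> f 1 / \<kappa>\<^sup>2 * u\<^sup>2" using \<kappa> f12 by (simp add: field_simps)
        moreover have "f u \<le> f 1" using T by (intro mono) auto
        moreover have "f 1 / \<kappa>\<^sup>2 * u\<^sup>2 \<le> max 1 (f 1 / \<kappa>\<^sup>2) * u\<^sup>2" by (intro mult_right_mono) auto
        ultimately show ?thesis using T by (simp add: Q_def)
      next
        case False
        then show ?thesis using mult_right_mono[of 1 "max 1 (f 1 / \<kappa>\<^sup>2)" "f u"] by (simp add: Q_def)
      qed
      also have "\<dots> \<le> (max 1 (f 1 / \<kappa>\<^sup>2) + f 2 / \<kappa>\<^sup>2) * Q u"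
        using f12 \<kappa> by (intro mult_right_mono) auto
      finally have "E * f u \<le> E * ((max 1 (f 1 / \<kappa>\<^sup>2) + f 2 / \<kappa>\<^sup>2) * Q u)" by (rule mult_left_mono[OF _ E])
      then show ?thesis using True by (simp add: C_def mult.assoc)
    next
      case False
      then obtain i where i: "j0 = Suc i" by (cases j0) auto
      have li: "sqrt 2 ^ i * \<bar>u\<bar> \<le> \<kappa>" using lt[of i] i by simp
      have "sqrt 2 * (sqrt 2 ^ i * \<bar>u\<bar>) \<le> 2 * 1"
        using li \<kappa> real_sqrt_le_mono[of 2 4] by (intro mult_mono) auto
      then have f2: "f (sqrt 2 ^ j0 * u) \<le> f 2" using i by (intro mono) (simp add: abs_mult mult.assoc)
      have "\<bar>u\<bar> \<le> sqrt 2 ^ i * \<bar>u\<bar>" by (intro mult_ge_right one_le_power) auto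
      then have u1: "\<bar>u\<bar> \<le> 1" using li \<kappa> by simp
      have "\<kappa>\<^sup>2 \<le> (sqrt 2 ^ j0 * \<bar>u\<bar>)\<^sup>2" using j0 \<kappa> by (intro power_mono) auto
      then have "\<kappa>\<^sup>2 \<le> 2 ^ j0 * u\<^sup>2" by (simp add: power_mult_distrib sq)
      then have "1 / 2 ^ j0 \<le> u\<^sup>2 / \<kappa>\<^sup>2" using \<kappa> by (simp add: field_simps)
      then have "1 / 2 ^ j0 * f (sqrt 2 ^ j0 * u) \<le> u\<^sup>2 / \<kappa>\<^sup>2 * f 2"
        using f2 by (intro mult_mono) auto
      also have "\<dots> = f 2 / \<kappa>\<^sup>2 * u\<^sup>2" by simp
      also have "\<dots> \<le> (max 1 (f 1 / \<kappa>\<^sup>2) + f 2 / \<kappa>\<^sup>2) * u\<^sup>2"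
        by (intro mult_right_mono) auto
      finally have "E * (1 / 2 ^ j0 * f (sqrt 2 ^ j0 * u)) \<le> E * ((max 1 (f 1 / \<kappa>\<^sup>2) + f 2 / \<kappa>\<^sup>2) * u\<^sup>2)"
        by (rule mult_left_mono[OF _ E])
      then show ?thesis using u1 by (simp add: C_def Q_def mult.assoc)
    qed
    finally show ?thesis .
  qed
  with C show ?thesis by blast
qed

end

text \<open>A constant generates the trivial sigma-algebra. This serves the first step of a walk,
  whose starting point is deterministic.\<close>

lemma (in prob_space) indep_var_const:
  fixes Y :: "'a \<Rightarrow> real"
  assumes Y: "Y \<in> borel_measurable M"
  shows "indep_var borel (\<lambda>_. c :: real) borel Y"
proof -
  have a: "a = {} \<or> a = space M"
    if "a \<in> sigma_sets (space M) {(\<lambda>_. c) -` A \<inter> space M |A. A \<in> sets borel}" for a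
    using that
  proof induction
    case (Basic a)
    then show ?case by (auto split: if_splits)
  next
    case (Union a)
    then show ?case by (cases "\<exists>i. a i = space M") blast+
  qed auto
  have b: "b \<subseteq> space M" if "b \<in> sigma_sets (space M) {Y -` A \<inter> space M |A. A \<in> sets borel}" for b
    using sigma_sets_into_sp[OF _ that] by auto
  have bm: "b \<in> events" if "b \<in> sigma_sets (space M) {Y -` A \<inter> space M |A. A \<in> sets borel}" for b
    using that measurable_sets[OF Y] by (induction) (auto intro: sets.compl_sets)
  show ?thesis
    unfolding indep_var_eq indep_sets2_eq
  proof (intro conjI ballI)
    show "sigma_sets (space M) {(\<lambda>_. c) -` A \<inter> space M |A. A \<in> sets borel} \<subseteq> events"
      using a by (metis (no_types, lifting) sets.empty_sets sets.top subsetI)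
    fix a' b' assume *: "a' \<in> sigma_sets (space M) {(\<lambda>_. c) -` A \<inter> space M |A. A \<in> sets borel}"
      "b' \<in> sigma_sets (space M) {Y -` A \<inter> space M |A. A \<in> sets borel}"
    from a[OF *(1)] b[OF *(2)] show "prob (a' \<inter> b') = prob a' * prob b'"
      by (elim disjE) (simp_all add: prob_space Int_absorb1)
  next
    show "sigma_sets (space M) {Y -` A \<inter> space M |A. A \<in> sets borel} \<subseteq> events"
      using bm by blast
  qed (use Y in simp_all)
qed

subsection \<open>Processes with Brownian energy\<close>

context energy
begin

text \<open>\<open>R\<^sub>0\<close> bounds the mean modulus of a normalised increment and thus its
  drift. \<open>H\<^sub>0\<close> bounds the energy of such an increment after a shift by at most
  \<open>2 * R\<^sub>0\<close>, by \<open>f_add\<close>.\<close>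

definition R\<^sub>0 :: real where "R\<^sub>0 = 1 + G 1 0 / f 1"
definition H\<^sub>0 :: real where "H\<^sub>0 = 2 * D * (G 1 0 + f (2 * R\<^sub>0))"

lemma R0_ge: "1 \<le> R\<^sub>0" by (simp add: R\<^sub>0_def)

lemma H0_nonneg: "0 \<le> H\<^sub>0" using D by (simp add: H\<^sub>0_def)

end

text \<open>The value at time \<open>0\<close> is left free and only pairs of adjacent increments
  are compared; this makes the class stable under restriction to a subinterval and under time
  reversal, see \<open>rescale\<close>.\<close>

locale process = energy f p D + prob_space M
  for f p D and M :: "'a measure" +
  fixes X :: "real \<Rightarrow> 'a \<Rightarrow> real"
  assumes X_meas: "t \<in> {0..1} \<Longrightarrow> X t \<in> borel_measurable M"
    and X_indep: "0 \<le> s \<Longrightarrow> s < t \<Longrightarrow> t < u \<Longrightarrow> u \<le> 1 \<Longrightarrow>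
      indep_var borel (\<lambda>\<omega>. X t \<omega> - X s \<omega>) borel (\<lambda>\<omega>. X u \<omega> - X t \<omega>)"
    and X_energy: "0 \<le> s \<Longrightarrow> s < t \<Longrightarrow> t \<le> 1 \<Longrightarrow>
      integrable M (\<lambda>\<omega>. f ((X t \<omega> - X s \<omega>) / sqrt (t - s))) \<and>
      expectation (\<lambda>\<omega>. f ((X t \<omega> - X s \<omega>) / sqrt (t - s))) = G 1 0"
begin

definition m :: "real \<Rightarrow> real \<Rightarrow> real" where "m s t = expectation (\<lambda>\<omega>. X t \<omega> - X s \<omega>)"
definition U :: "real \<Rightarrow> real \<Rightarrow> 'a \<Rightarrow> real" where "U s t \<omega> = X t \<omega> - X s \<omega> - m s t"

lemma dX_meas: "0 \<le> s \<Longrightarrow> s \<le> t \<Longrightarrow> t \<le> 1 \<Longrightarrow> (\<lambda>\<omega>. X t \<omega> - X s \<omega>) \<in> borel_measurable M"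
  by (intro borel_measurable_diff X_meas) auto

lemma m_refl [simp]: "m s s = 0" by (simp add: m_def)

lemma U_refl [simp]: "U s s \<omega> = 0" by (simp add: U_def)

lemma dX_mean:
  assumes "0 \<le> s" "s \<le> t" "t \<le> 1"
  shows "integrable M (\<lambda>\<omega>. X t \<omega> - X s \<omega>)" "expectation (\<lambda>\<omega>. \<bar>X t \<omega> - X s \<omega>\<bar>) \<le> R\<^sub>0 * sqrt (t - s)"
proof -
  have "integrable M (\<lambda>\<omega>. X t \<omega> - X s \<omega>) \<and> expectation (\<lambda>\<omega>. \<bar>X t \<omega> - X s \<omega>\<bar>) \<le> R\<^sub>0 * sqrt (t - s)"
  proof (cases "s = t")
    case False
    then have st: "s < t" using assms by simp
    define Z where "Z \<omega> = (X t \<omega> - X s \<omega>) / sqrt (t - s)" for \<omega>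
    note e = X_energy[OF assms(1) st assms(3), folded Z_def]
    have XZ: "X t \<omega> - X s \<omega> = sqrt (t - s) * Z \<omega>" for \<omega> using st by (simp add: Z_def)
    have iZ: "integrable M Z"
    proof (rule Bochner_Integration.integrable_bound)
      show "integrable M (\<lambda>\<omega>. 1 + f (Z \<omega>) / f 1)" using e by simp
      show "Z \<in> borel_measurable M" unfolding Z_def[abs_def] using dX_meas[of s t] assms by measurable
      show "AE \<omega> in M. norm (Z \<omega>) \<le> norm (1 + f (Z \<omega>) / f 1)"
        using abs_le_f by (intro AE_I2) (simp add: abs_of_nonneg add_nonneg_nonneg)
    qed
    have "expectation (\<lambda>\<omega>. \<bar>Z \<omega>\<bar>) \<le> expectation (\<lambda>\<omega>. 1 + f (Z \<omega>) / f 1)"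
      using iZ e abs_le_f by (intro integral_mono) auto
    also have "\<dots> = R\<^sub>0" using e by (simp add: prob_space R\<^sub>0_def)
    finally have "sqrt (t - s) * expectation (\<lambda>\<omega>. \<bar>Z \<omega>\<bar>) \<le> sqrt (t - s) * R\<^sub>0"
      by (rule mult_left_mono) (use st in simp)
    then show ?thesis unfolding XZ using iZ st by (simp add: abs_mult mult.commute)
  qed simp
  then show "integrable M (\<lambda>\<omega>. X t \<omega> - X s \<omega>)" "expectation (\<lambda>\<omega>. \<bar>X t \<omega> - X s \<omega>\<bar>) \<le> R\<^sub>0 * sqrt (t - s)"
    by auto
qed

lemma m_bound: assumes "0 \<le> s" "s \<le> t" "t \<le> 1" shows "\<bar>m s t\<bar> \<le> R\<^sub>0 * sqrt (t - s)"
  unfolding m_def using integral_abs_bound[of M "\<lambda>\<omega>. X t \<omega> - X s \<omega>"] dX_mean(2)[OF assms] by linarith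

lemma m_add: assumes "0 \<le> s" "s \<le> t" "t \<le> u" "u \<le> 1" shows "m s u = m s t + m t u"
proof -
  have "m s u = expectation (\<lambda>\<omega>. (X t \<omega> - X s \<omega>) + (X u \<omega> - X t \<omega>))" by (simp add: m_def)
  also have "\<dots> = m s t + m t u"
    unfolding m_def using dX_mean(1)[of s t] dX_mean(1)[of t u] assms by (intro Bochner_Integration.integral_add) auto
  finally show ?thesis .
qed

lemma U_add: "0 \<le> s \<Longrightarrow> s \<le> t \<Longrightarrow> t \<le> u \<Longrightarrow> u \<le> 1 \<Longrightarrow> U s u \<omega> = U s t \<omega> + U t u \<omega>"
  using m_add[of s t u] by (simp add: U_def)

lemma U_meas: "0 \<le> s \<Longrightarrow> s \<le> t \<Longrightarrow> t \<le> 1 \<Longrightarrow> U s t \<in> borel_measurable M"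
  unfolding U_def[abs_def] using dX_meas[of s t] by measurable

lemma U_mean: assumes "0 \<le> s" "s \<le> t" "t \<le> 1" shows "integrable M (U s t)" "expectation (U s t) = 0"
  using dX_mean(1)[OF assms] by (auto simp: U_def[abs_def] m_def prob_space)

lemma U_indep:
  assumes "0 \<le> s" "s \<le> t" "t < u" "u \<le> 1"
  shows "indep_var borel (\<lambda>\<omega>. U s t \<omega> / a + b) borel (\<lambda>\<omega>. U t u \<omega> / a)"
proof (cases "s = t")
  case True
  have [measurable]: "U t u \<in> borel_measurable M" by (rule U_meas) (use assms in auto)
  have "(\<lambda>\<omega>. U t u \<omega> / a) \<in> borel_measurable M" by measurable
  then show ?thesis using True indep_var_const by simp
next
  case False
  then have i: "indep_var borel (\<lambda>\<omega>. X t \<omega> - X s \<omega>) borel (\<lambda>\<omega>. X u \<omega> - X t \<omega>)"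
    using assms by (intro X_indep) auto
  have "indep_var borel ((\<lambda>y. (y - m s t) / a + b) \<circ> (\<lambda>\<omega>. X t \<omega> - X s \<omega>)) borel ((\<lambda>y. (y - m t u) / a) \<circ> (\<lambda>\<omega>. X u \<omega> - X t \<omega>))"
    by (rule indep_var_compose[OF i]) measurable
  then show ?thesis by (simp add: o_def U_def)
qed

text \<open>In units of the whole interval, a partial sum is a shrunk normalised increment plus the
  normalised difference of two drifts. This gives the energy bound \<open>H\<^sub>0\<close> for
  every partition.\<close>

lemma walk_interval:
  assumes s: "0 \<le> s" "0 < l" "s + l \<le> 1" and n: "0 < n"
  shows "walk f p D M (\<lambda>k \<omega>. U s (s + l * real k / real n) \<omega> / sqrt l + m s (s + l) / sqrt l) n (m s (s + l) / sqrt l) H\<^sub>0"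
proof -
  define t where "t k = s + l * real k / real n" for k
  have t0: "t 0 = s" by (simp add: t_def)
  have ts: "s \<le> t k" for k using s by (simp add: t_def)
  have block_tail: "t k \<le> s + l" if "k \<le> n" for k
  proof -
    have "l * real k / real n \<le> l * 1" unfolding times_divide_eq_right[symmetric]
      using that n s by (intro mult_left_mono) (auto simp: field_simps)
    then show ?thesis by (simp add: t_def)
  qed
  have t1: "t k \<le> 1" if "k \<le> n" for k using block_tail[OF that] s by simp
  have tS: "t k < t (Suc k)" for k using s n by (simp add: t_def divide_strict_right_mono mult_strict_left_mono)
  have t_pos: "s < t k" if "0 < k" for k using s n that by (simp add: t_def)
  let ?\<mu> = "m s (s + l) / sqrt l"
  have en: "integrable M (\<lambda>\<omega>. f (U s (t k) \<omega> / sqrt l + ?\<mu>)) \<and> expectation (\<lambda>\<omega>. f (U s (t k) \<omega> / sqrt l + ?\<mu>)) \<le> H\<^sub>0"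
    if k: "k \<le> n" for k
  proof (cases "k = 0")
    case True
    have "\<bar>m s (s + l)\<bar> \<le> R\<^sub>0 * sqrt l" using m_bound[of s "s + l"] s by simp
    then have "\<bar>?\<mu>\<bar> \<le> R\<^sub>0" using s by (simp add: field_simps)
    then have "f ?\<mu> \<le> f (2 * R\<^sub>0)" using R0_ge by (intro mono) auto
    also have "\<dots> \<le> 2 * D * f (2 * R\<^sub>0)" using D by (intro mult_ge_right) auto
    also have "\<dots> \<le> H\<^sub>0" unfolding H\<^sub>0_def using D by (intro mult_left_mono) auto
    finally show ?thesis using True t0 by (simp add: prob_space)
  next
    case False
    then have st: "s < t k" by (intro t_pos) auto
    note e = X_energy[OF s(1) st t1[OF k]]
    let ?Y = "\<lambda>\<omega>. (X (t k) \<omega> - X s \<omega>) / sqrt (t k - s)"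
    define c where "c = (m s (s + l) - m s (t k)) / sqrt l"
    have "\<bar>c\<bar> \<le> 2 * R\<^sub>0"
    proof -
      have "\<bar>m s (s + l)\<bar> \<le> R\<^sub>0 * sqrt l" using m_bound[of s "s + l"] s by simp
      moreover have "\<bar>m s (t k)\<bar> \<le> R\<^sub>0 * sqrt (t k - s)" using m_bound[of s "t k"] s st t1[OF k] by simp
      moreover have "R\<^sub>0 * sqrt (t k - s) \<le> R\<^sub>0 * sqrt l" using block_tail[OF k] R0_ge by (intro mult_left_mono) auto
      ultimately have "\<bar>m s (s + l) - m s (t k)\<bar> \<le> 2 * R\<^sub>0 * sqrt l" by linarith
      then show ?thesis using s by (simp add: c_def field_simps)
    qed
    then have fc: "f c \<le> f (2 * R\<^sub>0)" using R0_ge by (intro mono) auto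
    have bd: "f (U s (t k) \<omega> / sqrt l + ?\<mu>) \<le> 2 * D * (f (?Y \<omega>) + f (2 * R\<^sub>0))" for \<omega>
    proof -
      have "U s (t k) \<omega> / sqrt l + ?\<mu> = (X (t k) \<omega> - X s \<omega>) / sqrt l + c"
        by (simp add: U_def c_def diff_divide_distrib)
      then have "f (U s (t k) \<omega> / sqrt l + ?\<mu>) \<le> 2 * D * (f ((X (t k) \<omega> - X s \<omega>) / sqrt l) + f c)"
        by (simp only: f_add)
      also have "\<dots> \<le> 2 * D * (f (?Y \<omega>) + f (2 * R\<^sub>0))"
      proof (intro mult_left_mono add_mono fc)
        have "\<bar>X (t k) \<omega> - X s \<omega>\<bar> / sqrt l \<le> \<bar>X (t k) \<omega> - X s \<omega>\<bar> / sqrt (t k - s)"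
          using st block_tail[OF k] s by (intro divide_left_mono) auto
        then show "f ((X (t k) \<omega> - X s \<omega>) / sqrt l) \<le> f (?Y \<omega>)"
          using st s by (intro mono) simp
      qed (use D in auto)
      finally show ?thesis .
    qed
    have i2: "integrable M (\<lambda>\<omega>. 2 * D * (f (?Y \<omega>) + f (2 * R\<^sub>0)))" using e by simp
    have i1: "integrable M (\<lambda>\<omega>. f (U s (t k) \<omega> / sqrt l + ?\<mu>))"
    proof (rule Bochner_Integration.integrable_bound[OF i2])
      show "(\<lambda>\<omega>. f (U s (t k) \<omega> / sqrt l + ?\<mu>)) \<in> borel_measurable M"
        using U_meas[of s "t k"] s ts[of k] t1[OF k] by measurable
      show "AE \<omega> in M. norm (f (U s (t k) \<omega> / sqrt l + ?\<mu>)) \<le> norm (2 * D * (f (?Y \<omega>) + f (2 * R\<^sub>0)))"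
        using bd D by (intro AE_I2) (simp add: abs_of_nonneg)
    qed
    have "expectation (\<lambda>\<omega>. f (U s (t k) \<omega> / sqrt l + ?\<mu>)) \<le> expectation (\<lambda>\<omega>. 2 * D * (f (?Y \<omega>) + f (2 * R\<^sub>0)))"
      by (rule integral_mono[OF i1 i2 bd])
    also have "\<dots> = H\<^sub>0" using e by (simp add: H\<^sub>0_def prob_space)
    finally show ?thesis using i1 by simp
  qed
  show ?thesis
    unfolding t_def[symmetric]
  proof unfold_locales
    fix k assume k: "k \<le> n"
    show "(\<lambda>\<omega>. U s (t k) \<omega> / sqrt l + ?\<mu>) \<in> borel_measurable M"
      using U_meas[of s "t k"] s ts[of k] t1[OF k] by measurable
    show "integrable M (\<lambda>\<omega>. f (U s (t k) \<omega> / sqrt l + ?\<mu>))" "expectation (\<lambda>\<omega>. f (U s (t k) \<omega> / sqrt l + ?\<mu>)) \<le> H\<^sub>0"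
      using en[OF k] by auto
  next
    fix \<omega> show "U s (t 0) \<omega> / sqrt l + ?\<mu> = ?\<mu>" by (simp add: t0)
  next
    fix k assume "k < n"
    then have k: "k \<le> n" "Suc k \<le> n" by auto
    have d: "(U s (t (Suc k)) \<omega> / sqrt l + ?\<mu>) - (U s (t k) \<omega> / sqrt l + ?\<mu>) = U (t k) (t (Suc k)) \<omega> / sqrt l" for \<omega>
      using U_add[of s "t k" "t (Suc k)"] s ts[of k] tS[of k] t1[OF k(2)] by (simp add: add_divide_distrib)
    show "indep_var borel (\<lambda>\<omega>. U s (t k) \<omega> / sqrt l + ?\<mu>) borel (\<lambda>\<omega>. (U s (t (Suc k)) \<omega> / sqrt l + ?\<mu>) - (U s (t k) \<omega> / sqrt l + ?\<mu>))"
      unfolding d using s ts[of k] tS[of k] t1[OF k(2)] by (intro U_indep) auto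
    show "expectation (\<lambda>\<omega>. (U s (t (Suc k)) \<omega> / sqrt l + ?\<mu>) - (U s (t k) \<omega> / sqrt l + ?\<mu>)) = 0"
      unfolding d using U_mean(2)[of "t k" "t (Suc k)"] s ts[of k] tS[of k] t1[OF k(2)] by simp
  qed
qed

lemma walk_increment:
  assumes s: "0 \<le> s" "0 < l" "s + l \<le> 1" and n: "0 < n" and k: "k < n"
  shows "walk.\<xi> (\<lambda>k \<omega>. U s (s + l * real k / real n) \<omega> / sqrt l + m s (s + l) / sqrt l) k \<omega>
    = U (s + l * real k / real n) (s + l * real (Suc k) / real n) \<omega> / sqrt l"
proof -
  interpret walk f p D M "\<lambda>k \<omega>. U s (s + l * real k / real n) \<omega> / sqrt l + m s (s + l) / sqrt l" n "m s (s + l) / sqrt l" H\<^sub>0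
    by (rule walk_interval[OF s n])
  have "l * real (Suc k) / real n \<le> l * 1" unfolding times_divide_eq_right[symmetric]
    using k n s by (intro mult_left_mono) (auto simp: field_simps)
  then have "U s (s + l * real (Suc k) / real n) \<omega>
    = U s (s + l * real k / real n) \<omega> + U (s + l * real k / real n) (s + l * real (Suc k) / real n) \<omega>"
    using s by (intro U_add) (auto intro!: divide_right_mono mult_left_mono)
  then show ?thesis unfolding \<xi>_def by (simp add: add_divide_distrib)
qed

lemma walk_end:
  assumes "0 < l" "0 < (n::nat)"
  shows "U s (s + l * real n / real n) \<omega> / sqrt l + m s (s + l) / sqrt l = (X (s + l) \<omega> - X s \<omega>) / sqrt l"
  using assms by (simp add: U_def diff_divide_distrib)

definition incr_bound :: "real \<Rightarrow> bool" where
  "incr_bound A \<longleftrightarrow> (\<forall>s l n. 0 \<le> s \<longrightarrow> 0 < l \<longrightarrow> s + l \<le> 1 \<longrightarrow> 0 < n \<longrightarrow>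
    (\<Sum>k<n. expectation (\<lambda>\<omega>. Q (U (s + l * real k / real n) (s + l * real (Suc k) / real n) \<omega> / sqrt l))) \<le> A)"

text \<open>Smoothing at the fixed variance \<open>1\<close> makes the constants in
  \<open>energy_bound\<close> independent of the interval and of the partition.\<close>

lemma energy_increments: "\<exists>A\<ge>1. incr_bound A"
proof -
  obtain C where C: "smooth_const 1 1 C" using smooth_const_exists[of 1 1] by auto
  obtain c where c: "c > 0" "\<forall>v\<in>{1..1}. \<forall>x\<in>{-(2 * (1 + H\<^sub>0 / f 1))..2 * (1 + H\<^sub>0 / f 1)}. \<forall>u. c * Q u \<le> B v x u"
    using B_lower[of 1 1 "2 * (1 + H\<^sub>0 / f 1)"] by auto
  then have c': "lower_const 1 1 (2 * (1 + H\<^sub>0 / f 1)) c" by (simp add: lower_const_def)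
  define A where "A = 1 + 2 / c * (C * (1 + H\<^sub>0))"
  have C0: "0 \<le> C" using C by (simp add: smooth_const_def)
  have "(\<Sum>k<n. expectation (\<lambda>\<omega>. Q (U (s + l * real k / real n) (s + l * real (Suc k) / real n) \<omega> / sqrt l))) \<le> A"
    if s: "0 \<le> s" "0 < l" "s + l \<le> 1" and n: "0 < n" for s l n
  proof -
    interpret W: walk f p D M "\<lambda>k \<omega>. U s (s + l * real k / real n) \<omega> / sqrt l + m s (s + l) / sqrt l" n "m s (s + l) / sqrt l" H\<^sub>0
      by (rule walk_interval[OF s n])
    let ?S = "\<lambda>k \<omega>. U s (s + l * real k / real n) \<omega> / sqrt l + m s (s + l) / sqrt l"
    have "c / 2 * (\<Sum>k<n. expectation (\<lambda>\<omega>. Q (W.\<xi> k \<omega>))) \<le> expectation (\<lambda>\<omega>. G 1 (?S n \<omega>))"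
      by (rule W.energy_bound[OF C _ _ c']) auto
    also have "\<dots> \<le> expectation (\<lambda>\<omega>. C * (1 + f (?S n \<omega>)))"
      using W.int_GS(1)[OF C, of 1 n] W.energy_int[of n] C
      by (intro integral_mono) (auto simp: smooth_const_def)
    also have "\<dots> \<le> C * (1 + H\<^sub>0)" using W.weight_le[of n] C0 by (simp add: mult_left_mono)
    finally have "(\<Sum>k<n. expectation (\<lambda>\<omega>. Q (W.\<xi> k \<omega>))) \<le> A" using c(1) by (simp add: A_def field_simps)
    moreover have "(\<Sum>k<n. expectation (\<lambda>\<omega>. Q (W.\<xi> k \<omega>))) = (\<Sum>k<n. expectation (\<lambda>\<omega>. Q (U (s + l * real k / real n) (s + l * real (Suc k) / real n) \<omega> / sqrt l)))"
      by (intro sum.cong refl) (simp add: walk_increment[OF s n])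
    ultimately show ?thesis by simp
  qed
  moreover have "1 \<le> A" using c(1) C0 H0_nonneg by (simp add: A_def)
  ultimately show ?thesis unfolding incr_bound_def by blast
qed

end

subsection \<open>Dyadic scales\<close>

lemma sum_lessThan_add: "(\<Sum>k<a + b. g k) = (\<Sum>k<a. g k) + (\<Sum>k<b. g (a + k))"
  for g :: "nat \<Rightarrow> real" and a b :: nat
  by (induction b) simp_all

lemma near_scale: "0 < a \<Longrightarrow> near (a * x) (a * y) = near x y"
  by (simp add: near_def abs_mult)

context process
begin

definition incr :: "nat \<Rightarrow> nat \<Rightarrow> 'a \<Rightarrow> real" where
  "incr N k = U (real k / 2 ^ N) (real (Suc k) / 2 ^ N)"

definition trunc_var :: "real \<Rightarrow> nat \<Rightarrow> nat \<Rightarrow> real" where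
  "trunc_var x N k = expectation (\<lambda>\<omega>. (incr N k \<omega>)\<^sup>2 * near x (incr N k \<omega>))"

text \<open>\<open>N\<close> is the fine mesh, \<open>j\<close> the level and \<open>i\<close> the
  position of a block. The cut-off \<open>x\<close> is absolute, the same for all blocks, which
  makes these numbers a martingale in \<open>j\<close>; in \<open>block_tail\<close> the cut-off is
  relative to the length of the block.\<close>

definition block_var :: "real \<Rightarrow> nat \<Rightarrow> nat \<Rightarrow> nat \<Rightarrow> real" where
  "block_var x N j i = 2 ^ j * (\<Sum>k<2 ^ (N - j). trunc_var x N (i * 2 ^ (N - j) + k))"

definition block_tail :: "real \<Rightarrow> nat \<Rightarrow> nat \<Rightarrow> nat \<Rightarrow> real" where
  "block_tail \<kappa> N j i = (\<Sum>k<2 ^ (N - j). expectation (\<lambda>\<omega>.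
     f (sqrt 2 ^ j * incr N (i * 2 ^ (N - j) + k) \<omega>) * far \<kappa> (sqrt 2 ^ j * incr N (i * 2 ^ (N - j) + k) \<omega>)))"

definition mu :: "nat \<Rightarrow> nat \<Rightarrow> real" where
  "mu j i = sqrt 2 ^ j * m (real i / 2 ^ j) (real (Suc i) / 2 ^ j)"

definition Z :: "nat \<Rightarrow> nat \<Rightarrow> 'a \<Rightarrow> real" where
  "Z j i \<omega> = sqrt 2 ^ j * (X (real (Suc i) / 2 ^ j) \<omega> - X (real i / 2 ^ j) \<omega>)"

lemma grid_point:
  assumes "j \<le> N"
  shows "real i / 2 ^ j + 1 / 2 ^ j * real k / real (2 ^ (N - j)) = real (i * 2 ^ (N - j) + k) / 2 ^ N"
proof -
  have "(2::real) ^ N = 2 ^ j * 2 ^ (N - j)" using assms by (simp add: power_add[symmetric])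
  then show ?thesis by (simp add: field_simps)
qed

lemma dyadic_interval:
  assumes "i < 2 ^ j"
  shows "0 \<le> real i / 2 ^ j" "real i / 2 ^ j + 1 / 2 ^ j \<le> 1" "real (Suc i) / 2 ^ j = real i / 2 ^ j + 1 / 2 ^ j"
    "real (Suc i) / 2 ^ j \<le> 1" "real i / 2 ^ j < real (Suc i) / 2 ^ j"
    "real (Suc i) / 2 ^ j - real i / 2 ^ j = 1 / 2 ^ j"
proof -
  have "real (Suc i) \<le> real (2 ^ j)" using assms by (subst of_nat_le_iff) simp
  then show *: "real (Suc i) / 2 ^ j \<le> 1" by simp
  show e: "real (Suc i) / 2 ^ j = real i / 2 ^ j + 1 / 2 ^ j" by (simp add: add_divide_distrib)
  show "real i / 2 ^ j + 1 / 2 ^ j \<le> 1" using * unfolding e .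
  show "real (Suc i) / 2 ^ j - real i / 2 ^ j = 1 / 2 ^ j" using e by simp
qed (simp_all add: divide_strict_right_mono)

lemma Z_energy: assumes "i < 2 ^ j"
  shows "integrable M (\<lambda>\<omega>. f (Z j i \<omega>))" "expectation (\<lambda>\<omega>. f (Z j i \<omega>)) = G 1 0" "Z j i \<in> borel_measurable M"
proof -
  note d = dyadic_interval[OF assms]
  have "Z j i \<omega> = (X (real (Suc i) / 2 ^ j) \<omega> - X (real i / 2 ^ j) \<omega>) / sqrt (real (Suc i) / 2 ^ j - real i / 2 ^ j)" for \<omega>
    unfolding d(6) sqrt2_power Z_def by (simp add: mult.commute)
  then show "integrable M (\<lambda>\<omega>. f (Z j i \<omega>))" "expectation (\<lambda>\<omega>. f (Z j i \<omega>)) = G 1 0"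
    using X_energy[OF d(1) d(5) d(4)] by simp_all
  show "Z j i \<in> borel_measurable M" unfolding Z_def[abs_def]
    using dX_meas[OF d(1) less_imp_le[OF d(5)] d(4)] by measurable
qed

lemma mu_bound: assumes "i < 2 ^ j" shows "\<bar>mu j i\<bar> \<le> R\<^sub>0"
proof -
  note d = dyadic_interval[OF assms]
  have "\<bar>m (real i / 2 ^ j) (real (Suc i) / 2 ^ j)\<bar> \<le> R\<^sub>0 * sqrt (real (Suc i) / 2 ^ j - real i / 2 ^ j)"
    by (rule m_bound[OF d(1) less_imp_le[OF d(5)] d(4)])
  also have "sqrt (real (Suc i) / 2 ^ j - real i / 2 ^ j) = 1 / sqrt 2 ^ j"
    unfolding d(6) sqrt2_power ..
  finally have "sqrt 2 ^ j * \<bar>m (real i / 2 ^ j) (real (Suc i) / 2 ^ j)\<bar> \<le> sqrt 2 ^ j * (R\<^sub>0 * (1 / sqrt 2 ^ j))"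
    by (rule mult_left_mono) simp
  then show ?thesis by (simp add: mu_def abs_mult)
qed

lemma mu_halves: assumes "i < 2 ^ j"
  shows "mu j i = (mu (Suc j) (2 * i) + mu (Suc j) (2 * i + 1)) / sqrt 2"
proof -
  note d = dyadic_interval[OF assms]
  have h: "m (real i / 2 ^ j) (real (Suc i) / 2 ^ j)
    = m (real i / 2 ^ j) (real (2 * i + 1) / 2 ^ Suc j) + m (real (2 * i + 1) / 2 ^ Suc j) (real (Suc i) / 2 ^ j)"
    using d by (intro m_add) (auto simp: field_simps)
  have eq: "real i / 2 ^ j = real (2 * i) / 2 ^ Suc j" "real (Suc i) / 2 ^ j = real (Suc (2 * i + 1)) / 2 ^ Suc j"
    "real (Suc (2 * i)) = real (2 * i + 1)"
    by (auto simp: field_simps)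
  have e: "m (real i / 2 ^ j) (real (Suc i) / 2 ^ j) = m (real (2 * i) / 2 ^ Suc j) (real (Suc (2 * i)) / 2 ^ Suc j)
    + m (real (2 * i + 1) / 2 ^ Suc j) (real (Suc (2 * i + 1)) / 2 ^ Suc j)"
    using h by (simp only: eq)
  show ?thesis unfolding mu_def e by (simp add: distrib_left add_divide_distrib)
qed

context
  fixes N j i :: nat
  assumes j: "j \<le> N" and i: "i < 2 ^ j"
begin

definition dyadic_path :: "nat \<Rightarrow> 'a \<Rightarrow> real" where "dyadic_path = (\<lambda>k \<omega>. U (real i / 2 ^ j) (real i / 2 ^ j + 1 / 2 ^ j * real k / real (2 ^ (N - j))) \<omega> / sqrt (1 / 2 ^ j)
    + m (real i / 2 ^ j) (real i / 2 ^ j + 1 / 2 ^ j) / sqrt (1 / 2 ^ j))"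

lemma dyadic_walk: "walk f p D M dyadic_path (2 ^ (N - j)) (mu j i) H\<^sub>0"
proof -
  note d = dyadic_interval[OF i]
  have "m (real i / 2 ^ j) (real i / 2 ^ j + 1 / 2 ^ j) / sqrt (1 / 2 ^ j) = mu j i"
    by (simp only: mu_def d(3)) (simp add: sqrt2_power)
  then show ?thesis
    using walk_interval[OF d(1) _ d(2), of "2 ^ (N - j)"] unfolding dyadic_path_def by simp
qed

interpretation W: walk f p D M dyadic_path "2 ^ (N - j)" "mu j i" H\<^sub>0
  by (rule dyadic_walk)

lemma dyadic_increment: assumes "k < 2 ^ (N - j)"
  shows "W.\<xi> k \<omega> = sqrt 2 ^ j * incr N (i * 2 ^ (N - j) + k) \<omega>"
proof -
  note d = dyadic_interval[OF i]
  have "W.\<xi> k \<omega> = U (real i / 2 ^ j + 1 / 2 ^ j * real k / real (2 ^ (N - j)))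
     (real i / 2 ^ j + 1 / 2 ^ j * real (Suc k) / real (2 ^ (N - j))) \<omega> / sqrt (1 / 2 ^ j)"
    unfolding dyadic_path_def by (rule walk_increment[OF d(1) _ d(2) _ assms]) auto
  then show ?thesis
    unfolding grid_point[OF j] sqrt2_power by (simp add: incr_def)
qed

lemma dyadic_end: "dyadic_path (2 ^ (N - j)) \<omega> = Z j i \<omega>"
proof -
  note d = dyadic_interval[OF i]
  have "dyadic_path (2 ^ (N - j)) \<omega> = (X (real i / 2 ^ j + 1 / 2 ^ j) \<omega> - X (real i / 2 ^ j) \<omega>) / sqrt (1 / 2 ^ j)"
    unfolding dyadic_path_def by (rule walk_end) auto
  then show ?thesis unfolding Z_def d(3) by (simp add: sqrt2_power)
qed

lemma dyadic_q: assumes "k < 2 ^ (N - j)"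
  shows "W.q (sqrt 2 ^ j * x) k = 2 ^ j * trunc_var x N (i * 2 ^ (N - j) + k)"
  unfolding W.q_def dyadic_increment[OF assms] trunc_var_def
  by (simp add: near_scale power_mult_distrib sqrt2_power mult.assoc)

lemma dyadic_qsum: "(\<Sum>k<2 ^ (N - j). W.q (sqrt 2 ^ j * x) k) = block_var x N j i"
  by (simp add: dyadic_q block_var_def sum_distrib_left)

lemma dyadic_tail: "(\<Sum>k<2 ^ (N - j). expectation (\<lambda>\<omega>. f (W.\<xi> k \<omega>) * far \<kappa> (W.\<xi> k \<omega>))) = block_tail \<kappa> N j i"
  by (simp add: block_tail_def dyadic_increment)

lemma dyadic_lindeberg:
  assumes C: "smooth_const l v1 C" and l: "0 < l" and x: "0 \<le> x"
    and \<kappa>: "\<kappa> \<le> sqrt 2 ^ j * x" and T: "tail_const l v1 \<kappa> T" and v1: "l + block_var x N j i \<le> v1"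
  shows "\<bar>expectation (\<lambda>\<omega>. G l (Z j i \<omega>)) - G (l + block_var x N j i) (mu j i)\<bar>
    \<le> 2 * C * (1 + H\<^sub>0) * (sqrt 2 ^ j * x) * block_var x N j i + T * (1 + H\<^sub>0) * block_tail (sqrt 2 ^ j * x) N j i"
proof -
  have a: "l + (\<Sum>k<2 ^ (N - j). W.q (sqrt 2 ^ j * x) k) \<le> v1" using v1 by (simp only: dyadic_qsum)
  show ?thesis
    using W.lindeberg[OF C l order_refl _ a T \<kappa>] x
    unfolding dyadic_qsum dyadic_tail dyadic_end by simp
qed

lemma dyadic_int_G:
  assumes C: "smooth_const l v1 C" and l: "0 < l" "l \<le> v1"
  shows "integrable M (\<lambda>\<omega>. G l (Z j i \<omega>))"
  using W.int_GS(1)[OF C, of l "2 ^ (N - j)"] l unfolding dyadic_end by simp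

lemma dyadic_energy_sum:
  assumes A: "incr_bound A"
  shows "(\<Sum>k<2 ^ (N - j). expectation (\<lambda>\<omega>. Q (sqrt 2 ^ j * incr N (i * 2 ^ (N - j) + k) \<omega>))) \<le> A"
proof -
  note d = dyadic_interval[OF i]
  have "(\<Sum>k<2 ^ (N - j). expectation (\<lambda>\<omega>. Q (U (real i / 2 ^ j + 1 / 2 ^ j * real k / real (2 ^ (N - j))) (real i / 2 ^ j + 1 / 2 ^ j * real (Suc k) / real (2 ^ (N - j))) \<omega> / sqrt (1 / 2 ^ j)))) \<le> A"
    by (rule A[unfolded incr_bound_def, rule_format, OF d(1) _ d(2)]) auto
  then show ?thesis unfolding grid_point[OF j] sqrt2_power
    by (simp add: incr_def mult.commute)
qed

lemma dyadic_int:
  assumes "k < 2 ^ (N - j)"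
  shows "incr N (i * 2 ^ (N - j) + k) \<in> borel_measurable M"
    "integrable M (\<lambda>\<omega>. f (sqrt 2 ^ j * incr N (i * 2 ^ (N - j) + k) \<omega>))"
proof -
  have "(\<lambda>\<omega>. 1 / sqrt 2 ^ j * W.\<xi> k \<omega>) \<in> borel_measurable M" using W.meas_xi[OF assms] by measurable
  then show "incr N (i * 2 ^ (N - j) + k) \<in> borel_measurable M" unfolding dyadic_increment[OF assms] by simp
  show "integrable M (\<lambda>\<omega>. f (sqrt 2 ^ j * incr N (i * 2 ^ (N - j) + k) \<omega>))"
    using W.energy_xi[OF assms] unfolding dyadic_increment[OF assms] .
qed

text \<open>Up to modulus \<open>1\<close> the function \<open>Q\<close> is the square, so the a
  priori bound on \<open>Q\<close> covers the truncated variances.\<close>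

lemma block_var_bound:
  assumes A: "incr_bound A"
    and x: "0 \<le> x" "sqrt 2 ^ j * x \<le> 1"
  shows "0 \<le> block_var x N j i" "block_var x N j i \<le> A"
proof -
  have x': "0 \<le> sqrt 2 ^ j * x" using x by simp
  show "0 \<le> block_var x N j i" unfolding dyadic_qsum[symmetric] by (intro sum_nonneg W.q_bounds x') auto
  have "block_var x N j i \<le> (\<Sum>k<2 ^ (N - j). expectation (\<lambda>\<omega>. Q (W.\<xi> k \<omega>)))"
    unfolding dyadic_qsum[symmetric]
  proof (rule sum_mono)
    fix k assume "k \<in> {..<(2::nat) ^ (N - j)}"
    then have k: "k < 2 ^ (N - j)" by simp
    have Q1: "integrable M (\<lambda>\<omega>. Q (W.\<xi> k \<omega>))"
      by (rule W.integrable_xi_dom[OF k, where C = 1]) (use Q_le in auto)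
    show "W.q (sqrt 2 ^ j * x) k \<le> expectation (\<lambda>\<omega>. Q (W.\<xi> k \<omega>))"
      unfolding W.q_def
      by (intro integral_mono W.q_bounds(3)[OF x' k] Q1) (use x in \<open>auto simp: near_def Q_def\<close>)
  qed
  also have "\<dots> = (\<Sum>k<2 ^ (N - j). expectation (\<lambda>\<omega>. Q (sqrt 2 ^ j * incr N (i * 2 ^ (N - j) + k) \<omega>)))"
    by (simp add: dyadic_increment)
  also have "\<dots> \<le> A" by (rule dyadic_energy_sum[OF A])
  finally show "block_var x N j i \<le> A" .
qed

end

lemma block_var_halves: assumes "j < N"
  shows "block_var x N j i = (block_var x N (Suc j) (2 * i) + block_var x N (Suc j) (2 * i + 1)) / 2"
proof -
  define n where "n = (2::nat) ^ (N - Suc j)"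
  have "N - j = Suc (N - Suc j)" using assms by simp
  then have n: "2 ^ (N - j) = n + n" by (simp add: n_def)
  have e: "i * (n + n) + k = 2 * i * n + k" for k
    by (simp add: add_mult_distrib2)
  show ?thesis unfolding block_var_def n n_def[symmetric] sum_lessThan_add e by (simp add: distrib_left add_ac)
qed

end

section \<open>Energy of large jumps over all levels\<close>

lemma sum_blocks: "(\<Sum>i<a. \<Sum>k<b. g (i * b + k)) = (\<Sum>k<a * b. g k)" for g :: "nat \<Rightarrow> real" and a b :: nat
proof (induction a)
  case (Suc a)
  have "(\<Sum>k<Suc a * b. g k) = (\<Sum>k<a * b. g k) + (\<Sum>k<b. g (a * b + k))"
    using sum_lessThan_add[of g "a * b" b] by (simp add: add.commute)
  then show ?case using Suc by simp
qed simp

lemma sum_even_odd: "(\<Sum>i<n. g (2 * i) + g (2 * i + 1)) = (\<Sum>i<2 * n. g i)" for g :: "nat \<Rightarrow> real"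
  by (induction n) (simp_all add: add.assoc)

text \<open>Converts quadratic smallness of martingale differences into smallness in the
  mean.\<close>

lemma abs_le_square: "0 < \<eta> \<Longrightarrow> \<bar>d\<bar> \<le> \<eta> + d\<^sup>2 / \<eta>" for d \<eta> :: real
proof (cases "\<bar>d\<bar> \<le> \<eta>")
  case False
  assume \<eta>: "0 < \<eta>"
  have "\<bar>d\<bar> * \<eta> \<le> \<bar>d\<bar> * \<bar>d\<bar>" using False by (intro mult_left_mono) auto
  then have "\<bar>d\<bar> \<le> d\<^sup>2 / \<eta>" using \<eta> by (simp add: pos_le_divide_eq power2_eq_square)
  then show ?thesis using \<eta> by simp
qed (simp add: add_increasing2)

lemma exists_le_average:
  fixes g :: "nat \<Rightarrow> real"
  assumes "(\<Sum>w<n. g w) \<le> S" "0 < n"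
  shows "\<exists>w<n. g w \<le> S / real n"
proof (rule ccontr)
  assume "\<not> (\<exists>w<n. g w \<le> S / real n)"
  then have "(\<Sum>w<n. S / real n) < (\<Sum>w<n. g w)"
    using assms(2) by (intro sum_strict_mono) (auto simp: not_le)
  then show False using assms by simp
qed

context energy
begin

text \<open>\<open>f_le_G\<close> and \<open>G_small\<close>, integrated against a further normal
  step of variance \<open>v\<close> by the semigroup property.\<close>

lemma G_increase:
  assumes l: "0 < l" "l \<le> 1/2" and v: "0 \<le> v"
  shows "G v x \<le> G (l\<^sup>2 + v) x" "G (l\<^sup>2 + v) x \<le> G v x + (4 * D + G 1 0) * l * (1 + G v x)"
proof -
  have i: "integrable std_normal (\<lambda>w. f (x + sqrt v * w))" using v by (rule integrable_G)
  have g: "integrable std_normal (\<lambda>w. G (l\<^sup>2) (x + sqrt v * w))" "(\<integral>w. G (l\<^sup>2) (x + sqrt v * w) \<partial>std_normal) = G (l\<^sup>2 + v) x"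
    using G_add[of "l\<^sup>2" v x] v by auto
  have "G v x \<le> (\<integral>w. G (l\<^sup>2) (x + sqrt v * w) \<partial>std_normal)"
    unfolding G_def[of v] by (intro integral_mono i g f_le_G) auto
  then show "G v x \<le> G (l\<^sup>2 + v) x" using g by simp
  have "(\<integral>w. G (l\<^sup>2) (x + sqrt v * w) \<partial>std_normal)
    \<le> (\<integral>w. f (x + sqrt v * w) + (4 * D + G 1 0) * l * (1 + f (x + sqrt v * w)) \<partial>std_normal)"
    using i by (intro integral_mono g G_small l) auto
  also have "\<dots> = G v x + (4 * D + G 1 0) * l * (1 + G v x)"
    using i by (simp add: G_def)
  finally show "G (l\<^sup>2 + v) x \<le> G v x + (4 * D + G 1 0) * l * (1 + G v x)" using g by simp
qed

end

context process
begin

text \<open>The mean of \<open>block_tail\<close> over the blocks of level \<open>j\<close>, written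
  as one sum over the finest increments so that it can be interchanged with a sum over
  levels.\<close>

definition level_tail :: "real \<Rightarrow> nat \<Rightarrow> nat \<Rightarrow> real" where
  "level_tail \<kappa> N j = 1 / 2 ^ j * (\<Sum>k<2 ^ N. expectation (\<lambda>\<omega>. f (sqrt 2 ^ j * incr N k \<omega>) * far \<kappa> (sqrt 2 ^ j * incr N k \<omega>)))"

lemma incr_int: assumes "k < 2 ^ N"
  shows "incr N k \<in> borel_measurable M" "integrable M (\<lambda>\<omega>. f (incr N k \<omega>))"
    "integrable M (\<lambda>\<omega>. Q (incr N k \<omega>))"
proof -
  show m[measurable]: "incr N k \<in> borel_measurable M" and i: "integrable M (\<lambda>\<omega>. f (incr N k \<omega>))"
    using dyadic_int[of 0 N 0 k] assms by auto
  show "integrable M (\<lambda>\<omega>. Q (incr N k \<omega>))"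
  proof (rule Bochner_Integration.integrable_bound)
    show "integrable M (\<lambda>\<omega>. 1 + f (incr N k \<omega>))" using i by simp
    show "AE \<omega> in M. norm (Q (incr N k \<omega>)) \<le> norm (1 + f (incr N k \<omega>))"
      using Q_le by (intro AE_I2) simp
  qed measurable
qed

lemma incr_far_integrable: assumes k: "k < 2 ^ N"
  shows "integrable M (\<lambda>\<omega>. f (sqrt 2 ^ j * incr N k \<omega>) * far \<kappa> (sqrt 2 ^ j * incr N k \<omega>))"
proof (rule Bochner_Integration.integrable_bound)
  note [measurable] = incr_int(1)[OF k]
  show "integrable M (\<lambda>\<omega>. D * (sqrt 2 ^ j) powr p * f (incr N k \<omega>))" using incr_int(2)[OF k] by simp
  show "(\<lambda>\<omega>. f (sqrt 2 ^ j * incr N k \<omega>) * far \<kappa> (sqrt 2 ^ j * incr N k \<omega>)) \<in> borel_measurable M" by measurable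
  show "AE \<omega> in M. norm (f (sqrt 2 ^ j * incr N k \<omega>) * far \<kappa> (sqrt 2 ^ j * incr N k \<omega>)) \<le> norm (D * (sqrt 2 ^ j) powr p * f (incr N k \<omega>))"
  proof (rule AE_I2)
    fix \<omega>
    have "f (sqrt 2 ^ j * incr N k \<omega>) * far \<kappa> (sqrt 2 ^ j * incr N k \<omega>) \<le> f (sqrt 2 ^ j * incr N k \<omega>) * 1"
      by (intro mult_left_mono near_far_simps) auto
    also have "\<dots> \<le> D * (sqrt 2 ^ j) powr p * f (incr N k \<omega>)" unfolding mult_1_right by (intro dil one_le_power) auto
    finally show "norm (f (sqrt 2 ^ j * incr N k \<omega>) * far \<kappa> (sqrt 2 ^ j * incr N k \<omega>)) \<le> norm (D * (sqrt 2 ^ j) powr p * f (incr N k \<omega>))"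
      using near_far_simps(2) by (simp add: abs_of_nonneg)
  qed
qed

lemma level_tail_nonneg: "0 \<le> level_tail \<kappa> N j"
  unfolding level_tail_def by (intro mult_nonneg_nonneg sum_nonneg integral_nonneg_AE AE_I2 near_far_simps nonneg) auto

lemma level_tail_eq_mean: assumes "j \<le> N"
  shows "1 / 2 ^ j * (\<Sum>i<2 ^ j. block_tail \<kappa> N j i) = level_tail \<kappa> N j"
proof -
  have "(2::nat) ^ j * 2 ^ (N - j) = 2 ^ N" using assms by (simp add: power_add[symmetric])
  then show ?thesis
    using sum_blocks[of "\<lambda>k. expectation (\<lambda>\<omega>. f (sqrt 2 ^ j * incr N k \<omega>) * far \<kappa> (sqrt 2 ^ j * incr N k \<omega>))" "2 ^ (N - j)" "2 ^ j"]
    by (simp add: level_tail_def block_tail_def)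
qed

lemma block_tail_antimono:
  assumes "j \<le> N" "i < 2 ^ j" "\<kappa>' \<le> \<kappa>" shows "block_tail \<kappa> N j i \<le> block_tail \<kappa>' N j i"
  unfolding block_tail_def
proof (rule sum_mono)
  fix k assume "k \<in> {..<(2::nat) ^ (N - j)}"
  then have k: "k < 2 ^ (N - j)" by simp
  have "i * 2 ^ (N - j) + k < (i + 1) * 2 ^ (N - j)" using k by simp
  also have "\<dots> \<le> 2 ^ j * 2 ^ (N - j)" using assms by (intro mult_right_mono) auto
  also have "\<dots> = 2 ^ N" using assms by (simp add: power_add[symmetric])
  finally have k': "i * 2 ^ (N - j) + k < 2 ^ N" .
  show "expectation (\<lambda>\<omega>. f (sqrt 2 ^ j * incr N (i * 2 ^ (N - j) + k) \<omega>) * far \<kappa> (sqrt 2 ^ j * incr N (i * 2 ^ (N - j) + k) \<omega>))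
    \<le> expectation (\<lambda>\<omega>. f (sqrt 2 ^ j * incr N (i * 2 ^ (N - j) + k) \<omega>) * far \<kappa>' (sqrt 2 ^ j * incr N (i * 2 ^ (N - j) + k) \<omega>))"
    by (intro integral_mono incr_far_integrable k' mult_left_mono) (use assms(3) in \<open>auto simp: far_def\<close>)
qed

context
  fixes A :: real
  assumes A: "incr_bound A"
    and A1: "1 \<le> A"
begin

text \<open>After interchanging the sums, \<open>scale_sum\<close> handles each increment over all
  levels at once. The bound depends neither on the mesh nor on the number of levels.\<close>

lemma level_tail_sum:
  assumes \<kappa>: "0 < \<kappa>" "\<kappa> \<le> 1"
  shows "\<exists>C\<ge>0. \<forall>N n. (\<Sum>j<n. level_tail \<kappa> N j) \<le> C"
proof -
  obtain C where C: "0 \<le> C" "\<And>u m. (\<Sum>j<m. 1 / 2 ^ j * (f (sqrt 2 ^ j * u) * far \<kappa> (sqrt 2 ^ j * u))) \<le> C * Q u"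
    using scale_sum[OF \<kappa>] by blast
  have "(\<Sum>j<n. level_tail \<kappa> N j) \<le> C * A" for N n
  proof -
    let ?h = "\<lambda>j k \<omega>. f (sqrt 2 ^ j * incr N k \<omega>) * far \<kappa> (sqrt 2 ^ j * incr N k \<omega>)"
    have "(\<Sum>j<n. level_tail \<kappa> N j) = (\<Sum>j<n. \<Sum>k<2 ^ N. 1 / 2 ^ j * expectation (?h j k))"
      unfolding level_tail_def sum_distrib_left ..
    also have "\<dots> = (\<Sum>k<2 ^ N. \<Sum>j<n. 1 / 2 ^ j * expectation (?h j k))" by (rule sum.swap)
    also have "\<dots> \<le> (\<Sum>k<2 ^ N. C * expectation (\<lambda>\<omega>. Q (incr N k \<omega>)))"
    proof (rule sum_mono)
      fix k assume "k \<in> {..<(2::nat) ^ N}"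
      then have k: "k < 2 ^ N" by simp
      have "(\<Sum>j<n. 1 / 2 ^ j * expectation (?h j k)) = expectation (\<lambda>\<omega>. \<Sum>j<n. 1 / 2 ^ j * ?h j k \<omega>)"
        using incr_far_integrable[OF k] by (subst Bochner_Integration.integral_sum) (auto simp del: times_divide_eq_left)
      also have "\<dots> \<le> expectation (\<lambda>\<omega>. C * Q (incr N k \<omega>))"
        by (intro integral_mono Bochner_Integration.integrable_sum integrable_mult_right incr_far_integrable[OF k] incr_int(3)[OF k] C(2))
      finally show "(\<Sum>j<n. 1 / 2 ^ j * expectation (?h j k)) \<le> C * expectation (\<lambda>\<omega>. Q (incr N k \<omega>))" by simp
    qed
    also have "\<dots> = C * (\<Sum>k<2 ^ N. expectation (\<lambda>\<omega>. Q (incr N k \<omega>)))" by (simp only: sum_distrib_left)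
    also have "\<dots> \<le> C * A" using dyadic_energy_sum[of 0 N 0 A] A C(1) by (intro mult_left_mono) auto
    finally show ?thesis .
  qed
  moreover have "0 \<le> C * A" using C(1) A1 by simp
  ultimately show ?thesis by blast
qed

text \<open>Pigeonhole among \<open>n > C / \<delta>\<close> disjoint windows of
  \<open>L + 1\<close> levels, whose tail energies add up to at most \<open>C\<close>.\<close>

lemma window:
  assumes \<kappa>: "0 < \<kappa>" "\<kappa> \<le> 1" and \<delta>: "0 < \<delta>"
  shows "\<exists>a N. 1 \<le> a \<and> a + L \<le> N \<and> (\<forall>j\<in>{a..a + L}. level_tail \<kappa> N j \<le> \<delta>)"
proof -
  obtain C where C: "0 \<le> C" "\<And>N n. (\<Sum>j<n. level_tail \<kappa> N j) \<le> C" using level_tail_sum[OF \<kappa>] by blast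
  obtain n :: nat where n: "C / \<delta> < real n" using reals_Archimedean2 by blast
  have n0: "0 < n" using n C(1) \<delta> by (cases "n = 0") (auto simp: field_simps not_less[symmetric] divide_less_0_iff)
  \<comment> \<open>The windows start at level \<open>1\<close>, so that half of the unit interval
    is a union of blocks, and the mesh is finer than the last of them.\<close>
  define N where "N = Suc (n * Suc L)"
  have "(\<Sum>w<n. \<Sum>t<Suc L. level_tail \<kappa> N (1 + (w * Suc L + t))) = (\<Sum>k<n * Suc L. level_tail \<kappa> N (1 + k))"
    by (rule sum_blocks)
  also have "\<dots> \<le> (\<Sum>k<N. level_tail \<kappa> N k)"
    unfolding N_def sum.lessThan_Suc_shift using level_tail_nonneg by simp
  also have "\<dots> \<le> C" by (rule C)
  finally obtain w where w: "w < n" "(\<Sum>t<Suc L. level_tail \<kappa> N (1 + (w * Suc L + t))) \<le> C / real n"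
    using exists_le_average[OF _ n0] by blast
  have "C / real n \<le> \<delta>" using n n0 \<delta> by (simp add: field_simps)
  then have s: "(\<Sum>t<Suc L. level_tail \<kappa> N (1 + (w * Suc L + t))) \<le> \<delta>" using w by simp
  define a where "a = 1 + w * Suc L"
  have "level_tail \<kappa> N j \<le> \<delta>" if "j \<in> {a..a + L}" for j
  proof -
    have "level_tail \<kappa> N (1 + (w * Suc L + (j - a))) \<le> (\<Sum>t<Suc L. level_tail \<kappa> N (1 + (w * Suc L + t)))"
      by (rule member_le_sum) (use that level_tail_nonneg in auto)
    moreover have "1 + (w * Suc L + (j - a)) = j" using that by (simp add: a_def)
    ultimately show ?thesis using s by simp
  qed
  moreover have "a + L \<le> N"
  proof -
    have "Suc w * Suc L \<le> n * Suc L" using w(1) by (intro mult_right_mono) auto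
    then show ?thesis by (simp add: a_def N_def)
  qed
  ultimately show ?thesis by (intro exI[of _ a] exI[of _ N]) (auto simp: a_def)
qed

definition curve_error :: "real \<Rightarrow> nat \<Rightarrow> nat \<Rightarrow> nat \<Rightarrow> real" where
  "curve_error x N j i = \<bar>G (block_var x N j i) (mu j i) - G 1 0\<bar>"

text \<open>The energy of a block is exactly \<open>G 1 0\<close>. Smoothing by
  \<open>l\<^sup>2\<close> moves this energy and its Gaussian counterpart by order \<open>l\<close>
  each, and the swap error stands between the smoothed values. \<open>K\<close> is quantified before
  \<open>l\<close>, since the constants \<open>C\<close> and \<open>T\<close> depend on
  \<open>l\<close>.\<close>

lemma curve_error_bound:
  "\<exists>K\<ge>0. \<forall>l \<kappa> \<kappa>' C T x N j i. 0 < l \<longrightarrow> l \<le> 1/2 \<longrightarrow> smooth_const (l\<^sup>2) (1 + A) C \<longrightarrow> tail_const (l\<^sup>2) (1 + A) \<kappa>' T \<longrightarrow>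
     j \<le> N \<longrightarrow> i < 2 ^ j \<longrightarrow> 0 \<le> x \<longrightarrow> \<kappa>' \<le> sqrt 2 ^ j * x \<longrightarrow> sqrt 2 ^ j * x \<le> \<kappa> \<longrightarrow> \<kappa> \<le> 1 \<longrightarrow>
     curve_error x N j i \<le> K * l + 2 * C * (1 + H\<^sub>0) * \<kappa> * A + T * (1 + H\<^sub>0) * block_tail \<kappa>' N j i"
proof -
  obtain Cg where Cg: "1 \<le> Cg" "\<And>v x. v \<in> {0..A} \<Longrightarrow> G v x \<le> Cg * (1 + f x)" using G_bound by blast
  define c where "c = 4 * D + G 1 0"
  have c: "0 \<le> c" using D by (simp add: c_def)
  define g where "g = Cg * (1 + f R\<^sub>0)"
  have g: "0 \<le> g" using Cg by (simp add: g_def)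
  define K where "K = c * (1 + G 1 0) + c * (1 + g)"
  have "curve_error x N j i \<le> K * l + 2 * C * (1 + H\<^sub>0) * \<kappa> * A + T * (1 + H\<^sub>0) * block_tail \<kappa>' N j i"
    if l: "0 < l" "l \<le> 1/2" and C: "smooth_const (l\<^sup>2) (1 + A) C" and T: "tail_const (l\<^sup>2) (1 + A) \<kappa>' T"
      and j: "j \<le> N" and i: "i < 2 ^ j" and x: "0 \<le> x" and \<kappa>': "\<kappa>' \<le> sqrt 2 ^ j * x" and \<kappa>: "sqrt 2 ^ j * x \<le> \<kappa>" "\<kappa> \<le> 1"
    for l \<kappa> \<kappa>' C T x N j i
  proof -
    let ?v = "block_var x N j i" and ?E = "expectation (\<lambda>\<omega>. G (l\<^sup>2) (Z j i \<omega>))"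
    have v: "0 \<le> ?v" "?v \<le> A" using block_var_bound[OF j i A x] \<kappa> by auto
    have l2: "l\<^sup>2 \<le> 1" using l by (simp add: power_le_one)
    have C0: "0 \<le> C" and T0: "0 \<le> T" using C T by (auto simp: smooth_const_def tail_const_def)
    have tl0: "0 \<le> block_tail (sqrt 2 ^ j * x) N j i"
      unfolding block_tail_def by (intro sum_nonneg integral_nonneg_AE AE_I2 mult_nonneg_nonneg near_far_simps nonneg)
    have "\<bar>?E - G (l\<^sup>2 + ?v) (mu j i)\<bar>
      \<le> 2 * C * (1 + H\<^sub>0) * (sqrt 2 ^ j * x) * ?v + T * (1 + H\<^sub>0) * block_tail (sqrt 2 ^ j * x) N j i"
      by (rule dyadic_lindeberg[OF j i C _ x \<kappa>' T]) (use l l2 v in auto)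
    also have "\<dots> \<le> 2 * C * (1 + H\<^sub>0) * \<kappa> * A + T * (1 + H\<^sub>0) * block_tail \<kappa>' N j i"
    proof (intro add_mono)
      have "(sqrt 2 ^ j * x) * ?v \<le> \<kappa> * A" using v \<kappa> x A1 by (intro mult_mono) (auto intro: order_trans[of 0 "sqrt 2 ^ j * x"])
      then have "2 * C * (1 + H\<^sub>0) * ((sqrt 2 ^ j * x) * ?v) \<le> 2 * C * (1 + H\<^sub>0) * (\<kappa> * A)"
        by (rule mult_left_mono) (use C0 H0_nonneg in simp)
      then show "2 * C * (1 + H\<^sub>0) * (sqrt 2 ^ j * x) * ?v \<le> 2 * C * (1 + H\<^sub>0) * \<kappa> * A" by (simp only: mult.assoc)
      show "T * (1 + H\<^sub>0) * block_tail (sqrt 2 ^ j * x) N j i \<le> T * (1 + H\<^sub>0) * block_tail \<kappa>' N j i"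
        by (rule mult_left_mono[OF block_tail_antimono[OF j i \<kappa>']]) (use T0 H0_nonneg in simp)
    qed
    finally have X: "\<bar>?E - G (l\<^sup>2 + ?v) (mu j i)\<bar> \<le> 2 * C * (1 + H\<^sub>0) * \<kappa> * A + T * (1 + H\<^sub>0) * block_tail \<kappa>' N j i" .
    note Z = Z_energy[OF i]
    have iG: "integrable M (\<lambda>\<omega>. G (l\<^sup>2) (Z j i \<omega>))"
      by (rule dyadic_int_G[OF j i C]) (use l l2 A1 in auto)
    have "expectation (\<lambda>\<omega>. f (Z j i \<omega>)) \<le> ?E" by (intro integral_mono Z iG f_le_G) auto
    then have E1: "G 1 0 \<le> ?E" using Z by simp
    have "?E \<le> expectation (\<lambda>\<omega>. f (Z j i \<omega>) + c * l * (1 + f (Z j i \<omega>)))"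
      unfolding c_def using Z(1) by (intro integral_mono iG G_small l) auto
    also have "\<dots> = G 1 0 + c * l * (1 + G 1 0)" using Z by (simp add: prob_space)
    finally have E2: "?E \<le> G 1 0 + c * l * (1 + G 1 0)" .
    have gv: "G ?v (mu j i) \<le> g"
    proof -
      have "G ?v (mu j i) \<le> Cg * (1 + f (mu j i))" using v by (intro Cg) auto
      also have "\<dots> \<le> g" unfolding g_def using Cg(1) mu_bound[OF i] R0_ge by (intro mult_left_mono add_left_mono mono) auto
      finally show ?thesis .
    qed
    have G1: "G ?v (mu j i) \<le> G (l\<^sup>2 + ?v) (mu j i)" by (rule G_increase(1)[OF l v(1)])
    have "G (l\<^sup>2 + ?v) (mu j i) \<le> G ?v (mu j i) + c * l * (1 + G ?v (mu j i))"
      unfolding c_def by (rule G_increase(2)[OF l v(1)])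
    also have "c * l * (1 + G ?v (mu j i)) \<le> c * l * (1 + g)" using c l gv by (intro mult_left_mono) auto
    finally have G2: "G (l\<^sup>2 + ?v) (mu j i) \<le> G ?v (mu j i) + c * l * (1 + g)" by simp
    have k: "K * l = c * l * (1 + G 1 0) + c * l * (1 + g)" by (simp add: K_def algebra_simps)
    have nn: "0 \<le> c * l * (1 + G 1 0)" "0 \<le> c * l * (1 + g)" using c l g by auto
    show ?thesis unfolding curve_error_def k using X E1 E2 G1 G2 nn by linarith
  qed
  moreover have "0 \<le> K" using c g by (simp add: K_def)
  ultimately show ?thesis by blast
qed

end
end

section \<open>Averages over the blocks of a level and the choice of a good scale\<close>

definition dyadic_mean :: "nat \<Rightarrow> (nat \<Rightarrow> real) \<Rightarrow> real" where
  "dyadic_mean j g = 1 / 2 ^ j * (\<Sum>i<2 ^ j. g i)"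

lemma dyadic_mean_const: "dyadic_mean j (\<lambda>_. c) = c" by (simp add: dyadic_mean_def)

lemma dyadic_mean_add: "dyadic_mean j (\<lambda>i. g i + h i) = dyadic_mean j g + dyadic_mean j h"
  by (simp add: dyadic_mean_def sum.distrib distrib_left add_divide_distrib)

lemma dyadic_mean_cmult: "dyadic_mean j (\<lambda>i. c * g i) = c * dyadic_mean j g"
  by (simp add: dyadic_mean_def sum_distrib_left)

lemma dyadic_mean_mono: "(\<And>i. i < 2 ^ j \<Longrightarrow> g i \<le> h i) \<Longrightarrow> dyadic_mean j g \<le> dyadic_mean j h"
  unfolding dyadic_mean_def by (intro mult_left_mono sum_mono) auto

lemma dyadic_mean_halves: "dyadic_mean j (\<lambda>i. g (2 * i) + g (2 * i + 1)) = 2 * dyadic_mean (Suc j) g"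
  unfolding dyadic_mean_def sum_even_odd by simp

context process
begin

context
  fixes A :: real
  assumes A: "incr_bound A"
    and A1: "1 \<le> A"
begin

text \<open>The level is found by two pigeonhole arguments: first a window of consecutive levels on which large
  jumps carry little energy, then a level in that window at which the block variances, a bounded dyadic
  martingale, hardly change from an interval to its halves.\<close>

lemma small_scale_aux:
  assumes \<eta>: "0 < \<eta>" and x0: "0 < x0"
  shows "\<exists>N x j. 1 \<le> j \<and> Suc j \<le> N \<and> 0 < x \<and> x \<le> x0 \<and> x \<le> 1 \<and> sqrt 2 ^ j * x \<le> 1 \<and> sqrt 2 ^ Suc j * x \<le> 1 \<and>
    dyadic_mean j (curve_error x N j) \<le> \<eta> \<and> dyadic_mean (Suc j) (curve_error x N (Suc j)) \<le> \<eta> \<and>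
    dyadic_mean j (\<lambda>i. \<bar>block_var x N (Suc j) (2 * i) - block_var x N (Suc j) (2 * i + 1)\<bar>) \<le> 2 * \<eta>"
proof -
  obtain K where K: "0 \<le> K" "\<And>l \<kappa> \<kappa>' C T x N j i. 0 < l \<Longrightarrow> l \<le> 1/2 \<Longrightarrow> smooth_const (l\<^sup>2) (1 + A) C \<Longrightarrow> tail_const (l\<^sup>2) (1 + A) \<kappa>' T \<Longrightarrow>
     j \<le> N \<Longrightarrow> i < 2 ^ j \<Longrightarrow> 0 \<le> x \<Longrightarrow> \<kappa>' \<le> sqrt 2 ^ j * x \<Longrightarrow> sqrt 2 ^ j * x \<le> \<kappa> \<Longrightarrow> \<kappa> \<le> 1 \<Longrightarrow>
     curve_error x N j i \<le> K * l + 2 * C * (1 + H\<^sub>0) * \<kappa> * A + T * (1 + H\<^sub>0) * block_tail \<kappa>' N j i"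
    using curve_error_bound[OF A A1] by blast
  \<comment> \<open>The mean square of the block variances rises by at most \<open>A\<^sup>2\<close>
    over the window, so some level contributes at most \<open>A\<^sup>2 / L\<close>; this choice
    makes four times that at most \<open>\<eta>\<^sup>2\<close>.\<close>
  obtain L :: nat where L: "4 * A\<^sup>2 / \<eta>\<^sup>2 < real L" using reals_Archimedean2 by blast
  have L0: "0 < L"
  proof (rule ccontr)
    assume "\<not> 0 < L"
    moreover have "0 \<le> 4 * A\<^sup>2 / \<eta>\<^sup>2" by simp
    ultimately show False using L by simp
  qed
  \<comment> \<open>Each of the three terms of \<open>curve_error_bound\<close> gets a third of
    \<open>\<eta>\<close>; adding \<open>1\<close> keeps the denominator positive.\<close>
  have split: "c * y \<le> \<eta> / 3" if "0 \<le> c" "y \<le> \<eta> / (3 * (c + 1))" for c y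
  proof -
    have "c * y \<le> c * (\<eta> / (3 * (c + 1)))" using that by (intro mult_left_mono) auto
    also have "\<dots> = c / (c + 1) * (\<eta> / 3)" by simp
    also have "\<dots> \<le> 1 * (\<eta> / 3)" using that \<eta> by (intro mult_right_mono) auto
    finally show ?thesis by simp
  qed
  \<comment> \<open>\<open>l\<close> determines \<open>C\<close>, to which \<open>\<kappa>\<close>
    is adapted; \<open>\<kappa>\<close> and \<open>L\<close> determine \<open>\<kappa>'\<close>,
    then \<open>T\<close>, and finally \<open>\<delta>\<close>.\<close>
  define l where "l = min (1/2) (\<eta> / (3 * (K + 1)))"
  have l: "0 < l" "l \<le> 1/2" using \<eta> K(1) unfolding l_def by (simp, intro min.cobounded1)
  have Kl: "K * l \<le> \<eta> / 3" using K(1) by (intro split) (auto simp: l_def)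
  obtain C where C: "smooth_const (l\<^sup>2) (1 + A) C" using smooth_const_exists[of "l\<^sup>2" "1 + A"] l by auto
  have C0: "0 \<le> C" using C by (simp add: smooth_const_def)
  define C1 where "C1 = 2 * C * (1 + H\<^sub>0) * A"
  have C1: "0 \<le> C1" using C0 H0_nonneg A1 by (simp add: C1_def)
  define \<kappa> where "\<kappa> = min (min 1 x0) (\<eta> / (3 * (C1 + 1)))"
  have \<kappa>: "0 < \<kappa>" "\<kappa> \<le> 1" "\<kappa> \<le> x0" using \<eta> C1 x0 by (auto simp: \<kappa>_def)
  have Ck: "2 * C * (1 + H\<^sub>0) * \<kappa> * A \<le> \<eta> / 3"
  proof -
    have "C1 * \<kappa> \<le> \<eta> / 3" using C1 by (intro split) (auto simp: \<kappa>_def)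
    then show ?thesis by (simp add: C1_def mult_ac)
  qed
  \<comment> \<open>One absolute cut-off serves the whole window, so the relative cut-off drops by
    \<open>sqrt 2\<close> with each coarser level, down to this value.\<close>
  define \<kappa>' where "\<kappa>' = \<kappa> / sqrt 2 ^ L"
  have one: "1 \<le> sqrt 2 ^ n" for n by (rule one_le_power) simp
  have dle: "\<kappa> / sqrt 2 ^ n \<le> \<kappa>" for n
    using mult_ge_right[OF one[of n], of \<kappa>] \<kappa>(1) by (simp add: pos_divide_le_eq mult.commute)
  have \<kappa>': "0 < \<kappa>'" "\<kappa>' \<le> 1" using \<kappa> order_trans[OF dle[of L] \<kappa>(2)] by (auto simp: \<kappa>'_def)
  obtain T where T: "tail_const (l\<^sup>2) (1 + A) \<kappa>' T"
    using B_bound_tail[of "l\<^sup>2" \<kappa>' "1 + A"] l \<kappa>' by (auto simp: tail_const_def)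
  have T0: "0 \<le> T" using T by (simp add: tail_const_def)
  have T1: "0 \<le> T * (1 + H\<^sub>0)" using T0 H0_nonneg by simp
  define \<delta> where "\<delta> = \<eta> / (3 * (T * (1 + H\<^sub>0) + 1))"
  have \<delta>: "0 < \<delta>" using \<eta> T1 by (simp add: \<delta>_def)
  obtain a N where aN: "1 \<le> a" "a + L \<le> N" "\<And>j. j \<in> {a..a + L} \<Longrightarrow> level_tail \<kappa>' N j \<le> \<delta>"
    using window[OF A A1 \<kappa>' \<delta>, of L] by blast
  \<comment> \<open>Chosen so that the relative cut-off is exactly \<open>\<kappa>\<close> at the
    finest level of the window.\<close>
  define x where "x = \<kappa> / sqrt 2 ^ (a + L)"
  have x_pos: "0 < x" using \<kappa> by (simp add: x_def)
  have x_le: "x \<le> \<kappa>" unfolding x_def by (rule dle)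
  have sc: "\<kappa>' \<le> sqrt 2 ^ j * x" "sqrt 2 ^ j * x \<le> \<kappa>" if j: "j \<in> {a..a + L}" for j
  proof -
    have "sqrt 2 ^ (a + L) = sqrt 2 ^ j * sqrt 2 ^ (a + L - j)" using j by (simp add: power_add[symmetric])
    then have e: "sqrt 2 ^ j * x = \<kappa> / sqrt 2 ^ (a + L - j)" by (simp add: x_def)
    show "sqrt 2 ^ j * x \<le> \<kappa>" unfolding e by (rule dle)
    have "sqrt 2 ^ (a + L - j) \<le> sqrt 2 ^ L" using j by (intro power_increasing) auto
    then show "\<kappa>' \<le> sqrt 2 ^ j * x" unfolding e \<kappa>'_def using \<kappa> by (intro divide_left_mono) auto
  qed
  have errj: "dyadic_mean j (curve_error x N j) \<le> \<eta>" if j: "j \<in> {a..a + L}" for j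
  proof -
    have jN: "j \<le> N" using j aN by simp
    have "dyadic_mean j (curve_error x N j) \<le> dyadic_mean j (\<lambda>i. (K * l + 2 * C * (1 + H\<^sub>0) * \<kappa> * A) + T * (1 + H\<^sub>0) * block_tail \<kappa>' N j i)"
      by (intro dyadic_mean_mono K(2)[OF l C T jN _ _ sc(1)[OF j] sc(2)[OF j] \<kappa>(2)]) (use x_pos in auto)
    also have "\<dots> = K * l + 2 * C * (1 + H\<^sub>0) * \<kappa> * A + T * (1 + H\<^sub>0) * level_tail \<kappa>' N j"
      unfolding dyadic_mean_add dyadic_mean_const dyadic_mean_cmult level_tail_eq_mean[OF jN, symmetric] by (simp add: dyadic_mean_def)
    also have "\<dots> \<le> \<eta> / 3 + \<eta> / 3 + \<eta> / 3"
    proof -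
      have "T * (1 + H\<^sub>0) * level_tail \<kappa>' N j \<le> \<eta> / 3"
        using aN(3)[OF j] T1 by (intro split) (auto simp: \<delta>_def)
      then show ?thesis using Kl Ck by linarith
    qed
    finally show ?thesis by simp
  qed
  have vA: "0 \<le> block_var x N j i" "block_var x N j i \<le> A" if "j \<in> {a..a + L}" "i < 2 ^ j" for j i
    using block_var_bound[of j N i A x] that aN A x_pos sc(2)[OF that(1)] \<kappa> by auto
  define S where "S t = dyadic_mean (a + t) (\<lambda>i. (block_var x N (a + t) i)\<^sup>2)" for t
  define d where "d j i = block_var x N (Suc j) (2 * i) - block_var x N (Suc j) (2 * i + 1)" for j i
  \<comment> \<open>Orthogonality of martingale differences, in the form of the parallelogram
    identity for the two halves of each block.\<close>
  have step: "S (Suc t) - S t = dyadic_mean (a + t) (\<lambda>i. 1 / 4 * (d (a + t) i)\<^sup>2)" if t: "t < L" for t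
  proof -
    let ?j = "a + t"
    have jN: "?j < N" using t aN by simp
    have "(block_var x N (Suc ?j) (2 * i))\<^sup>2 + (block_var x N (Suc ?j) (2 * i + 1))\<^sup>2 = 2 * ((block_var x N ?j i)\<^sup>2 + 1 / 4 * (d ?j i)\<^sup>2)" for i
      unfolding block_var_halves[OF jN, of x i] d_def by (simp add: power2_eq_square field_simps)
    then have "2 * S (Suc t) = dyadic_mean ?j (\<lambda>i. 2 * ((block_var x N ?j i)\<^sup>2 + 1 / 4 * (d ?j i)\<^sup>2))"
      unfolding S_def add_Suc_right dyadic_mean_halves[symmetric] by simp
    also have "\<dots> = 2 * (S t + dyadic_mean ?j (\<lambda>i. 1 / 4 * (d ?j i)\<^sup>2))"
      unfolding dyadic_mean_cmult[of _ 2] dyadic_mean_add S_def ..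
    finally show ?thesis by simp
  qed
  have "(\<Sum>t<L. S (Suc t) - S t) = S L - S 0" by (rule sum_lessThan_telescope)
  also have "\<dots> \<le> S L" by (simp add: S_def dyadic_mean_def sum_nonneg)
  also have "\<dots> \<le> dyadic_mean (a + L) (\<lambda>_. A\<^sup>2)"
    unfolding S_def by (intro dyadic_mean_mono power_mono) (use vA in auto)
  also have "\<dots> = A\<^sup>2" by (rule dyadic_mean_const)
  finally obtain t where t: "t < L" "S (Suc t) - S t \<le> A\<^sup>2 / real L"
    using exists_le_average[OF _ L0] by blast
  define j where "j = a + t"
  have j: "j \<in> {a..a + L}" "Suc j \<in> {a..a + L}" using t by (auto simp: j_def)
  have "dyadic_mean j (\<lambda>i. \<bar>d j i\<bar>) \<le> dyadic_mean j (\<lambda>i. \<eta> + 4 / \<eta> * (1 / 4 * (d j i)\<^sup>2))"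
    by (intro dyadic_mean_mono order_trans[OF abs_le_square[OF \<eta>]]) simp
  also have "\<dots> = \<eta> + 4 / \<eta> * (S (Suc t) - S t)"
    unfolding dyadic_mean_add dyadic_mean_const dyadic_mean_cmult[of _ "4 / \<eta>"] step[OF t(1)] j_def ..
  also have "\<dots> \<le> \<eta> + 4 / \<eta> * (A\<^sup>2 / real L)" using t(2) \<eta> by (intro add_left_mono mult_left_mono) auto
  also have "4 / \<eta> * (A\<^sup>2 / real L) \<le> \<eta>"
    using L \<eta> L0 by (simp add: field_simps power2_eq_square)
  finally have "dyadic_mean j (\<lambda>i. \<bar>d j i\<bar>) \<le> 2 * \<eta>" by simp
  moreover have "sqrt 2 ^ j * x \<le> 1" "sqrt 2 ^ Suc j * x \<le> 1"
    using order_trans[OF sc(2)[OF j(1)] \<kappa>(2)] order_trans[OF sc(2)[OF j(2)] \<kappa>(2)] by auto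
  ultimately show ?thesis
    using errj[OF j(1)] errj[OF j(2)] x_pos x_le \<kappa> aN j unfolding d_def
    by (intro exI[of _ N] exI[of _ x] exI[of _ j]) auto
qed

text \<open>\<open>rigidity\<close> is averaged over the blocks of a level. The defects are small in
  the mean but not on every block, so the conclusion is a mean as well.\<close>

lemma small_scale:
  assumes \<epsilon>: "0 < \<epsilon>" and x0: "0 < x0"
  shows "\<exists>N x j. 1 \<le> j \<and> j \<le> N \<and> 0 < x \<and> x \<le> x0 \<and> x \<le> 1 \<and> dyadic_mean j (\<lambda>i. \<bar>block_var x N j i - 1\<bar>) \<le> \<epsilon>"
proof -
  obtain K where K: "0 \<le> K" "\<And>m1 m2 v1 v2. m1 \<in> {-R\<^sub>0..R\<^sub>0} \<Longrightarrow> m2 \<in> {-R\<^sub>0..R\<^sub>0} \<Longrightarrow> v1 \<in> {0..A} \<Longrightarrow> v2 \<in> {0..A} \<Longrightarrow>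
    \<bar>(v1 + v2) / 2 - 1\<bar> \<le> \<epsilon> / 2 + K * (\<bar>G v1 m1 - G 1 0\<bar> + \<bar>G v2 m2 - G 1 0\<bar>
      + \<bar>G ((v1 + v2) / 2) ((m1 + m2) / sqrt 2) - G 1 0\<bar> + \<bar>v1 - v2\<bar>)"
    using rigidity[of "\<epsilon> / 2" R\<^sub>0 A] \<epsilon> by auto
  \<comment> \<open>The defects add up to \<open>5 * \<eta>\<close> in the mean: two from the
    halves, one from the block itself and two from the difference of the halves.\<close>
  define \<eta> where "\<eta> = \<epsilon> / (10 * (K + 1))"
  have \<eta>: "0 < \<eta>" using \<epsilon> K(1) by (simp add: \<eta>_def)
  obtain N x j where *: "1 \<le> j" "Suc j \<le> N" "0 < x" "x \<le> x0" "x \<le> 1" "sqrt 2 ^ j * x \<le> 1" "sqrt 2 ^ Suc j * x \<le> 1"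
    "dyadic_mean j (curve_error x N j) \<le> \<eta>" "dyadic_mean (Suc j) (curve_error x N (Suc j)) \<le> \<eta>"
    "dyadic_mean j (\<lambda>i. \<bar>block_var x N (Suc j) (2 * i) - block_var x N (Suc j) (2 * i + 1)\<bar>) \<le> 2 * \<eta>"
    using small_scale_aux[OF \<eta> x0] by blast
  have jN: "j < N" using *(2) by simp
  let ?d = "\<lambda>i. \<bar>block_var x N (Suc j) (2 * i) - block_var x N (Suc j) (2 * i + 1)\<bar>"
  let ?e = "\<lambda>i. curve_error x N (Suc j) (2 * i) + curve_error x N (Suc j) (2 * i + 1)"
  have "dyadic_mean j (\<lambda>i. \<bar>block_var x N j i - 1\<bar>) \<le> dyadic_mean j (\<lambda>i. \<epsilon> / 2 + K * ((?e i + curve_error x N j i) + ?d i))"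
  proof (rule dyadic_mean_mono)
    fix i :: nat assume i: "i < 2 ^ j"
    have i2: "2 * i < 2 ^ Suc j" "2 * i + 1 < 2 ^ Suc j" using i by auto
    have v: "block_var x N (Suc j) (2 * i) \<in> {0..A}" "block_var x N (Suc j) (2 * i + 1) \<in> {0..A}"
      using block_var_bound[OF *(2) i2(1) A _ *(7)] block_var_bound[OF *(2) i2(2) A _ *(7)] *(3) by auto
    have m: "mu (Suc j) (2 * i) \<in> {-R\<^sub>0..R\<^sub>0}" "mu (Suc j) (2 * i + 1) \<in> {-R\<^sub>0..R\<^sub>0}"
      using mu_bound[OF i2(1)] mu_bound[OF i2(2)] by (auto simp: abs_le_iff)
    show "\<bar>block_var x N j i - 1\<bar> \<le> \<epsilon> / 2 + K * ((?e i + curve_error x N j i) + ?d i)"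
      using K(2)[OF m v] unfolding curve_error_def[OF A A1] block_var_halves[OF jN] mu_halves[OF i] .
  qed
  also have "\<dots> = \<epsilon> / 2 + K * ((2 * dyadic_mean (Suc j) (curve_error x N (Suc j)) + dyadic_mean j (curve_error x N j)) + dyadic_mean j ?d)"
    unfolding dyadic_mean_add dyadic_mean_const dyadic_mean_cmult dyadic_mean_add[of _ "\<lambda>i. ?e i + curve_error x N j i"] dyadic_mean_add[of _ ?e] dyadic_mean_halves[of j "curve_error x N (Suc j)", symmetric] ..
  also have "\<dots> \<le> \<epsilon> / 2 + K * ((2 * \<eta> + \<eta>) + 2 * \<eta>)"
    using * K(1) by (intro add_left_mono mult_left_mono add_mono) auto
  also have "\<dots> = \<epsilon> / 2 + 5 * (K * \<eta>)" by simp
  also have "K * \<eta> = K / (K + 1) * (\<epsilon> / 10)" by (simp add: \<eta>_def)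
  also have "\<epsilon> / 2 + 5 * (K / (K + 1) * (\<epsilon> / 10)) \<le> \<epsilon> / 2 + 5 * (1 * (\<epsilon> / 10))"
    using K(1) \<epsilon> by (intro add_left_mono mult_left_mono mult_right_mono) auto
  finally have "dyadic_mean j (\<lambda>i. \<bar>block_var x N j i - 1\<bar>) \<le> \<epsilon>" by simp
  then show ?thesis using * jN by (intro exI[of _ N] exI[of _ x] exI[of _ j]) auto
qed

end

text \<open>A mean deviation over the blocks controls the sum over any initial run of them. The run
  covering half the interval and the full run together also determine the variance of the second
  half.\<close>

lemma variance_halves:
  assumes \<epsilon>: "0 < \<epsilon>" and x0: "0 < x0"
  shows "\<exists>N x. 1 \<le> N \<and> 0 < x \<and> x \<le> x0 \<and> x \<le> 1 \<and> \<bar>(\<Sum>k<2 ^ (N - 1). trunc_var x N k) - 1 / 2\<bar> \<le> \<epsilon> \<and>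
    \<bar>(\<Sum>k<2 ^ N. trunc_var x N k) - 1\<bar> \<le> \<epsilon>"
proof -
  obtain A where A: "1 \<le> A" "incr_bound A"
    using energy_increments by blast
  obtain N x j where *: "1 \<le> j" "j \<le> N" "0 < x" "x \<le> x0" "x \<le> 1" "dyadic_mean j (\<lambda>i. \<bar>block_var x N j i - 1\<bar>) \<le> \<epsilon>"
    using small_scale[OF A(2,1) \<epsilon> x0] by blast
  have part: "\<bar>(\<Sum>k<n * 2 ^ (N - j). trunc_var x N k) - real n / 2 ^ j\<bar> \<le> \<epsilon>" if "n \<le> 2 ^ j" for n
  proof -
    have "(\<Sum>k<n * 2 ^ (N - j). trunc_var x N k) = (\<Sum>i<n. 1 / 2 ^ j * block_var x N j i)"
      unfolding sum_blocks[symmetric] block_var_def by simp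
    then have "(\<Sum>k<n * 2 ^ (N - j). trunc_var x N k) - real n / 2 ^ j = (\<Sum>i<n. 1 / 2 ^ j * (block_var x N j i - 1))"
      by (simp add: right_diff_distrib sum_subtractf diff_divide_distrib)
    also have "\<bar>\<dots>\<bar> \<le> (\<Sum>i<n. \<bar>1 / 2 ^ j * (block_var x N j i - 1)\<bar>)" by (rule sum_abs)
    also have "\<dots> \<le> (\<Sum>i<2 ^ j. \<bar>1 / 2 ^ j * (block_var x N j i - 1)\<bar>)" using that by (intro sum_mono2) auto
    also have "\<dots> = dyadic_mean j (\<lambda>i. \<bar>block_var x N j i - 1\<bar>)" by (simp add: dyadic_mean_def abs_mult sum_divide_distrib)
    finally show ?thesis using *(6) by linarith
  qed
  obtain i where i: "j = Suc i" using *(1) by (cases j) auto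
  have "(2::nat) ^ i * 2 ^ (N - j) = 2 ^ (N - 1)" using *(2) i by (simp add: power_add[symmetric])
  then have h1: "\<bar>(\<Sum>k<2 ^ (N - 1). trunc_var x N k) - 1 / 2\<bar> \<le> \<epsilon>"
    using part[of "2 ^ i"] i by simp
  have "(2::nat) ^ j * 2 ^ (N - j) = 2 ^ N" using *(2) by (simp add: power_add[symmetric])
  then have h2: "\<bar>(\<Sum>k<2 ^ N. trunc_var x N k) - 1\<bar> \<le> \<epsilon>" using part[of "2 ^ j"] by simp
  show ?thesis using h1 h2 * by (intro exI[of _ N] exI[of _ x]) auto
qed

text \<open>The second half provides the variance \<open>1 / 4\<close> that frees \<open>c\<close>
  from \<open>l\<close>, so the gain is read off the first half only. With \<open>l \<le> 1\<close>
  and a total of at most \<open>2\<close>, all variances stay within \<open>3\<close>.\<close>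

lemma gain:
  assumes C: "smooth_const l 3 C" and l: "0 < l" "l \<le> 1" and x: "0 \<le> x" and N: "1 \<le> N"
    and c: "lower_const (1 / 4) 3 (2 * (1 + H\<^sub>0 / f 1)) c"
    and V: "(\<Sum>k<2 ^ N. trunc_var x N k) \<le> 2" "1 / 4 \<le> (\<Sum>k\<in>{2 ^ (N - 1)..<2 ^ N}. trunc_var x N k)"
  shows "G (l + (\<Sum>k<2 ^ N. trunc_var x N k)) (mu 0 0) - 2 * C * (1 + H\<^sub>0) * x * (\<Sum>k<2 ^ N. trunc_var x N k)
      + c / 2 * (\<Sum>k<2 ^ (N - 1). expectation (\<lambda>\<omega>. Q (incr N k \<omega>) * far x (incr N k \<omega>)))
    \<le> expectation (\<lambda>\<omega>. G l (Z 0 0 \<omega>))"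
proof -
  interpret W: walk f p D M "dyadic_path N 0 0" "2 ^ (N - 0)" "mu 0 0" H\<^sub>0
    by (rule dyadic_walk) auto
  have xi: "W.\<xi> k \<omega> = incr N k \<omega>" if "k < 2 ^ N" for k \<omega>
    using dyadic_increment[of 0 N 0 k \<omega>] that by simp
  have q: "W.q x k = trunc_var x N k" if "k < 2 ^ N" for k
    using dyadic_q[of 0 N 0 k x] that by simp
  have s1: "(\<Sum>k<2 ^ N. W.q x k) = (\<Sum>k<2 ^ N. trunc_var x N k)" by (simp add: q)
  have s2: "(\<Sum>k\<in>{2 ^ (N - 1)..<2 ^ N}. W.q x k) = (\<Sum>k\<in>{2 ^ (N - 1)..<2 ^ N}. trunc_var x N k)" by (simp add: q)
  have le: "(2::nat) ^ (N - 1) \<le> 2 ^ N" by (intro power_increasing) auto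
  have s3: "(\<Sum>k<2 ^ (N - 1). expectation (\<lambda>\<omega>. Q (W.\<xi> k \<omega>) * far x (W.\<xi> k \<omega>)))
      = (\<Sum>k<2 ^ (N - 1). expectation (\<lambda>\<omega>. Q (incr N k \<omega>) * far x (incr N k \<omega>)))"
  proof (intro sum.cong refl)
    fix k assume "k \<in> {..<(2::nat) ^ (N - 1)}"
    then have "k < 2 ^ (N - 1)" by simp
    then have "k < 2 ^ N" using le by (rule less_le_trans)
    then show "expectation (\<lambda>\<omega>. Q (W.\<xi> k \<omega>) * far x (W.\<xi> k \<omega>)) = expectation (\<lambda>\<omega>. Q (incr N k \<omega>) * far x (incr N k \<omega>))"
      by (simp only: xi)
  qed
  have e: "dyadic_path N 0 0 (2 ^ N) \<omega> = Z 0 0 \<omega>" for \<omega> using dyadic_end[of 0 N 0 \<omega>] by simp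
  have a: "l + (\<Sum>k<2 ^ (N - 0). W.q x k) \<le> 3" using s1 V(1) l by simp
  show ?thesis
    using W.lindeberg_gain[OF C l(1) order_refl x a _ _ c, of "2 ^ (N - 1)"] V(2) le s1 s2 s3 by (simp add: e)
qed

end

subsection \<open>Characteristic functions of the increments\<close>

lemma exp_minus_lipschitz:
  fixes a b :: real assumes "0 \<le> a" "0 \<le> b"
  shows "\<bar>exp (- a) - exp (- b)\<bar> \<le> \<bar>a - b\<bar>"
proof -
  have *: "exp (- a) - exp (- b) \<le> b - a" if "0 \<le> a" "a \<le> b" for a b :: real
  proof -
    have "1 - exp (a - b) \<le> b - a" using exp_ge_add_one_self[of "a - b"] by linarith
    then have "exp (- a) * (1 - exp (a - b)) \<le> 1 * (b - a)" using that by (intro mult_mono) auto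
    then show ?thesis by (simp add: right_diff_distrib exp_add[symmetric])
  qed
  have **: "exp (- b) \<le> exp (- a)" if "a \<le> b" for a b :: real using that by simp
  show ?thesis using *[of a b] *[of b a] **[of a b] **[of b a] assms by (cases "a \<le> b") auto
qed

lemma exp_minus_taylor: fixes t :: real assumes "0 \<le> t" shows "\<bar>exp (- t) - (1 - t)\<bar> \<le> t\<^sup>2"
proof -
  have l: "1 - t \<le> exp (- t)" using exp_ge_add_one_self[of "- t"] by simp
  have "exp (- t) * (1 + t) \<le> exp (- t) * exp t" using exp_ge_add_one_self[of t] by (intro mult_left_mono) auto
  then have "exp (- t) * (1 + t) \<le> 1" by (simp add: exp_add[symmetric])
  then have "exp (- t) \<le> 1 / (1 + t)" using assms by (simp add: pos_le_divide_eq)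
  also have "\<dots> \<le> 1 - t + t\<^sup>2"
  proof -
    have "1 \<le> (1 - t + t\<^sup>2) * (1 + t)" using assms by (simp add: algebra_simps power2_eq_square)
    then show ?thesis using assms by (simp add: pos_divide_le_eq)
  qed
  finally show ?thesis using l by (simp add: abs_le_iff)
qed

lemma nonpos_of_le_small:
  fixes a K :: real assumes "0 \<le> K" "\<And>\<epsilon>. 0 < \<epsilon> \<Longrightarrow> \<epsilon> \<le> 1 \<Longrightarrow> a \<le> K * \<epsilon>" shows "a \<le> 0"
proof (rule ccontr)
  assume a: "\<not> a \<le> 0"
  define \<epsilon> where "\<epsilon> = min 1 (a / (2 * (K + 1)))"
  have \<epsilon>: "0 < \<epsilon>" "\<epsilon> \<le> 1" using a assms(1) by (auto simp: \<epsilon>_def)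
  have "a \<le> K * \<epsilon>" by (rule assms(2)[OF \<epsilon>])
  also have "\<dots> \<le> K * (a / (2 * (K + 1)))" using assms(1) by (intro mult_left_mono) (auto simp: \<epsilon>_def)
  also have "\<dots> = K / (K + 1) * (a / 2)" by simp
  also have "\<dots> \<le> 1 * (a / 2)" using assms(1) a by (intro mult_right_mono) auto
  finally show False using a by simp
qed

lemma norm_diff_triangle_middle: "norm (a - c) \<le> norm (a - b) + norm (b - c)" for a b c :: complex
  using norm_triangle_ineq[of "a - b" "b - c"] by simp

context process
begin

text \<open>The energy of the whole interval is exactly \<open>G 1 0\<close>, while its truncated variance alone already
  accounts for almost all of it, so nothing is left for the large increments.\<close>

lemma tails:
  assumes \<epsilon>: "0 < \<epsilon>"
  shows "\<exists>N x. 1 \<le> N \<and> 0 < x \<and> x \<le> \<epsilon> \<and> x \<le> 1 \<and> \<bar>(\<Sum>k<2 ^ (N - 1). trunc_var x N k) - 1 / 2\<bar> \<le> \<epsilon> \<and>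
    (\<Sum>k<2 ^ (N - 1). expectation (\<lambda>\<omega>. Q (incr N k \<omega>) * far x (incr N k \<omega>))) \<le> \<epsilon>"
proof -
  obtain c where c: "lower_const (1 / 4) 3 (2 * (1 + H\<^sub>0 / f 1)) c"
    using B_lower[of "1 / 4" 3 "2 * (1 + H\<^sub>0 / f 1)"] by (auto simp: lower_const_def)
  have c0: "0 < c" using c by (simp add: lower_const_def)
  \<comment> \<open>Three errors of size \<open>\<theta>\<close> arise, from the smoothing, from the
    deviation of the variance and from the swap; \<open>3 * \<theta>\<close> is
    \<open>c / 2 * \<epsilon>\<close>.\<close>
  define \<theta> where "\<theta> = c * \<epsilon> / 6"
  have \<theta>: "0 < \<theta>" using c0 \<epsilon> by (simp add: \<theta>_def)
  define b where "b = (4 * D + G 1 0) * (1 + G 1 0)"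
  have b: "0 \<le> b" using D by (simp add: b_def)
  define l where "l = min (1 / 2) (\<theta> / (b + 1))"
  have l: "0 < l" "l \<le> 1 / 2" using \<theta> b unfolding l_def by (simp, intro min.cobounded1)
  have bl: "b * l \<le> \<theta>"
  proof -
    have "b * l \<le> b * (\<theta> / (b + 1))" using b by (intro mult_left_mono) (auto simp: l_def)
    also have "\<dots> = b / (b + 1) * \<theta>" by simp
    also have "\<dots> \<le> 1 * \<theta>" using b \<theta> by (intro mult_right_mono) auto
    finally show ?thesis by simp
  qed
  have l2: "0 < l\<^sup>2" "l\<^sup>2 \<le> 1" using l by (auto simp: power_le_one)
  obtain C where C: "smooth_const (l\<^sup>2) 3 C" using smooth_const_exists[of "l\<^sup>2" 3] l by auto
  have C0: "0 \<le> C" using C by (simp add: smooth_const_def)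
  define b' where "b' = 4 * C * (1 + H\<^sub>0)"
  have b': "0 \<le> b'" using C0 H0_nonneg by (simp add: b'_def)
  define x0 where "x0 = min \<epsilon> (\<theta> / (b' + 1))"
  have x0: "0 < x0" using \<epsilon> \<theta> b' by (simp add: x0_def)
  obtain d where d: "0 < d" "\<And>v. 0 \<le> v \<Longrightarrow> \<bar>v - 1\<bar> < d \<Longrightarrow> \<bar>G v 0 - G 1 0\<bar> < \<theta>"
  proof -
    have "continuous_on {0..} (\<lambda>v. case (0, v) of (x, v) \<Rightarrow> G v x)"
      by (rule continuous_on_compose2[OF continuous_G]) (auto intro!: continuous_intros)
    then have "continuous_on {0..} (\<lambda>v. G v 0)" by simp
    from this[unfolded continuous_on_iff, rule_format, of 1 \<theta>] \<theta> that show thesis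
      by (auto simp: dist_real_def)
  qed
  \<comment> \<open>With \<open>1 / 8\<close> the second half keeps variance at least
    \<open>(1 - 1 / 8) - (1 / 2 + 1 / 8) = 1 / 4\<close>.\<close>
  define \<epsilon>' where "\<epsilon>' = min (min (\<epsilon> / 2) (d / 2)) (1 / 8)"
  have \<epsilon>': "0 < \<epsilon>'" "\<epsilon>' \<le> \<epsilon>" "\<epsilon>' < d" "\<epsilon>' \<le> 1 / 8" using \<epsilon> d(1) by (auto simp: \<epsilon>'_def)
  obtain N x where N: "1 \<le> N" and x: "0 < x" "x \<le> x0" "x \<le> 1"
    and V1: "\<bar>(\<Sum>k<2 ^ (N - 1). trunc_var x N k) - 1 / 2\<bar> \<le> \<epsilon>'" and V: "\<bar>(\<Sum>k<2 ^ N. trunc_var x N k) - 1\<bar> \<le> \<epsilon>'"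
    using variance_halves[OF \<epsilon>'(1) x0] by blast
  let ?V = "\<Sum>k<2 ^ N. trunc_var x N k" and ?T = "\<Sum>k<2 ^ (N - 1). expectation (\<lambda>\<omega>. Q (incr N k \<omega>) * far x (incr N k \<omega>))"
  have "(2::nat) ^ (N - 1) \<le> 2 ^ N" by (intro power_increasing) auto
  then have "(\<Sum>k<2 ^ (N - 1). trunc_var x N k) + (\<Sum>k\<in>{2 ^ (N - 1)..<2 ^ N}. trunc_var x N k) = ?V"
    unfolding lessThan_atLeast0 by (intro sum.atLeastLessThan_concat) auto
  then have V2: "1 / 4 \<le> (\<Sum>k\<in>{2 ^ (N - 1)..<2 ^ N}. trunc_var x N k)" using V1 V \<epsilon>'(4) unfolding abs_le_iff by linarith
  have Vle: "?V \<le> 2" "0 \<le> ?V" using V \<epsilon>'(4) unfolding abs_le_iff by linarith+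
  have g: "G (l\<^sup>2 + ?V) (mu 0 0) - 2 * C * (1 + H\<^sub>0) * x * ?V + c / 2 * ?T \<le> expectation (\<lambda>\<omega>. G (l\<^sup>2) (Z 0 0 \<omega>))"
    by (rule gain[OF C l2 less_imp_le[OF x(1)] N c Vle(1) V2])
  have z0: "(0::nat) < 2 ^ 0" by simp
  note Z = Z_energy[OF z0]
  have iG: "integrable M (\<lambda>\<omega>. G (l\<^sup>2) (Z 0 0 \<omega>))"
    using dyadic_int_G[of 0 0 0 "l\<^sup>2" 3 C] C l2 by simp
  have "expectation (\<lambda>\<omega>. G (l\<^sup>2) (Z 0 0 \<omega>)) \<le> expectation (\<lambda>\<omega>. f (Z 0 0 \<omega>) + (4 * D + G 1 0) * l * (1 + f (Z 0 0 \<omega>)))"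
    using Z(1) by (intro integral_mono iG G_small l) auto
  also have "\<dots> = G 1 0 + b * l" using Z by (simp add: prob_space b_def)
  finally have E: "expectation (\<lambda>\<omega>. G (l\<^sup>2) (Z 0 0 \<omega>)) \<le> G 1 0 + \<theta>" using bl by linarith
  \<comment> \<open>The drift of the whole interval is still unknown, but drift and extra smoothing
    can only raise the Gaussian energy.\<close>
  have "G ?V 0 \<le> G (l\<^sup>2 + ?V) 0" using Vle l2 by (intro G_var_mono) auto
  also have "\<dots> \<le> G (l\<^sup>2 + ?V) (mu 0 0)" using Vle l2 by (intro G_zero_le) auto
  finally have g1: "G 1 0 - \<theta> \<le> G (l\<^sup>2 + ?V) (mu 0 0)"
    using d(2)[OF Vle(2)] V \<epsilon>'(3) by linarith
  have g2: "2 * C * (1 + H\<^sub>0) * x * ?V \<le> \<theta>"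
  proof -
    have "2 * C * (1 + H\<^sub>0) * x * ?V \<le> 2 * C * (1 + H\<^sub>0) * x * 2"
      using C0 H0_nonneg x Vle by (intro mult_left_mono) auto
    also have "\<dots> = b' * x" by (simp add: b'_def)
    also have "\<dots> \<le> b' * (\<theta> / (b' + 1))" using b' x(2) by (intro mult_left_mono) (auto simp: x0_def)
    also have "\<dots> = b' / (b' + 1) * \<theta>" by simp
    also have "\<dots> \<le> 1 * \<theta>" using b' \<theta> by (intro mult_right_mono) auto
    finally show ?thesis by simp
  qed
  have "c / 2 * ?T \<le> 3 * \<theta>" using g E g1 g2 by linarith
  also have "\<dots> = c / 2 * \<epsilon>" by (simp add: \<theta>_def)
  finally have "?T \<le> \<epsilon>" using c0 by simp
  moreover have "x \<le> \<epsilon>" using x(2) by (simp add: x0_def)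
  ultimately show ?thesis using N x V1 \<epsilon>'(2) by (intro exI[of _ N] exI[of _ x]) auto
qed

text \<open>On near values the exponential is expanded to second order, with a cubic error of at
  most a factor \<open>x\<close> times the square. On far values the quadratic term is truncated
  away and the remainder is bounded by \<open>Q\<close>. The term with \<open>t ^ 4\<close> comes
  from replacing the quadratic polynomial by an exponential.\<close>

lemma char_increment_estimate:
  assumes k: "k < 2 ^ N" and x: "0 \<le> x" "x \<le> 1"
  shows "cmod (char (distr M borel (incr N k)) t - of_real (exp (- (t\<^sup>2 * trunc_var x N k / 2))))
    \<le> (\<bar>t\<bar> ^ 3 + t ^ 4) * x * trunc_var x N k + (t\<^sup>2 / 2 + 2 * \<bar>t\<bar> / f 1) * expectation (\<lambda>\<omega>. Q (incr N k \<omega>) * far x (incr N k \<omega>))"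
proof -
  note [measurable] = incr_int(1)[OF k]
  let ?Y = "incr N k" and ?q = "trunc_var x N k" and ?c = "t\<^sup>2 / 2 + 2 * \<bar>t\<bar> / f 1"
  have k0: "k < 2 ^ (N - 0)" using k by simp
  interpret W: walk f p D M "dyadic_path N 0 0" "2 ^ (N - 0)" "mu 0 0" H\<^sub>0
    by (rule dyadic_walk) auto
  have xi: "W.\<xi> k \<omega> = ?Y \<omega>" for \<omega>
    using dyadic_increment[of 0 N 0 k \<omega>] k by simp
  have mean: "integrable M ?Y" "expectation ?Y = 0"
    using W.xi_mean[OF k0] by (simp_all add: xi[abs_def])
  have q: "integrable M (\<lambda>\<omega>. (?Y \<omega>)\<^sup>2 * near x (?Y \<omega>))" "0 \<le> ?q" "?q \<le> x\<^sup>2"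
    using W.q_bounds[OF x(1) k0] unfolding W.q_def xi trunc_var_def by auto
  have iT: "integrable M (\<lambda>\<omega>. Q (?Y \<omega>) * far x (?Y \<omega>))"
    by (rule Bochner_Integration.integrable_bound[OF incr_int(3)[OF k]]) (auto simp: far_def)
  have c0: "0 \<le> ?c" by simp
  let ?h = "\<lambda>\<omega>. iexp (t * ?Y \<omega>) - 1 - \<i> * of_real (t * ?Y \<omega>) + of_real (t\<^sup>2 / 2 * ((?Y \<omega>)\<^sup>2 * near x (?Y \<omega>)))"
  have ie: "integrable M (\<lambda>\<omega>. iexp (t * ?Y \<omega>))"
    by (rule integrable_const_bound[where B = 1]) auto
  have i1: "integrable M (\<lambda>\<omega>. \<i> * of_real (t * ?Y \<omega>))"
    using mean(1) by (intro integrable_mult_right integrable_of_real) auto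
  have i2: "integrable M (\<lambda>\<omega>. complex_of_real (t\<^sup>2 / 2 * ((?Y \<omega>)\<^sup>2 * near x (?Y \<omega>))))"
    using q(1) by (intro integrable_of_real integrable_mult_right)
  have ih: "integrable M ?h" using ie i1 i2 by (intro Bochner_Integration.integrable_add Bochner_Integration.integrable_diff) auto
  have e1: "(CLINT \<omega>|M. \<i> * of_real (t * ?Y \<omega>)) = 0" using mean by simp
  have e2: "(CLINT \<omega>|M. complex_of_real (t\<^sup>2 / 2 * ((?Y \<omega>)\<^sup>2 * near x (?Y \<omega>)))) = of_real (t\<^sup>2 * ?q / 2)"
    unfolding integral_complex_of_real by (simp add: trunc_var_def)
  have eh: "(CLINT \<omega>|M. ?h \<omega>) = char (distr M borel ?Y) t - of_real (1 - t\<^sup>2 * ?q / 2)"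
  proof -
    define h1 where "h1 \<omega> = \<i> * complex_of_real (t * ?Y \<omega>)" for \<omega>
    define h2 where "h2 \<omega> = complex_of_real (t\<^sup>2 / 2 * ((?Y \<omega>)\<^sup>2 * near x (?Y \<omega>)))" for \<omega>
    define h0 where "h0 \<omega> = iexp (t * ?Y \<omega>)" for \<omega>
    have d: "complex_integrable M h0" "complex_integrable M h1" "complex_integrable M h2"
      "(CLINT \<omega>|M. h1 \<omega>) = 0" "(CLINT \<omega>|M. h2 \<omega>) = of_real (t\<^sup>2 * ?q / 2)"
      using ie i1 i2 e1 e2 by (simp_all only: h0_def[abs_def] h1_def[abs_def] h2_def[abs_def])
    have "char (distr M borel ?Y) t = (CLINT \<omega>|M. h0 \<omega>)"
      unfolding h0_def char_def by (subst integral_distr) auto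
    moreover have "(CLINT \<omega>|M. h0 \<omega> - 1 - h1 \<omega> + h2 \<omega>) = (CLINT \<omega>|M. h0 \<omega>) - 1 - 0 + of_real (t\<^sup>2 * ?q / 2)"
      using d by (simp add: prob_space Bochner_Integration.integrable_diff)
    ultimately show ?thesis unfolding h0_def h1_def h2_def by simp
  qed
  have bound: "cmod (?h \<omega>) \<le> \<bar>t\<bar> ^ 3 * x * ((?Y \<omega>)\<^sup>2 * near x (?Y \<omega>)) + ?c * (Q (?Y \<omega>) * far x (?Y \<omega>))" for \<omega>
  proof (cases "\<bar>?Y \<omega>\<bar> \<le> x")
    case True
    let ?y = "t * ?Y \<omega>"
    have h: "?h \<omega> = iexp ?y - (\<Sum>k\<le>2. (\<i> * ?y) ^ k / fact k)"
      using True by (simp add: near_def eval_nat_numeral power_mult_distrib algebra_simps)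
    have "cmod (?h \<omega>) \<le> \<bar>?y\<bar> ^ Suc 2 / fact (Suc 2)" unfolding h by (rule iexp_approx1)
    also have "\<dots> \<le> \<bar>?y\<bar> ^ Suc 2 / 1"
      by (intro divide_left_mono fact_ge_1 zero_le_power) simp_all
    also have "\<dots> = \<bar>?y\<bar> ^ 3" by (simp only: Suc_numeral div_by_1) simp
    also have "\<dots> = \<bar>t\<bar> ^ 3 * (\<bar>?Y \<omega>\<bar> * (?Y \<omega>)\<^sup>2)"
    proof -
      have "\<bar>?Y \<omega>\<bar> ^ 3 = \<bar>?Y \<omega>\<bar> * (?Y \<omega>)\<^sup>2"
        by (simp add: power3_eq_cube power2_eq_square mult.assoc)
      then show ?thesis by (simp only: abs_mult power_mult_distrib)
    qed
    also have "\<dots> \<le> \<bar>t\<bar> ^ 3 * (x * (?Y \<omega>)\<^sup>2)" using True by (intro mult_left_mono mult_right_mono) auto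
    finally show ?thesis using True by (simp add: near_def far_def mult.assoc)
  next
    case False
    let ?y = "t * ?Y \<omega>"
    have h: "?h \<omega> = iexp ?y - (\<Sum>k\<le>1. (\<i> * ?y) ^ k / fact k)"
      using False by (simp add: near_def)
    have "cmod (?h \<omega>) \<le> \<bar>?y\<bar> ^ Suc 1 / fact (Suc 1)" unfolding h by (rule iexp_approx1)
    also have "\<dots> = t\<^sup>2 / 2 * (?Y \<omega>)\<^sup>2" by (simp add: power_mult_distrib flip: power2_eq_square)
    finally have a1: "cmod (?h \<omega>) \<le> t\<^sup>2 / 2 * (?Y \<omega>)\<^sup>2" .
    have "cmod (?h \<omega>) \<le> 2 * \<bar>?y\<bar> ^ 1 / fact 1" unfolding h by (rule iexp_approx2)
    then have a2: "cmod (?h \<omega>) \<le> 2 * \<bar>t\<bar> * \<bar>?Y \<omega>\<bar>" by (simp only: power_one_right abs_mult fact_1 div_by_1 mult.assoc)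
    \<comment> \<open>\<open>Q\<close> is quadratic up to modulus \<open>1\<close> and at least
      linear beyond, which matches the two remainder bounds.\<close>
    have "cmod (?h \<omega>) \<le> ?c * Q (?Y \<omega>)"
    proof (cases "\<bar>?Y \<omega>\<bar> \<le> 1")
      case True
      have "t\<^sup>2 / 2 * (?Y \<omega>)\<^sup>2 \<le> ?c * (?Y \<omega>)\<^sup>2" by (intro mult_right_mono) auto
      then show ?thesis using a1 True by (simp add: Q_def)
    next
      case F: False
      then have "f 1 * \<bar>?Y \<omega>\<bar> \<le> f (?Y \<omega>)" by (intro f_ge_linear) simp
      then have "\<bar>?Y \<omega>\<bar> \<le> f (?Y \<omega>) / f 1" using pos[of 1] by (simp add: pos_le_divide_eq mult.commute)
      then have "2 * \<bar>t\<bar> * \<bar>?Y \<omega>\<bar> \<le> 2 * \<bar>t\<bar> * (f (?Y \<omega>) / f 1)" by (intro mult_left_mono) auto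
      also have "\<dots> = 2 * \<bar>t\<bar> / f 1 * f (?Y \<omega>)" by simp
      also have "\<dots> \<le> ?c * f (?Y \<omega>)" by (intro mult_right_mono) auto
      finally show ?thesis using a2 F by (simp add: Q_def)
    qed
    then show ?thesis using False by (simp add: near_def far_def)
  qed
  have "cmod (char (distr M borel ?Y) t - of_real (1 - t\<^sup>2 * ?q / 2)) \<le> (\<integral>\<omega>. cmod (?h \<omega>) \<partial>M)"
    unfolding eh[symmetric] by (rule integral_norm_bound)
  also have "\<dots> \<le> expectation (\<lambda>\<omega>. \<bar>t\<bar> ^ 3 * x * ((?Y \<omega>)\<^sup>2 * near x (?Y \<omega>)) + ?c * (Q (?Y \<omega>) * far x (?Y \<omega>)))"
    using ih q(1) iT by (intro integral_mono bound) auto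
  also have "\<dots> = \<bar>t\<bar> ^ 3 * x * ?q + ?c * expectation (\<lambda>\<omega>. Q (?Y \<omega>) * far x (?Y \<omega>))"
    using q(1) iT by (simp add: trunc_var_def)
  finally have 1: "cmod (char (distr M borel ?Y) t - of_real (1 - t\<^sup>2 * ?q / 2))
    \<le> \<bar>t\<bar> ^ 3 * x * ?q + ?c * expectation (\<lambda>\<omega>. Q (?Y \<omega>) * far x (?Y \<omega>))" .
  have 2: "cmod (of_real (1 - t\<^sup>2 * ?q / 2) - of_real (exp (- (t\<^sup>2 * ?q / 2)))) \<le> t ^ 4 * x * ?q"
  proof -
    have "cmod (of_real (1 - t\<^sup>2 * ?q / 2) - of_real (exp (- (t\<^sup>2 * ?q / 2)))) = \<bar>exp (- (t\<^sup>2 * ?q / 2)) - (1 - t\<^sup>2 * ?q / 2)\<bar>"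
      unfolding of_real_diff[symmetric] norm_of_real by (rule abs_minus_commute)
    also have "\<dots> \<le> (t\<^sup>2 * ?q / 2)\<^sup>2" using q(2) by (intro exp_minus_taylor) auto
    also have "\<dots> = t ^ 4 * (?q * ?q) / 4" by (simp add: power2_eq_square eval_nat_numeral)
    also have "\<dots> \<le> t ^ 4 * (?q * ?q)" using q(2) by simp
    also have "\<dots> \<le> t ^ 4 * (x * ?q)"
    proof (intro mult_left_mono mult_right_mono q(2))
      have "x\<^sup>2 \<le> x" using x by (simp add: power2_eq_square mult_left_le_one_le)
      then show "?q \<le> x" using q(3) by linarith
    qed auto
    finally show ?thesis by (simp add: mult.assoc)
  qed
  have "cmod (char (distr M borel ?Y) t - of_real (exp (- (t\<^sup>2 * ?q / 2))))
    \<le> cmod (char (distr M borel ?Y) t - of_real (1 - t\<^sup>2 * ?q / 2)) + cmod (of_real (1 - t\<^sup>2 * ?q / 2) - of_real (exp (- (t\<^sup>2 * ?q / 2))))"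
    by (rule norm_diff_triangle_middle)
  also note add_mono[OF 1 2]
  finally show ?thesis by (simp add: distrib_right mult.assoc)
qed

lemma char_partial:
  assumes "n \<le> 2 ^ N"
  shows "char (distr M borel (U 0 (real n / 2 ^ N))) t = (\<Prod>k<n. char (distr M borel (incr N k)) t)"
  using assms
proof (induction n)
  case 0
  have "U 0 (real 0 / 2 ^ N) = (\<lambda>_. 0)" by (simp add: fun_eq_iff)
  then show ?case by (simp add: char_def integral_return)
next
  case (Suc n)
  have n: "real (Suc n) / 2 ^ N \<le> 1" "real n / 2 ^ N < real (Suc n) / 2 ^ N" 
    using dyadic_interval(4,5)[of n N] Suc.prems by auto
  have "U 0 (real (Suc n) / 2 ^ N) = (\<lambda>\<omega>. U 0 (real n / 2 ^ N) \<omega> + incr N n \<omega>)"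
    unfolding incr_def using n by (intro ext U_add) auto
  moreover have "indep_var borel (\<lambda>\<omega>. U 0 (real n / 2 ^ N) \<omega> / 1 + 0) borel (\<lambda>\<omega>. U (real n / 2 ^ N) (real (Suc n) / 2 ^ N) \<omega> / 1)"
    using n by (intro U_indep) auto
  then have "indep_var borel (U 0 (real n / 2 ^ N)) borel (incr N n)" by (simp add: incr_def)
  ultimately show ?case using Suc by (simp add: char_distr_add)
qed

text \<open>Products in the unit disc differ by at most the sum of the differences of their factors.
  That sum consists of the cut-off times the bounded total variance and of the tails, both of which
  \<open>tails\<close> makes small.\<close>

lemma char_half: "char (distr M borel (U 0 (1 / 2))) t = exp (- (t\<^sup>2 / 4))"
proof -
  define c where "c = t\<^sup>2 / 2 + 2 * \<bar>t\<bar> / f 1"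
  define K where "K = (\<bar>t\<bar> ^ 3 + t ^ 4) * 2 + c + t\<^sup>2 / 2"
  have c0: "0 \<le> c" by (simp add: c_def)
  have "cmod (char (distr M borel (U 0 (1 / 2))) t - of_real (exp (- (t\<^sup>2 / 4)))) \<le> K * \<epsilon>" if \<epsilon>: "0 < \<epsilon>" "\<epsilon> \<le> 1" for \<epsilon>
  proof -
    obtain N x where N: "1 \<le> N" and x: "0 < x" "x \<le> \<epsilon>" "x \<le> 1"
      and V: "\<bar>(\<Sum>k<2 ^ (N - 1). trunc_var x N k) - 1 / 2\<bar> \<le> \<epsilon>"
      and T: "(\<Sum>k<2 ^ (N - 1). expectation (\<lambda>\<omega>. Q (incr N k \<omega>) * far x (incr N k \<omega>))) \<le> \<epsilon>"
      using tails[OF \<epsilon>(1)] by blast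
    let ?n = "(2::nat) ^ (N - 1)" and ?\<phi> = "\<lambda>k. char (distr M borel (incr N k)) t"
    let ?V = "\<Sum>k<?n. trunc_var x N k"
    let ?g = "\<lambda>k. complex_of_real (exp (- (t\<^sup>2 * trunc_var x N k / 2)))"
    have n: "?n \<le> 2 ^ N" by (intro power_increasing) auto
    have kn: "k < 2 ^ N" if "k < ?n" for k using that n by (rule less_le_trans)
    have q0: "0 \<le> trunc_var x N k" for k
      unfolding trunc_var_def by (intro integral_nonneg_AE AE_I2 mult_nonneg_nonneg near_far_simps) auto
    have V0: "0 \<le> ?V" by (intro sum_nonneg q0)
    have Nn: "real ?n / 2 ^ N = 1 / 2" using N by (cases N) auto
    have "cmod ((\<Prod>k<?n. ?\<phi> k) - (\<Prod>k<?n. ?g k)) \<le> (\<Sum>k<?n. cmod (?\<phi> k - ?g k))"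
    proof (rule norm_prod_diff)
      fix k assume "k \<in> {..<?n}"
      then have "k < 2 ^ N" using kn by simp
      then have "real_distribution (distr M borel (incr N k))" by (intro real_distribution_distr incr_int)
      then show "cmod (?\<phi> k) \<le> 1" by (rule real_distribution.cmod_char_le_1)
      show "cmod (?g k) \<le> 1" using q0 by (simp del: of_real_exp)
    qed
    also have "\<dots> \<le> (\<Sum>k<?n. (\<bar>t\<bar> ^ 3 + t ^ 4) * x * trunc_var x N k + c * expectation (\<lambda>\<omega>. Q (incr N k \<omega>) * far x (incr N k \<omega>)))"
      unfolding c_def using kn x by (intro sum_mono char_increment_estimate) auto
    also have "\<dots> = (\<bar>t\<bar> ^ 3 + t ^ 4) * x * ?V + c * (\<Sum>k<?n. expectation (\<lambda>\<omega>. Q (incr N k \<omega>) * far x (incr N k \<omega>)))"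
      by (simp only: sum.distrib sum_distrib_left)
    also have "\<dots> \<le> (\<bar>t\<bar> ^ 3 + t ^ 4) * \<epsilon> * 2 + c * \<epsilon>"
      using x V \<epsilon> V0 T c0 by (intro add_mono mult_mono mult_left_mono) auto
    finally have 1: "cmod ((\<Prod>k<?n. ?\<phi> k) - (\<Prod>k<?n. ?g k)) \<le> (\<bar>t\<bar> ^ 3 + t ^ 4) * \<epsilon> * 2 + c * \<epsilon>" .
    have "(\<Prod>k<?n. ?g k) = of_real (exp (- (t\<^sup>2 * ?V / 2)))"
      unfolding of_real_prod[symmetric] exp_sum[symmetric, OF finite_lessThan]
      by (simp add: sum_negf sum_divide_distrib[symmetric] sum_distrib_left[symmetric])
    then have "cmod ((\<Prod>k<?n. ?g k) - of_real (exp (- (t\<^sup>2 / 4)))) = \<bar>exp (- (t\<^sup>2 * ?V / 2)) - exp (- (t\<^sup>2 / 4))\<bar>"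
      by (simp only: of_real_diff[symmetric] norm_of_real)
    also have "\<dots> \<le> \<bar>t\<^sup>2 * ?V / 2 - t\<^sup>2 / 4\<bar>" using V0 by (intro exp_minus_lipschitz) auto
    also have "t\<^sup>2 * ?V / 2 - t\<^sup>2 / 4 = t\<^sup>2 / 2 * (?V - 1 / 2)" by (simp add: algebra_simps)
    also have "\<bar>t\<^sup>2 / 2 * (?V - 1 / 2)\<bar> \<le> t\<^sup>2 / 2 * \<epsilon>" unfolding abs_mult using V by (intro mult_mono) auto
    finally have 2: "cmod ((\<Prod>k<?n. ?g k) - of_real (exp (- (t\<^sup>2 / 4)))) \<le> t\<^sup>2 / 2 * \<epsilon>" .
    have "cmod ((\<Prod>k<?n. ?\<phi> k) - of_real (exp (- (t\<^sup>2 / 4)))) \<le> cmod ((\<Prod>k<?n. ?\<phi> k) - (\<Prod>k<?n. ?g k)) + cmod ((\<Prod>k<?n. ?g k) - of_real (exp (- (t\<^sup>2 / 4))))"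
      by (rule norm_diff_triangle_middle)
    also note add_mono[OF 1 2]
    also have "(\<bar>t\<bar> ^ 3 + t ^ 4) * \<epsilon> * 2 + c * \<epsilon> + t\<^sup>2 / 2 * \<epsilon> = K * \<epsilon>" by (simp add: K_def algebra_simps)
    finally show ?thesis using char_partial[OF n, of t] unfolding Nn by simp
  qed
  then have "cmod (char (distr M borel (U 0 (1 / 2))) t - of_real (exp (- (t\<^sup>2 / 4)))) \<le> 0"
    using c0 by (intro nonpos_of_le_small[of K]) (auto simp: K_def)
  then show ?thesis by simp
qed

end

section \<open>From half an interval to all increments\<close>

lemma (in prob_space) char_distr_cmult:
  assumes "Y \<in> borel_measurable M"
  shows "char (distr M borel (\<lambda>\<omega>. c * Y \<omega>)) t = char (distr M borel Y) (t * c)"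
  using assms by (simp add: char_def integral_distr mult.assoc)

lemma (in prob_space) indep_var_commute: "indep_var S Y T Z \<Longrightarrow> indep_var T Z S Y"
proof -
  assume "indep_var S Y T Z"
  note h = this[unfolded indep_var_eq indep_sets2_eq]
  show "indep_var T Z S Y"
    unfolding indep_var_eq indep_sets2_eq
  proof (intro conjI ballI)
    fix a b assume "a \<in> sigma_sets (space M) {Z -` A \<inter> space M |A. A \<in> sets T}"
      "b \<in> sigma_sets (space M) {Y -` A \<inter> space M |A. A \<in> sets S}"
    then have "prob (b \<inter> a) = prob b * prob a" using h by blast
    then show "prob (a \<inter> b) = prob a * prob b" by (subst Int_commute, subst mult.commute)
  qed (use h in blast)+
qed

lemma (in prob_space) gaussian_of_char:
  assumes [measurable]: "Y \<in> borel_measurable M" and v: "0 \<le> v"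
    and ch: "\<And>t. char (distr M borel Y) t = exp (- (t\<^sup>2 * v / 2))"
  shows "gaussian_rv M Y" "integrable M Y" "expectation Y = 0" "integrable M (\<lambda>\<omega>. (Y \<omega>)\<^sup>2)" "expectation (\<lambda>\<omega>. (Y \<omega>)\<^sup>2) = v"
proof -
  have law: "distr M borel Y = distr std_normal borel (\<lambda>w. sqrt v * w)"
  proof (rule Levy_uniqueness)
    show "real_distribution (distr M borel Y)" by (intro real_distribution_distr) auto
    show "real_distribution (distr std_normal borel (\<lambda>w. sqrt v * w))" by (intro std_normal.real_distribution_distr) auto
    show "char (distr M borel Y) = char (distr std_normal borel (\<lambda>w. sqrt v * w))"
    proof
      fix t
      have "char (distr std_normal borel (\<lambda>w. sqrt v * w)) t = char (distr std_normal borel (\<lambda>w. w)) (t * sqrt v)"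
        by (rule std_normal.char_distr_cmult) auto
      also have "distr std_normal borel (\<lambda>w. w) = std_normal" by (rule distr_id2) simp
      also have "char std_normal (t * sqrt v) = exp (- (t\<^sup>2 * v / 2))"
        using v by (simp add: char_std_normal_distribution power_mult_distrib)
      finally show "char (distr M borel Y) t = char (distr std_normal borel (\<lambda>w. sqrt v * w)) t" using ch by simp
    qed
  qed
  have transfer: "integrable M (\<lambda>\<omega>. g (Y \<omega>)) = integrable std_normal (\<lambda>w. g (sqrt v * w))"
    "expectation (\<lambda>\<omega>. g (Y \<omega>)) = (\<integral>w. g (sqrt v * w) \<partial>std_normal)"
    if [measurable]: "g \<in> borel_measurable borel" for g :: "real \<Rightarrow> real"
  proof -
    have "integrable M (\<lambda>\<omega>. g (Y \<omega>)) = integrable (distr M borel Y) g"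
      by (subst integrable_distr_eq) auto
    also have "\<dots> = integrable std_normal (\<lambda>w. g (sqrt v * w))"
      unfolding law by (subst integrable_distr_eq) auto
    finally show "integrable M (\<lambda>\<omega>. g (Y \<omega>)) = integrable std_normal (\<lambda>w. g (sqrt v * w))" .
    have "expectation (\<lambda>\<omega>. g (Y \<omega>)) = (\<integral>y. g y \<partial>distr M borel Y)"
      by (subst integral_distr) auto
    also have "\<dots> = (\<integral>w. g (sqrt v * w) \<partial>std_normal)"
      unfolding law by (subst integral_distr) auto
    finally show "expectation (\<lambda>\<omega>. g (Y \<omega>)) = (\<integral>w. g (sqrt v * w) \<partial>std_normal)" .
  qed
  have id: "(\<lambda>y::real. y) \<in> borel_measurable borel" and sq: "(\<lambda>y::real. y\<^sup>2) \<in> borel_measurable borel"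
    by measurable
  have "integrable std_normal (\<lambda>w. sqrt v * w)" by (intro integrable_mult_right std_normal_moments)
  then show "integrable M Y" using transfer(1)[OF id] by (rule iffD2[rotated])
  have "(\<integral>w. sqrt v * w \<partial>std_normal) = 0" by (simp add: std_normal_moments)
  then show "expectation Y = 0" by (rule trans[OF transfer(2)[OF id]])
  have "integrable std_normal (\<lambda>w. (sqrt v * w)\<^sup>2)"
    unfolding power_mult_distrib by (intro integrable_mult_right std_normal_moments)
  then show "integrable M (\<lambda>\<omega>. (Y \<omega>)\<^sup>2)" using transfer(1)[OF sq] by (rule iffD2[rotated])
  have "(\<integral>w. (sqrt v * w)\<^sup>2 \<partial>std_normal) = v"
    unfolding power_mult_distrib using v by (simp add: std_normal_moments)
  then show "expectation (\<lambda>\<omega>. (Y \<omega>)\<^sup>2) = v" by (rule trans[OF transfer(2)[OF sq]])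
  show "gaussian_rv M Y"
  proof (cases "v = 0")
    case True
    have "AE y in distr M borel Y. y = 0" unfolding law by (subst AE_distr_iff) (auto simp: True)
    then have "AE \<omega> in M. Y \<omega> = 0" by (subst (asm) AE_distr_iff) auto
    then show ?thesis by (auto simp: gaussian_rv_def)
  next
    case False
    then have v: "0 < v" using v by simp
    have "distributed std_normal lborel (\<lambda>w. w) std_normal_density"
      by (auto simp: distributed_def distr_id2)
    from std_normal.normal_density_affine[OF this _ , of "sqrt v" 0]
    have "distributed std_normal lborel (\<lambda>w. sqrt v * w) (normal_density 0 (sqrt v))" using v by simp
    then have "distr std_normal lborel (\<lambda>w. sqrt v * w) = density lborel (normal_density 0 (sqrt v))"
      by (rule distributed_distr_eq_density)
    moreover have "distr std_normal lborel (\<lambda>w. sqrt v * w) = distr std_normal borel (\<lambda>w. sqrt v * w)" "distr M lborel Y = distr M borel Y"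
      by (auto intro!: distr_cong)
    ultimately have "distributed M lborel Y (normal_density 0 (sqrt v))"
      using law by (simp add: distributed_def)
    then show ?thesis using v unfolding gaussian_rv_def by (intro conjI disjI1 exI[of _ 0] exI[of _ "sqrt v"]) auto
  qed
qed

context process
begin

text \<open>The centred increment is normal with variance \<open>1 / 2\<close>, so the uncentred one
  has energy \<open>G 1 a\<close> with its normalised drift \<open>a\<close>. This energy is
  prescribed as \<open>G 1 0\<close>, and \<open>G_inj\<close> forces \<open>a = 0\<close>.\<close>

lemma first_half_char: "char (distr M borel (\<lambda>\<omega>. X (1 / 2) \<omega> - X 0 \<omega>)) t = exp (- (t\<^sup>2 / 4))"
proof -
  have [measurable]: "U 0 (1 / 2) \<in> borel_measurable M" by (rule U_meas) auto
  have law: "distr M borel (\<lambda>\<omega>. sqrt 2 * U 0 (1 / 2) \<omega>) = std_normal"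
  proof (rule Levy_uniqueness)
    show "real_distribution (distr M borel (\<lambda>\<omega>. sqrt 2 * U 0 (1 / 2) \<omega>))" by (intro real_distribution_distr) auto
    show "real_distribution std_normal" by (rule real_dist_normal_dist)
    show "char (distr M borel (\<lambda>\<omega>. sqrt 2 * U 0 (1 / 2) \<omega>)) = char std_normal"
      by (auto simp: fun_eq_iff char_distr_cmult char_half char_std_normal_distribution power_mult_distrib)
  qed
  define a where "a = sqrt 2 * m 0 (1 / 2)"
  have "G 1 0 = expectation (\<lambda>\<omega>. f ((X (1 / 2) \<omega> - X 0 \<omega>) / sqrt (1 / 2 - 0)))"
    using X_energy[of 0 "1 / 2"] by simp
  also have "\<dots> = expectation (\<lambda>\<omega>. f (a + sqrt 2 * U 0 (1 / 2) \<omega>))"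
    by (simp add: a_def U_def real_sqrt_divide algebra_simps)
  also have "\<dots> = (\<integral>y. f (a + y) \<partial>distr M borel (\<lambda>\<omega>. sqrt 2 * U 0 (1 / 2) \<omega>))"
    by (subst integral_distr) auto
  also have "\<dots> = G 1 a" unfolding law by (simp add: G_def)
  finally have "\<bar>a\<bar> = \<bar>0\<bar>" by (intro G_inj[of 1]) auto
  then have "m 0 (1 / 2) = 0" by (simp add: a_def)
  then have "U 0 (1 / 2) = (\<lambda>\<omega>. X (1 / 2) \<omega> - X 0 \<omega>)" by (simp add: U_def fun_eq_iff)
  then show ?thesis using char_half[of t] by simp
qed

text \<open>Negative \<open>c\<close> runs time backwards, which turns the second half of an interval into the first.\<close>

lemma rescale:
  assumes c: "c \<noteq> 0" and a: "a \<in> {0..1}" "a + c \<in> {0..1}"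
  shows "process f p D M (\<lambda>u \<omega>. X (a + c * u) \<omega> / sqrt \<bar>c\<bar>)"
proof unfold_locales
  have r: "a + c * u \<in> {0..1}" if "0 \<le> u" "u \<le> 1" for u
  proof -
    have "(1 - u) * a + u * (a + c) \<in> {0..1}"
      using convexD_alt[OF convex_real_interval(5) a(1) a(2), of u] that by simp
    then show ?thesis by (simp add: algebra_simps)
  qed
  show "(\<lambda>\<omega>. X (a + c * t) \<omega> / sqrt \<bar>c\<bar>) \<in> borel_measurable M" if "t \<in> {0..1}" for t
  proof -
    have [measurable]: "X (a + c * t) \<in> borel_measurable M" using that by (intro X_meas r) auto
    show ?thesis by measurable
  qed
  show "indep_var borel (\<lambda>\<omega>. X (a + c * t) \<omega> / sqrt \<bar>c\<bar> - X (a + c * s) \<omega> / sqrt \<bar>c\<bar>)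
      borel (\<lambda>\<omega>. X (a + c * u) \<omega> / sqrt \<bar>c\<bar> - X (a + c * t) \<omega> / sqrt \<bar>c\<bar>)"
    if "0 \<le> s" "s < t" "t < u" "u \<le> 1" for s t u
  proof (cases "0 < c")
    case True
    have "indep_var borel (\<lambda>\<omega>. X (a + c * t) \<omega> - X (a + c * s) \<omega>) borel (\<lambda>\<omega>. X (a + c * u) \<omega> - X (a + c * t) \<omega>)"
      using True r[of s] r[of u] that by (intro X_indep) auto
    from indep_var_compose[OF this, of "\<lambda>y. y / sqrt \<bar>c\<bar>" borel "\<lambda>y. y / sqrt \<bar>c\<bar>" borel]
    show ?thesis by (simp add: o_def diff_divide_distrib)
  next
    case False
    then have "indep_var borel (\<lambda>\<omega>. X (a + c * t) \<omega> - X (a + c * u) \<omega>) borel (\<lambda>\<omega>. X (a + c * s) \<omega> - X (a + c * t) \<omega>)"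
      using c r[of s] r[of u] that by (intro X_indep) auto
    from indep_var_compose[OF indep_var_commute[OF this], of "\<lambda>y. - y / sqrt \<bar>c\<bar>" borel "\<lambda>y. - y / sqrt \<bar>c\<bar>" borel]
    show ?thesis by (simp add: o_def diff_divide_distrib)
  qed
  show "integrable M (\<lambda>\<omega>. f ((X (a + c * t) \<omega> / sqrt \<bar>c\<bar> - X (a + c * s) \<omega> / sqrt \<bar>c\<bar>) / sqrt (t - s))) \<and>
      expectation (\<lambda>\<omega>. f ((X (a + c * t) \<omega> / sqrt \<bar>c\<bar> - X (a + c * s) \<omega> / sqrt \<bar>c\<bar>) / sqrt (t - s))) = G 1 0"
    if st: "0 \<le> s" "s < t" "t \<le> 1" for s t
  proof -
    \<comment> \<open>Evenness of \<open>f\<close> makes the normalised energy independent of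
      orientation, so sorting the end points treats both signs of \<open>c\<close>.\<close>
    have "f ((X (a + c * t) \<omega> / sqrt \<bar>c\<bar> - X (a + c * s) \<omega> / sqrt \<bar>c\<bar>) / sqrt (t - s))
      = f ((X (max (a + c * s) (a + c * t)) \<omega> - X (min (a + c * s) (a + c * t)) \<omega>)
          / sqrt (max (a + c * s) (a + c * t) - min (a + c * s) (a + c * t)))" for \<omega>
    proof (cases "0 < c")
      case True
      have "a + c * s \<le> a + c * t" using True st by simp
      moreover have "a + c * t - (a + c * s) = \<bar>c\<bar> * (t - s)" using True by (simp add: algebra_simps)
      ultimately show ?thesis
        by (simp add: real_sqrt_mult diff_divide_distrib[symmetric] max_def min_def mult.commute)
    next
      case False
      have "a + c * t \<le> a + c * s" using False st by (simp add: mult_left_mono_neg)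
      moreover have "a + c * s - (a + c * t) = \<bar>c\<bar> * (t - s)" using False by (simp add: algebra_simps)
      ultimately show ?thesis
        using even[of "(X (a + c * t) \<omega> - X (a + c * s) \<omega>) / (sqrt \<bar>c\<bar> * sqrt (t - s))"]
        by (simp add: real_sqrt_mult diff_divide_distrib[symmetric] max_def min_def minus_divide_left)
    qed
    moreover have "a + c * s \<noteq> a + c * t" using c st by simp
    then have "min (a + c * s) (a + c * t) < max (a + c * s) (a + c * t)" by linarith
    moreover have "0 \<le> min (a + c * s) (a + c * t)" "max (a + c * s) (a + c * t) \<le> 1" using r[of s] r[of t] st by auto
    ultimately show ?thesis using X_energy by simp
  qed
qed

lemma half_char:
  assumes c: "c \<noteq> 0" and a: "a \<in> {0..1}" "a + c \<in> {0..1}"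
  shows "char (distr M borel (\<lambda>\<omega>. X (a + c / 2) \<omega> - X a \<omega>)) t = exp (- (t\<^sup>2 * \<bar>c\<bar> / 4))"
proof -
  interpret P: process f p D M "\<lambda>u \<omega>. X (a + c * u) \<omega> / sqrt \<bar>c\<bar>" by (rule rescale[OF assms])
  have "(\<lambda>\<omega>. X (a + c * (1 / 2)) \<omega> / sqrt \<bar>c\<bar> - X (a + c * 0) \<omega> / sqrt \<bar>c\<bar>) \<in> borel_measurable M"
    by (intro borel_measurable_diff P.X_meas) auto
  from char_distr_cmult[OF this, of "sqrt \<bar>c\<bar>" t]
  have "char (distr M borel (\<lambda>\<omega>. X (a + c / 2) \<omega> - X a \<omega>)) t
    = char (distr M borel (\<lambda>\<omega>. X (a + c * (1 / 2)) \<omega> / sqrt \<bar>c\<bar> - X (a + c * 0) \<omega> / sqrt \<bar>c\<bar>)) (t * sqrt \<bar>c\<bar>)"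
    using c by (simp add: right_diff_distrib)
  also have "\<dots> = exp (- (t\<^sup>2 * \<bar>c\<bar> / 4))"
    unfolding P.first_half_char by (simp add: power_mult_distrib)
  finally show ?thesis .
qed

text \<open>\<open>half_char\<close> gives the first half forwards from \<open>s\<close> and the
  second backwards from \<open>u\<close>, with negative \<open>c\<close>. The halves are adjacent,
  hence independent, and their characteristic functions multiply.\<close>

lemma increment_char:
  assumes "0 \<le> s" "s < u" "u \<le> 1"
  shows "char (distr M borel (\<lambda>\<omega>. X u \<omega> - X s \<omega>)) t = exp (- (t\<^sup>2 * (u - s) / 2))"
proof -
  define h where "h = s + (u - s) / 2"
  have h: "s < h" "h < u" "u + (s - u) / 2 = h" using assms by (auto simp: h_def field_simps)
  have a: "char (distr M borel (\<lambda>\<omega>. X h \<omega> - X s \<omega>)) t = exp (- (t\<^sup>2 * (u - s) / 4))"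
    using half_char[of "u - s" s t] assms by (simp add: h_def)
  have "char (distr M borel (\<lambda>\<omega>. X h \<omega> - X u \<omega>)) (- t) = exp (- (t\<^sup>2 * (u - s) / 4))"
    using half_char[of "s - u" u "- t"] assms h(3) by simp
  moreover have "(\<lambda>\<omega>. X h \<omega> - X u \<omega>) \<in> borel_measurable M" using h assms by (intro borel_measurable_diff X_meas) auto
  from char_distr_cmult[OF this, of "- 1" t]
  have "char (distr M borel (\<lambda>\<omega>. X u \<omega> - X h \<omega>)) t = char (distr M borel (\<lambda>\<omega>. X h \<omega> - X u \<omega>)) (- t)" by simp
  ultimately have b: "char (distr M borel (\<lambda>\<omega>. X u \<omega> - X h \<omega>)) t = exp (- (t\<^sup>2 * (u - s) / 4))" by simp
  have "indep_var borel (\<lambda>\<omega>. X h \<omega> - X s \<omega>) borel (\<lambda>\<omega>. X u \<omega> - X h \<omega>)"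
    using h assms by (intro X_indep) auto
  from char_distr_add[OF this, of t]
  have "char (distr M borel (\<lambda>\<omega>. X u \<omega> - X s \<omega>)) t = complex_of_real (exp (- (t\<^sup>2 * (u - s) / 4)) * exp (- (t\<^sup>2 * (u - s) / 4)))"
    unfolding a b by simp
  also have "exp (- (t\<^sup>2 * (u - s) / 4)) * exp (- (t\<^sup>2 * (u - s) / 4)) = exp (- (t\<^sup>2 * (u - s) / 2))"
    by (simp add: exp_add[symmetric])
  finally show ?thesis .
qed

lemma increment_moments:
  assumes "0 \<le> s" "s < u" "u \<le> 1"
  shows "expectation (\<lambda>\<omega>. X u \<omega> - X s \<omega>) = 0"
    "integrable M (\<lambda>\<omega>. (X u \<omega> - X s \<omega>)\<^sup>2)" "expectation (\<lambda>\<omega>. (X u \<omega> - X s \<omega>)\<^sup>2) = u - s"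
proof -
  have "(\<lambda>\<omega>. X u \<omega> - X s \<omega>) \<in> borel_measurable M" using assms by (intro dX_meas) auto
  note g = gaussian_of_char[OF this, of "u - s"]
  show "expectation (\<lambda>\<omega>. X u \<omega> - X s \<omega>) = 0"
    "integrable M (\<lambda>\<omega>. (X u \<omega> - X s \<omega>)\<^sup>2)" "expectation (\<lambda>\<omega>. (X u \<omega> - X s \<omega>)\<^sup>2) = u - s"
    using g assms increment_char[OF assms] by auto
qed

lemma covariance:
  assumes "0 \<le> s" "s \<le> u" "u \<le> 1"
  shows "expectation (\<lambda>\<omega>. (X u \<omega> - X 0 \<omega>) * (X s \<omega> - X 0 \<omega>)) = s"
proof (cases "s = 0 \<or> s = u")
  case True
  then show ?thesis using increment_moments(3)[of 0 u] assms by (cases "s = 0"; cases "u = 0") (auto simp: power2_eq_square)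
next
  case False
  then have su: "0 < s" "s < u" using assms by auto
  have i: "indep_var borel (\<lambda>\<omega>. X s \<omega> - X 0 \<omega>) borel (\<lambda>\<omega>. X u \<omega> - X s \<omega>)"
    using su assms by (intro X_indep) auto
  have int: "integrable M (\<lambda>\<omega>. X s \<omega> - X 0 \<omega>)" "integrable M (\<lambda>\<omega>. X u \<omega> - X s \<omega>)"
    using su assms by (auto intro!: dX_mean(1))
  note p = indep_var_integrable[OF i int] indep_var_lebesgue_integral[OF i int]
  have "expectation (\<lambda>\<omega>. (X u \<omega> - X 0 \<omega>) * (X s \<omega> - X 0 \<omega>))
    = expectation (\<lambda>\<omega>. (X s \<omega> - X 0 \<omega>) * (X u \<omega> - X s \<omega>) + (X s \<omega> - X 0 \<omega>)\<^sup>2)"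
    by (intro Bochner_Integration.integral_cong) (auto simp: power2_eq_square algebra_simps)
  also have "\<dots> = expectation (\<lambda>\<omega>. X s \<omega> - X 0 \<omega>) * expectation (\<lambda>\<omega>. X u \<omega> - X s \<omega>) + s"
    using p increment_moments(2,3)[of 0 s] su assms by simp
  finally show ?thesis using increment_moments(1)[of 0 s] su assms by simp
qed

text \<open>Summation by parts over the sorted time points rewrites the combination in increments,
  which are independent and normal.\<close>

lemma linear_combination:
  fixes b :: "real \<Rightarrow> real"
  assumes ind: "independent_increments M {0..1} X" and J: "finite J" "J \<subseteq> {0..1}"
  shows "\<exists>v\<ge>0. \<forall>t. char (distr M borel (\<lambda>\<omega>. \<Sum>s\<in>J. b s * (X s \<omega> - X 0 \<omega>))) t = exp (- (t\<^sup>2 * v / 2))"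
proof -
  \<comment> \<open>Time \<open>0\<close> is added so that each difference
    \<open>X s \<omega> - X 0 \<omega>\<close> telescopes along the grid.\<close>
  define J' where "J' = insert 0 J"
  define xs where "xs = sorted_list_of_set J'"
  define \<tau> where "\<tau> i = xs ! i" for i
  define n where "n = length xs - 1"
  have J': "finite J'" "J' \<subseteq> {0..1}" "0 \<in> J'" using J by (auto simp: J'_def)
  have xs: "set xs = J'" "sorted_wrt (<) xs" using J' by (auto simp: xs_def)
  have len: "length xs = Suc n" using J'(3) xs(1) by (cases xs) (auto simp: n_def)
  have img: "\<tau> ` {..n} = J'"
    unfolding xs(1)[symmetric] \<tau>_def[abs_def] set_conv_nth len by (auto simp: less_Suc_eq_le)
  have sm: "\<tau> i < \<tau> k" if "i < k" "k \<le> n" for i k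
    using sorted_wrt_nth_less[OF xs(2), of i k] that len by (simp add: \<tau>_def)
  have smo: "strict_mono_on {..n} \<tau>" by (auto simp: strict_mono_on_def intro: sm)
  have \<tau>0: "\<tau> 0 = 0"
  proof -
    obtain i where i: "i \<le> n" "\<tau> i = 0" using img J'(3) by (metis atMost_iff imageE)
    have "\<tau> 0 \<ge> 0" using img J'(2) by force
    then show ?thesis using sm[of 0 i] i by (cases i) auto
  qed
  have \<tau>r: "0 \<le> \<tau> i" "\<tau> i \<le> 1" if "i \<le> n" for i using img J'(2) that by force+
  define I where "I i \<omega> = X (\<tau> (Suc i)) \<omega> - X (\<tau> i) \<omega>" for i \<omega>
  have indI: "indep_vars (\<lambda>_. borel) I {..<n}"
    using ind img J'(2) smo unfolding independent_increments_def I_def[abs_def] by blast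
  \<comment> \<open>The added time \<open>0\<close> may lie outside \<open>J\<close> and then gets
    coefficient \<open>0\<close>.\<close>
  define b' where "b' s = (if s \<in> J then b s else 0)" for s
  define c where "c i = (\<Sum>k\<in>{i<..n}. b' (\<tau> k))" for i
  define v where "v = (\<Sum>i<n. (c i)\<^sup>2 * (\<tau> (Suc i) - \<tau> i))"
  have inj: "inj_on \<tau> {..n}" using smo by (rule strict_mono_on_imp_inj_on)
  have sum: "(\<Sum>s\<in>J. b s * (X s \<omega> - X 0 \<omega>)) = (\<Sum>i<n. c i * I i \<omega>)" for \<omega>
  proof -
    have "(\<Sum>s\<in>J. b s * (X s \<omega> - X 0 \<omega>)) = (\<Sum>s\<in>J'. b' s * (X s \<omega> - X 0 \<omega>))"
      by (intro sum.mono_neutral_cong_left) (use J' in \<open>auto simp: J'_def b'_def\<close>)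
    also have "\<dots> = (\<Sum>k\<le>n. b' (\<tau> k) * (X (\<tau> k) \<omega> - X 0 \<omega>))"
      unfolding img[symmetric] by (simp add: sum.reindex[OF inj])
    also have "\<dots> = (\<Sum>k\<le>n. \<Sum>i<k. b' (\<tau> k) * I i \<omega>)"
      unfolding sum_distrib_left[symmetric] I_def
      by (simp add: sum_lessThan_telescope[of "\<lambda>i. X (\<tau> i) \<omega>"] \<tau>0)
    also have "\<dots> = (\<Sum>k\<le>n. \<Sum>i<n. if i < k then b' (\<tau> k) * I i \<omega> else 0)"
      by (intro sum.cong refl sum.mono_neutral_cong_left) auto
    also have "\<dots> = (\<Sum>i<n. \<Sum>k\<le>n. if i < k then b' (\<tau> k) * I i \<omega> else 0)" by (rule sum.swap)
    also have "\<dots> = (\<Sum>i<n. \<Sum>k\<in>{i<..n}. b' (\<tau> k) * I i \<omega>)"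
      by (intro sum.cong refl sum.mono_neutral_cong_right) auto
    also have "\<dots> = (\<Sum>i<n. c i * I i \<omega>)" by (simp add: c_def sum_distrib_right)
    finally show ?thesis .
  qed
  have indC: "indep_vars (\<lambda>_. borel) (\<lambda>i \<omega>. c i * I i \<omega>) {..<n}"
    by (rule indep_vars_compose2[OF indI]) measurable
  have "char (distr M borel (\<lambda>\<omega>. \<Sum>s\<in>J. b s * (X s \<omega> - X 0 \<omega>))) t = exp (- (t\<^sup>2 * v / 2))" for t
  proof -
    have "char (distr M borel (\<lambda>\<omega>. \<Sum>s\<in>J. b s * (X s \<omega> - X 0 \<omega>))) t
      = (\<Prod>i<n. char (distr M borel (\<lambda>\<omega>. c i * I i \<omega>)) t)"
      unfolding sum by (rule char_distr_sum[OF indC])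
    also have "\<dots> = (\<Prod>i<n. complex_of_real (exp (- (t\<^sup>2 * ((c i)\<^sup>2 * (\<tau> (Suc i) - \<tau> i)) / 2))))"
    proof (rule prod.cong[OF refl])
      fix i assume "i \<in> {..<n}"
      then have i: "\<tau> i < \<tau> (Suc i)" "0 \<le> \<tau> i" "\<tau> (Suc i) \<le> 1" using sm[of i "Suc i"] \<tau>r[of i] \<tau>r[of "Suc i"] by auto
      have "I i \<in> borel_measurable M" unfolding I_def[abs_def] using i by (intro dX_meas) auto
      then have "char (distr M borel (\<lambda>\<omega>. c i * I i \<omega>)) t = char (distr M borel (I i)) (t * c i)" by (rule char_distr_cmult)
      also have "\<dots> = exp (- ((t * c i)\<^sup>2 * (\<tau> (Suc i) - \<tau> i) / 2))"
        unfolding I_def[abs_def] by (rule increment_char) (use i in auto)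
      finally show "char (distr M borel (\<lambda>\<omega>. c i * I i \<omega>)) t = complex_of_real (exp (- (t\<^sup>2 * ((c i)\<^sup>2 * (\<tau> (Suc i) - \<tau> i)) / 2)))"
        by (simp add: power_mult_distrib mult.assoc)
    qed
    also have "\<dots> = exp (- (t\<^sup>2 * v / 2))"
      unfolding of_real_prod[symmetric] exp_sum[symmetric, OF finite_lessThan]
      by (simp add: v_def sum_negf sum_distrib_left sum_divide_distrib)
    finally show ?thesis .
  qed
  moreover have "0 \<le> v" unfolding v_def
    by (intro sum_nonneg mult_nonneg_nonneg) (use sm in \<open>auto intro: less_imp_le\<close>)
  ultimately show ?thesis by blast
qed

end

section \<open>From the hypotheses to Brownian motion\<close>

lemma process_of_hypotheses:
  fixes M :: "'a measure" and N :: "'b measure"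
  assumes F: "energy f p D"
    and X: "real_process M {0..1} X" and ind: "independent_increments M {0..1} X"
    and N: "prob_space N" and W: "distributed N lborel W std_normal_density"
    and E: "\<And>s t. 0 \<le> s \<Longrightarrow> 0 < t \<Longrightarrow> s + t \<le> 1 \<Longrightarrow>
           (\<integral>\<omega>. f (t powr (- 1 / 2) * (X (t + s) \<omega> - X s \<omega>)) \<partial>M) = (\<integral>\<omega>. f (W \<omega>) \<partial>N)"
  shows "process f p D M X"
proof -
  interpret energy f p D by (rule F)
  interpret prob_space M using X by (simp add: real_process_def)
  interpret N: prob_space N by (rule N)
  have "(\<integral>\<omega>. f (W \<omega>) \<partial>N) = (\<integral>y. f y \<partial>distr N lborel W)"
    using distributed_measurable[OF W] by (subst integral_distr) auto
  also have "\<dots> = G 1 0" unfolding distributed_distr_eq_density[OF W] by (simp add: G_def)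
  finally have EW: "(\<integral>\<omega>. f (W \<omega>) \<partial>N) = G 1 0" .
  show ?thesis
  proof unfold_locales
    show "X t \<in> borel_measurable M" if "t \<in> {0..1}" for t using X that by (simp add: real_process_def)
    show "indep_var borel (\<lambda>\<omega>. X t \<omega> - X s \<omega>) borel (\<lambda>\<omega>. X u \<omega> - X t \<omega>)" if "0 \<le> s" "s < t" "t < u" "u \<le> 1" for s t u
    proof -
      define \<tau> where "\<tau> i = (if i = 0 then s else if i = 1 then t else u)" for i :: nat
      have "\<tau> ` {..2} \<subseteq> {0..1}" "strict_mono_on {..2} \<tau>"
        using that by (auto simp: \<tau>_def strict_mono_on_def)
      then have i: "indep_vars (\<lambda>_. borel) (\<lambda>i \<omega>. X (\<tau> (Suc i)) \<omega> - X (\<tau> i) \<omega>) {..<2}"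
        using ind unfolding independent_increments_def by blast
      moreover have "{..<2::nat} = insert 0 {1}" by auto
      ultimately have "indep_vars (\<lambda>_. borel) (\<lambda>i \<omega>. X (\<tau> (Suc i)) \<omega> - X (\<tau> i) \<omega>) (insert 0 {1})" by simp
      \<comment> \<open>A sum over the single index \<open>1\<close> turns the indexed form of
        independence into the binary one.\<close>
      from indep_vars_sum[OF _ _ this] show ?thesis by (simp add: \<tau>_def)
    qed
    show "integrable M (\<lambda>\<omega>. f ((X t \<omega> - X s \<omega>) / sqrt (t - s))) \<and>
      expectation (\<lambda>\<omega>. f ((X t \<omega> - X s \<omega>) / sqrt (t - s))) = G 1 0" if st: "0 \<le> s" "s < t" "t \<le> 1" for s t
    proof -
      have "(t - s) powr (- 1 / 2) = inverse ((t - s) powr (1 / 2))" by (simp add: powr_minus[symmetric])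
      then have "(t - s) powr (- 1 / 2) = 1 / sqrt (t - s)" using st by (simp add: powr_half_sqrt inverse_eq_divide)
      then have e: "expectation (\<lambda>\<omega>. f ((X t \<omega> - X s \<omega>) / sqrt (t - s))) = G 1 0"
        using E[of s "t - s"] st EW by simp
      \<comment> \<open>A non-integrable function has integral \<open>0\<close> by convention,
        whereas \<open>G 1 0 > 0\<close>; so the energy identity itself entails
        integrability.\<close>
      then have "integrable M (\<lambda>\<omega>. f ((X t \<omega> - X s \<omega>) / sqrt (t - s)))"
        using G_pos[of 1] not_integrable_integral_eq by fastforce
      with e show ?thesis by simp
    qed
  qed
qed

theorem corollary2:
  fixes f :: "real \<Rightarrow> real"
    and M :: "'a measure" and X :: "real \<Rightarrow> 'a \<Rightarrow> real"
    and N :: "'b measure" and W :: "'b \<Rightarrow> real"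
  assumes "condition_F f"
    and "real_process M {0..1} X"
    and "independent_increments M {0..1} X"
    and "AE \<omega> in M. X 0 \<omega> = 0"
    and "prob_space N"
    and "distributed N lborel W std_normal_density"
    and "\<And>s t. 0 \<le> s \<Longrightarrow> 0 < t \<Longrightarrow> s + t \<le> 1 \<Longrightarrow>
           (\<integral>\<omega>. f (t powr (- 1 / 2) * (X (t + s) \<omega> - X s \<omega>)) \<partial>M) = (\<integral>\<omega>. f (W \<omega>) \<partial>N)"
  shows "standard_brownian_motion M X"
proof -
  obtain p D where F: "energy f p D" using condition_F_energy[OF assms(1)] .
  interpret process f p D M X by (rule process_of_hypotheses[OF F assms(2,3,5,6,7)])
  have Xm: "X t \<in> borel_measurable M" if "t \<in> {0..1}" for t by (rule X_meas[OF that])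
  have X0[measurable]: "X 0 \<in> borel_measurable M" by (rule Xm) simp
  have "gaussian_rv M (\<lambda>\<omega>. \<Sum>t\<in>J. a t * X t \<omega>)" if J: "finite J" "J \<subseteq> {0..1}" for J a
  proof -
    obtain v where v: "0 \<le> v" "\<And>t. char (distr M borel (\<lambda>\<omega>. \<Sum>s\<in>J. a s * (X s \<omega> - X 0 \<omega>))) t = exp (- (t\<^sup>2 * v / 2))"
      using linear_combination[OF assms(3) J, of a] by blast
    have m1: "(\<lambda>\<omega>. \<Sum>s\<in>J. a s * (X s \<omega> - X 0 \<omega>)) \<in> borel_measurable M"
      using J by (intro borel_measurable_sum borel_measurable_times borel_measurable_diff borel_measurable_const Xm) auto
    have m2: "(\<lambda>\<omega>. \<Sum>s\<in>J. a s * X s \<omega>) \<in> borel_measurable M"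
      using J by (intro borel_measurable_sum borel_measurable_times borel_measurable_const Xm) auto
    \<comment> \<open>\<open>X 0\<close> vanishes only almost everywhere, so Gaussianity is carried
      over through equality of laws.\<close>
    have "AE \<omega> in M. (\<Sum>s\<in>J. a s * (X s \<omega> - X 0 \<omega>)) = (\<Sum>s\<in>J. a s * X s \<omega>)"
      using assms(4) by eventually_elim simp
    then have "distr M borel (\<lambda>\<omega>. \<Sum>s\<in>J. a s * (X s \<omega> - X 0 \<omega>)) = distr M borel (\<lambda>\<omega>. \<Sum>s\<in>J. a s * X s \<omega>)"
      by (intro distr_cong_AE m1 m2) auto
    then show ?thesis using v by (intro gaussian_of_char(1)[OF m2 v(1)]) simp
  qed
  then have "gaussian_process M {0..1} X" using assms(2) by (simp add: gaussian_process_def)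
  moreover have "expectation (X t) = 0" if t: "t \<in> {0..1}" for t
  proof -
    have "expectation (X t) = expectation (\<lambda>\<omega>. X t \<omega> - X 0 \<omega>)"
      using assms(4) Xm[OF t] by (intro integral_cong_AE) auto
    then show ?thesis using increment_moments(1)[of 0 t] t by (cases "t = 0") auto
  qed
  moreover have "expectation (\<lambda>\<omega>. X t \<omega> * X s \<omega>) = min t s" if s: "s \<in> {0..1}" and t: "t \<in> {0..1}" for s t
  proof -
    have "expectation (\<lambda>\<omega>. X t \<omega> * X s \<omega>) = expectation (\<lambda>\<omega>. (X t \<omega> - X 0 \<omega>) * (X s \<omega> - X 0 \<omega>))"
      using assms(4) Xm[OF t] Xm[OF s] by (intro integral_cong_AE) auto
    also have "\<dots> = min t s"
    proof (cases "s \<le> t")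
      case True then show ?thesis using covariance[of s t] s t by simp
    next
      case False then show ?thesis using covariance[of t s] s t by (simp add: mult.commute)
    qed
    finally show ?thesis .
  qed
  ultimately show ?thesis using assms(3) by (simp add: standard_brownian_motion_def)
qed

end
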